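(* Let $(\mathcal A,U,\Omega)$ be a conformal net. Then $\operatorname{UCP}(\mathcal A)$ is a compact Hausdorff convex set.
   Context: Conformal nets. Let $\mathcal I$ be the set of non-empty, non-dense open intervals of $S^1$; for $I\in\mathcal I$ let $I'$ be the interior of $S^1\setminus I$. $\mathrm{PSL}(2,\mathbb R)$ acts on $S^1$ by Möbius transformations, $\mathrm{Diff}_+(S^1)$ is the group of orientation preserving diffeomorphisms of $S^1$, and $\mathrm{Diff}_+(I)$ is the subgroup of $\gamma$ with $\gamma(z)=z$ for all $z\in I'$. A conformal net $(\mathcal A,U,\Omega)$ consists of von Neumann algebras $\mathcal A(I)\subset B(\mathcal H)$, $I\in\mathcal I$, on a common complex separable Hilbert space $\mathcal H$, a strongly continuous projective unitary representation $U$ of $\mathrm{Diff}_+(S^1)$ on $\mathcal H$ extending a strongly continuous unitary representation (also denoted $U$) of $\mathrm{PSL}(2,\mathbb R)$, and a unit vector $\Omega\in\mathcal H$, such that: (isotony) $\mathcal A(I_1)\subset\mathcal A(I_2)$ if $I_1\subset I_2$; (locality) $\mathcal A(I_1)\subset\mathcal A(I_2)'$ if $I_1\cap I_2=\emptyset$; (covariance) $U(\gamma)\mathcal A(I)U(\gamma)^{-1}=\mathcal A(\gamma I)$ for $\gamma\in\mathrm{Diff}_+(S^1)$, and $U(\gamma)xU(\gamma)^{-1}=x$ for $x\in\mathcal A(I)$, $\gamma\in\mathrm{Diff}_+(I')$; (positive energy) the generator of the rotation subgroup of $\mathrm{PSL}(2,\mathbb R)$ has non-negative spectrum; (vacuum)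 $\Omega$ is the unique vector up to a phase with $U(g)\Omega=\Omega$ for all $g\in\mathrm{PSL}(2,\mathbb R)$, and the vectors $x\Omega$, $x\in\bigvee_{I}\mathcal A(I)$, are dense in $\mathcal H$. (Standard fact: $\Omega$ is cyclic and separating for each $\mathcal A(I)$.) Let $\omega_I=(\Omega,\cdot\,\Omega)$ on $\mathcal A(I)$, and $\operatorname{Vir}_{\mathcal A}(I)=\{U(\gamma):\gamma\in\mathrm{Diff}_+(I)\}''\subset\mathcal A(I)$. $\operatorname{UCP}(\mathcal A)$ is the set of collections $\phi=\{\phi_I: I\in\mathcal I\}$ of normal faithful unital completely positive maps $\phi_I:\mathcal A(I)\to\mathcal A(I)$ such that: (i) $\phi_{I_2}|_{\mathcal A(I_1)}=\phi_{I_1}$ whenever $I_1\subset I_2$; (ii) $\omega_I\circ\phi_I=\omega_I$ for every $I$; (iii) $\operatorname{Ad}U(g)\circ\phi_I\circ\operatorname{Ad}U(g)^{-1}=\phi_{gI}$ for every $I\in\mathcal I$, $g\in\mathrm{PSL}(2,\mathbb R)$, and $\phi_I|_{\operatorname{Vir}_{\mathcal A}(I)}=\mathrm{id}$ for every $I$. (Normality and faithfulness are automatic from (ii).) Convex combinations are taken intervalwise. $\operatorname{UCP}(\mathcal A)$ carries the coarsest topology such that the maps $\phi\mapsto\phi_I$ are continuous for every $I\in\mathcal I$, where the set of unital completely positive maps $\mathcal A(I)\to\mathcal A(I)$ has the pointwise ultraweak operator topology. *)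

theory Defs
  imports "HOL-Analysis.Analysis" "HOL-Library.Nonpos_Ints"
begin

section \<open>Complex Hilbert spaces\<close>

text \<open>The inner product is conjugate linear in its first argument, and the real inner product of
  the library is its real part; so norm, topology and completeness are those of the library.\<close>

class complex_hilbert = real_inner + complete_space +
  fixes scaleC :: "complex \<Rightarrow> 'a \<Rightarrow> 'a" (infixr "*\<^sub>C" 75)
    and cinner :: "'a \<Rightarrow> 'a \<Rightarrow> complex"
  assumes scaleC_add_right: "a *\<^sub>C (x + y) = a *\<^sub>C x + a *\<^sub>C y"
    and scaleC_add_left: "(a + b) *\<^sub>C x = a *\<^sub>C x + b *\<^sub>C x"
    and scaleC_scaleC: "a *\<^sub>C (b *\<^sub>C x) = (a * b) *\<^sub>C x"
    and scaleC_of_real: "complex_of_real r *\<^sub>C x = r *\<^sub>R x"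
    and cinner_commute: "cinner x y = cnj (cinner y x)"
    and cinner_add_right: "cinner x (y + z) = cinner x y + cinner x z"
    and cinner_scaleC_right: "cinner x (a *\<^sub>C y) = a * cinner x y"
    and Re_cinner: "Re (cinner x y) = inner x y"

instantiation complex :: complex_hilbert
begin
definition scaleC_complex :: "complex \<Rightarrow> complex \<Rightarrow> complex" where "scaleC_complex a x = a * x"
definition cinner_complex :: "complex \<Rightarrow> complex \<Rightarrow> complex" where "cinner_complex x y = cnj x * y"
instance
  by standard (auto simp: scaleC_complex_def cinner_complex_def algebra_simps inner_complex_def
      scaleR_conv_of_real)
end


section \<open>Bounded operators, von Neumann algebras\<close>

definition bounded_ops :: "('h::complex_hilbert \<Rightarrow> 'h) set" where
  "bounded_ops = {x. bounded_linear x \<and> (\<forall>c \<xi>. x (c *\<^sub>C \<xi>) = c *\<^sub>C x \<xi>)}"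

definition unitary_ops :: "('h::complex_hilbert \<Rightarrow> 'h) set" where
  "unitary_ops = {u \<in> bounded_ops. surj u \<and> (\<forall>\<xi> \<eta>. cinner (u \<xi>) (u \<eta>) = cinner \<xi> \<eta>)}"

definition Ad :: "('h::complex_hilbert \<Rightarrow> 'h) \<Rightarrow> ('h \<Rightarrow> 'h) \<Rightarrow> ('h \<Rightarrow> 'h)" where
  "Ad u x = u \<circ> x \<circ> inv u"

definition adj :: "('h::complex_hilbert \<Rightarrow> 'h) \<Rightarrow> ('h \<Rightarrow> 'h)" where
  "adj x = (THE y. \<forall>\<xi> \<eta>. cinner (y \<xi>) \<eta> = cinner \<xi> (x \<eta>))"

definition commutant :: "('h::complex_hilbert \<Rightarrow> 'h) set \<Rightarrow> ('h \<Rightarrow> 'h) set" where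
  "commutant S = {y \<in> bounded_ops. \<forall>x\<in>S. x \<circ> y = y \<circ> x}"

definition von_neumann_algebra :: "('h::complex_hilbert \<Rightarrow> 'h) set \<Rightarrow> bool" where
  "von_neumann_algebra M \<longleftrightarrow>
     M \<subseteq> bounded_ops \<and> (\<forall>x\<in>M. adj x \<in> M) \<and> commutant (commutant M) = M"


section \<open>Topologies on sets of operators and maps\<close>

text \<open>The coarsest topology on \<open>X\<close> for which all maps \<open>f j\<close>, \<open>j \<in> J\<close>, into \<open>T j\<close> are
  continuous.\<close>

definition coarsest_topology ::
    "'a set \<Rightarrow> 'j set \<Rightarrow> ('j \<Rightarrow> 'a \<Rightarrow> 'b) \<Rightarrow> ('j \<Rightarrow> 'b topology) \<Rightarrow> 'a topology" where
  "coarsest_topology X J f T =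
     topology_generated_by (insert X {{x \<in> X. f j x \<in> V} |j V. j \<in> J \<and> openin (T j) V})"

lemma topspace_coarsest_topology [simp]: "topspace (coarsest_topology X J f T) = X"
  by (auto simp: coarsest_topology_def)

lemma continuous_map_coarsest_topology:
  assumes "j \<in> J" "f j ` X \<subseteq> topspace (T j)"
  shows "continuous_map (coarsest_topology X J f T) (T j) (f j)"
  unfolding continuous_map_def
proof (intro conjI allI impI)
  show "f j \<in> topspace (coarsest_topology X J f T) \<rightarrow> topspace (T j)"
    using assms(2) by auto
next
  fix V assume "openin (T j) V"
  then have "{x \<in> X. f j x \<in> V} \<in>
      insert X {{x \<in> X. f j x \<in> V} |j V. j \<in> J \<and> openin (T j) V}"
    using assms(1) by blast
  then show "openin (coarsest_topology X J f T)
      {x \<in> topspace (coarsest_topology X J f T). f j x \<in> V}"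
    unfolding topspace_coarsest_topology
    unfolding coarsest_topology_def by (rule topology_generated_by_Basis)
qed

definition strong_topology :: "('h::complex_hilbert \<Rightarrow> 'h) set \<Rightarrow> ('h \<Rightarrow> 'h) topology" where
  "strong_topology X = coarsest_topology X UNIV (\<lambda>\<xi> x. x \<xi>) (\<lambda>_. euclidean)"

definition square_summable :: "(nat \<Rightarrow> 'h::complex_hilbert) set" where
  "square_summable = {\<xi>. summable (\<lambda>n. (norm (\<xi> n))\<^sup>2)}"

definition ultraweak_topology :: "('h::complex_hilbert \<Rightarrow> 'h) set \<Rightarrow> ('h \<Rightarrow> 'h) topology" where
  "ultraweak_topology X =
     coarsest_topology X (square_summable \<times> square_summable)
       (\<lambda>(\<xi>, \<eta>) x. \<Sum>n. cinner (\<xi> n) (x (\<eta> n))) (\<lambda>_. euclidean)"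


section \<open>Unital completely positive maps\<close>

definition positive_op :: "('h::complex_hilbert \<Rightarrow> 'h) \<Rightarrow> bool" where
  "positive_op x \<longleftrightarrow> (\<forall>\<xi>. cinner \<xi> (x \<xi>) \<in> \<real>\<^sub>\<ge>\<^sub>0)"

text \<open>Positivity of the operator on the \<open>n\<close>-fold direct sum of the Hilbert space that is given by
  the operator matrix \<open>X\<close>.\<close>

definition positive_matrix :: "nat \<Rightarrow> (nat \<Rightarrow> nat \<Rightarrow> 'h::complex_hilbert \<Rightarrow> 'h) \<Rightarrow> bool" where
  "positive_matrix n X \<longleftrightarrow>
     (\<forall>\<xi>. (\<Sum>i<n. \<Sum>j<n. cinner (\<xi> i) (X i j (\<xi> j))) \<in> \<real>\<^sub>\<ge>\<^sub>0)"

definition completely_positive ::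
    "('h::complex_hilbert \<Rightarrow> 'h) set \<Rightarrow> (('h \<Rightarrow> 'h) \<Rightarrow> ('h \<Rightarrow> 'h)) \<Rightarrow> bool" where
  "completely_positive M \<phi> \<longleftrightarrow>
     (\<forall>x\<in>M. \<forall>y\<in>M. \<forall>c. \<phi> (\<lambda>\<xi>. x \<xi> + c *\<^sub>C y \<xi>) = (\<lambda>\<xi>. \<phi> x \<xi> + c *\<^sub>C \<phi> y \<xi>)) \<and>
     (\<forall>n X. (\<forall>i<n. \<forall>j<n. X i j \<in> M) \<longrightarrow> positive_matrix n X \<longrightarrow>
        positive_matrix n (\<lambda>i j. \<phi> (X i j)))"

definition normal_map ::
    "('h::complex_hilbert \<Rightarrow> 'h) set \<Rightarrow> (('h \<Rightarrow> 'h) \<Rightarrow> ('h \<Rightarrow> 'h)) \<Rightarrow> bool" where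
  "normal_map M \<phi> \<longleftrightarrow> continuous_map (ultraweak_topology M) (ultraweak_topology M) \<phi>"

definition faithful_map ::
    "('h::complex_hilbert \<Rightarrow> 'h) set \<Rightarrow> (('h \<Rightarrow> 'h) \<Rightarrow> ('h \<Rightarrow> 'h)) \<Rightarrow> bool" where
  "faithful_map M \<phi> \<longleftrightarrow> (\<forall>x\<in>M. positive_op x \<longrightarrow> \<phi> x = (\<lambda>_. 0) \<longrightarrow> x = (\<lambda>_. 0))"

definition ucp_maps ::
    "('h::complex_hilbert \<Rightarrow> 'h) set \<Rightarrow> (('h \<Rightarrow> 'h) \<Rightarrow> ('h \<Rightarrow> 'h)) set" where
  "ucp_maps M = {\<phi> \<in> M \<rightarrow>\<^sub>E M. \<phi> id = id \<and> completely_positive M \<phi>}"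

definition pointwise_ultraweak_topology ::
    "('h::complex_hilbert \<Rightarrow> 'h) set \<Rightarrow> (('h \<Rightarrow> 'h) \<Rightarrow> ('h \<Rightarrow> 'h)) topology" where
  "pointwise_ultraweak_topology M =
     coarsest_topology (ucp_maps M) M (\<lambda>x \<phi>. \<phi> x) (\<lambda>_. ultraweak_topology M)"


section \<open>The circle and its diffeomorphisms\<close>

abbreviation S1 :: "complex set" where "S1 \<equiv> sphere 0 1"

definition arcs :: "complex set set" where
  "arcs = {I. openin (top_of_set S1) I \<and> connected I \<and> I \<noteq> {} \<and> closure I \<noteq> S1}"

definition arc_compl :: "complex set \<Rightarrow> complex set" where
  "arc_compl I = (top_of_set S1) interior_of (S1 - I)"

definition smooth :: "(real \<Rightarrow> complex) \<Rightarrow> bool" where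
  "smooth f \<longleftrightarrow> (\<forall>k t. ((\<lambda>g s. vector_derivative g (at s)) ^^ k) f differentiable (at t))"

text \<open>A transformation of the circle is represented by the map of the complex plane that extends
  it by the identity, so that the group operations are composition and \<open>inv\<close>. A function on the
  circle is smooth if it is a smooth function of the angle. The tangent vector of
  \<open>t \<mapsto> \<gamma> (cis t)\<close> is a real multiple of \<open>\<i> * \<gamma> (cis t)\<close>; the last condition says that the factor is
  positive, i.e. that \<open>\<gamma>\<close> preserves the orientation.\<close>

definition Diff :: "(complex \<Rightarrow> complex) set" where
  "Diff = {\<gamma>. bij_betw \<gamma> S1 S1 \<and> (\<forall>z. z \<notin> S1 \<longrightarrow> \<gamma> z = z) \<and>
     smooth (\<gamma> \<circ> cis) \<and> smooth (inv \<gamma> \<circ> cis) \<and>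
     (\<forall>t. Im (cnj (\<gamma> (cis t)) * vector_derivative (\<gamma> \<circ> cis) (at t)) > 0)}"

definition Diff_on :: "complex set \<Rightarrow> (complex \<Rightarrow> complex) set" where
  "Diff_on I = {\<gamma> \<in> Diff. \<forall>z \<in> arc_compl I. \<gamma> z = z}"

text \<open>The smooth topology: uniform convergence of all derivatives with respect to the angle.\<close>

definition Diff_topology :: "(complex \<Rightarrow> complex) topology" where
  "Diff_topology = topology_generated_by
     {{\<delta> \<in> Diff. \<forall>k\<le>n. \<forall>t.
         dist (((\<lambda>g s. vector_derivative g (at s)) ^^ k) (\<delta> \<circ> cis) t)
              (((\<lambda>g s. vector_derivative g (at s)) ^^ k) (\<gamma> \<circ> cis) t) < \<epsilon>}
      |\<gamma> n \<epsilon>. \<gamma> \<in> Diff \<and> \<epsilon> > 0}"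

definition SL2 :: "(real^2^2) set" where
  "SL2 = {A. det A = 1}"

text \<open>The action of a real matrix on the circle: its action by fractional linear transformations on
  the projective line, conjugated by the Cayley transform \<open>x \<mapsto> (x - \<i>) / (x + \<i>)\<close>.\<close>

definition mobius :: "real^2^2 \<Rightarrow> complex \<Rightarrow> complex" where
  "mobius A z =
     (let \<alpha> = Complex ((A$1$1 + A$2$2) / 2) ((A$1$2 - A$2$1) / 2);
          \<beta> = Complex ((A$1$1 - A$2$2) / 2) (- (A$1$2 + A$2$1) / 2)
      in if z \<in> S1 then (\<alpha> * z + \<beta>) / (cnj \<beta> * z + cnj \<alpha>) else z)"

text \<open>Two matrices act in the same way iff they agree up to sign, so this is \<open>PSL(2, \<real>)\<close>.\<close>

definition PSL2 :: "(complex \<Rightarrow> complex) set" where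
  "PSL2 = mobius ` SL2"

definition rotation :: "real \<Rightarrow> complex \<Rightarrow> complex" where
  "rotation t z = (if z \<in> S1 then cis t * z else z)"

lemma rotation_eq_mobius:
  "rotation t = mobius (vector [vector [cos (t/2), sin (t/2)], vector [- sin (t/2), cos (t/2)]])"
proof
  fix z :: complex
  have *: "Complex (cos s) (sin s) = cis s" for s
    by (simp add: complex_eq_iff)
  have "cis t * cis (- (t/2)) = cis (t/2)"
    by (simp add: cis_mult)
  then have "cis (t/2) * z / cis (- (t/2)) = cis t * z"
    by (simp add: divide_eq_eq mult.assoc mult.left_commute[of z])
  moreover have "mobius (vector [vector [cos (t/2), sin (t/2)], vector [- sin (t/2), cos (t/2)]]) z =
      (if z \<in> S1 then cis (t/2) * z / cis (- (t/2)) else z)"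
    unfolding mobius_def by (simp add: * cis_cnj flip: zero_complex.code)
  ultimately show "rotation t z = mobius
      (vector [vector [cos (t/2), sin (t/2)], vector [- sin (t/2), cos (t/2)]]) z"
    by (simp only: rotation_def)
qed


section \<open>One-parameter groups\<close>

text \<open>The generator \<open>L\<close> of a one-parameter unitary group \<open>V t = exp (\<i> t L)\<close>, an operator on the
  domain where \<open>V\<close> is differentiable.\<close>

definition generator_domain :: "(real \<Rightarrow> 'h::complex_hilbert \<Rightarrow> 'h) \<Rightarrow> 'h set" where
  "generator_domain V = {\<xi>. (\<lambda>t. V t \<xi>) differentiable (at 0)}"

definition generator :: "(real \<Rightarrow> 'h::complex_hilbert \<Rightarrow> 'h) \<Rightarrow> 'h \<Rightarrow> 'h" where
  "generator V \<xi> = (- \<i>) *\<^sub>C vector_derivative (\<lambda>t. V t \<xi>) (at 0)"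

definition spectrum :: "'h::complex_hilbert set \<Rightarrow> ('h \<Rightarrow> 'h) \<Rightarrow> complex set" where
  "spectrum D T = {z. \<not> (bij_betw (\<lambda>\<xi>. T \<xi> - z *\<^sub>C \<xi>) D UNIV \<and>
     (\<exists>K. \<forall>\<xi>\<in>D. norm \<xi> \<le> K * norm (T \<xi> - z *\<^sub>C \<xi>)))}"


section \<open>Conformal nets\<close>

text \<open>The projective representation of \<^term>\<open>Diff\<close> is given by unitary representatives \<open>U \<gamma>\<close>, chosen
  on \<^term>\<open>PSL2\<close> so that they form the given representation. Strong continuity of the projective
  representation is continuity into the quotient by the phases of the unitary group with its strong
  topology, and strong continuity on \<^term>\<open>PSL2\<close> is continuity as a map on the group of matrices, of
  which \<open>PSL(2, \<real>)\<close> is a quotient.\<close>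

locale conformal_net =
  fixes A :: "complex set \<Rightarrow> ('h::complex_hilbert \<Rightarrow> 'h) set"
    and U :: "(complex \<Rightarrow> complex) \<Rightarrow> 'h \<Rightarrow> 'h"
    and \<Omega> :: 'h
  assumes separable: "separable_space (euclidean :: 'h topology)"
    and von_neumann: "I \<in> arcs \<Longrightarrow> von_neumann_algebra (A I)"
    and unitary: "\<gamma> \<in> Diff \<Longrightarrow> U \<gamma> \<in> unitary_ops"
    and projective: "\<gamma> \<in> Diff \<Longrightarrow> \<delta> \<in> Diff \<Longrightarrow>
      \<exists>c. cmod c = 1 \<and> U (\<gamma> \<circ> \<delta>) = (\<lambda>\<xi>. c *\<^sub>C U \<gamma> (U \<delta> \<xi>))"
    and projective_continuous:
      "openin (strong_topology unitary_ops) W \<Longrightarrow>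
       (\<And>u c. u \<in> W \<Longrightarrow> cmod c = 1 \<Longrightarrow> (\<lambda>\<xi>. c *\<^sub>C u \<xi>) \<in> W) \<Longrightarrow>
       openin Diff_topology {\<gamma> \<in> Diff. U \<gamma> \<in> W}"
    and representation: "g \<in> PSL2 \<Longrightarrow> h \<in> PSL2 \<Longrightarrow> U (g \<circ> h) = U g \<circ> U h"
    and strongly_continuous: "continuous_on SL2 (\<lambda>a. U (mobius a) \<xi>)"
    and isotony: "I \<in> arcs \<Longrightarrow> J \<in> arcs \<Longrightarrow> I \<subseteq> J \<Longrightarrow> A I \<subseteq> A J"
    and locality: "I \<in> arcs \<Longrightarrow> J \<in> arcs \<Longrightarrow> I \<inter> J = {} \<Longrightarrow> A I \<subseteq> commutant (A J)"
    and covariance: "I \<in> arcs \<Longrightarrow> \<gamma> \<in> Diff \<Longrightarrow> Ad (U \<gamma>) ` A I = A (\<gamma> ` I)"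
    and covariance_local:
      "I \<in> arcs \<Longrightarrow> x \<in> A I \<Longrightarrow> \<gamma> \<in> Diff_on (arc_compl I) \<Longrightarrow> Ad (U \<gamma>) x = x"
    and positive_energy:
      "spectrum (generator_domain (\<lambda>t. U (rotation t))) (generator (\<lambda>t. U (rotation t))) \<subseteq> \<real>\<^sub>\<ge>\<^sub>0"
    and vacuum_norm: "norm \<Omega> = 1"
    and vacuum_invariant: "g \<in> PSL2 \<Longrightarrow> U g \<Omega> = \<Omega>"
    and vacuum_unique:
      "norm \<xi> = 1 \<Longrightarrow> (\<And>g. g \<in> PSL2 \<Longrightarrow> U g \<xi> = \<xi>) \<Longrightarrow> \<exists>c. cmod c = 1 \<and> \<xi> = c *\<^sub>C \<Omega>"
    and vacuum_cyclic:
      "closure ((\<lambda>x. x \<Omega>) ` commutant (commutant (\<Union>I\<in>arcs. A I))) = UNIV"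

definition Vir :: "((complex \<Rightarrow> complex) \<Rightarrow> 'h::complex_hilbert \<Rightarrow> 'h) \<Rightarrow> complex set \<Rightarrow> ('h \<Rightarrow> 'h) set"
  where "Vir U I = commutant (commutant (U ` Diff_on I))"


section \<open>The convex set of a conformal net\<close>

definition UCP ::
    "(complex set \<Rightarrow> ('h::complex_hilbert \<Rightarrow> 'h) set) \<Rightarrow> ((complex \<Rightarrow> complex) \<Rightarrow> 'h \<Rightarrow> 'h) \<Rightarrow> 'h \<Rightarrow>
     (complex set \<Rightarrow> ('h \<Rightarrow> 'h) \<Rightarrow> ('h \<Rightarrow> 'h)) set" where
  "UCP A U \<Omega> = {\<phi> \<in> (\<Pi>\<^sub>E I\<in>arcs. ucp_maps (A I)).
     (\<forall>I\<in>arcs. normal_map (A I) (\<phi> I) \<and> faithful_map (A I) (\<phi> I)) \<and>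
     (\<forall>I\<in>arcs. \<forall>J\<in>arcs. I \<subseteq> J \<longrightarrow> (\<forall>x\<in>A I. \<phi> J x = \<phi> I x)) \<and>
     (\<forall>I\<in>arcs. \<forall>x\<in>A I. cinner \<Omega> (\<phi> I x \<Omega>) = cinner \<Omega> (x \<Omega>)) \<and>
     (\<forall>I\<in>arcs. \<forall>g\<in>PSL2. \<forall>x\<in>A (g ` I). Ad (U g) (\<phi> I (Ad (inv (U g)) x)) = \<phi> (g ` I) x) \<and>
     (\<forall>I\<in>arcs. \<forall>x\<in>Vir U I. \<phi> I x = x)}"

definition UCP_topology ::
    "(complex set \<Rightarrow> ('h::complex_hilbert \<Rightarrow> 'h) set) \<Rightarrow> ((complex \<Rightarrow> complex) \<Rightarrow> 'h \<Rightarrow> 'h) \<Rightarrow> 'h \<Rightarrow>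
     (complex set \<Rightarrow> ('h \<Rightarrow> 'h) \<Rightarrow> ('h \<Rightarrow> 'h)) topology" where
  "UCP_topology A U \<Omega> =
     coarsest_topology (UCP A U \<Omega>) arcs (\<lambda>I \<phi>. \<phi> I) (\<lambda>I. pointwise_ultraweak_topology (A I))"

lemma topspace_UCP_topology [simp]: "topspace (UCP_topology A U \<Omega>) = UCP A U \<Omega>"
  by (simp add: UCP_topology_def)

definition convex_combination ::
    "(complex set \<Rightarrow> ('h::complex_hilbert \<Rightarrow> 'h) set) \<Rightarrow> real \<Rightarrow>
     (complex set \<Rightarrow> ('h \<Rightarrow> 'h) \<Rightarrow> ('h \<Rightarrow> 'h)) \<Rightarrow> (complex set \<Rightarrow> ('h \<Rightarrow> 'h) \<Rightarrow> ('h \<Rightarrow> 'h)) \<Rightarrow>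
     complex set \<Rightarrow> ('h \<Rightarrow> 'h) \<Rightarrow> ('h \<Rightarrow> 'h)" where
  "convex_combination A t \<phi> \<psi> =
     (\<lambda>I\<in>arcs. \<lambda>x\<in>A I. \<lambda>\<xi>. t *\<^sub>R \<phi> I x \<xi> + (1 - t) *\<^sub>R \<psi> I x \<xi>)"

end

theory Submission
  imports Defs "HOL-Complex_Analysis.Complex_Analysis"
begin

text \<open>Matrix elements embed \<open>UCP\<close> into a product of discs, where all defining conditions except
  normality and faithfulness are closed. Those two follow from the invariance of the vacuum because
  \<open>\<Omega>\<close> is cyclic for each local algebra and for its commutant. Faithfulness is then immediate. For
  normality, vectors \<open>z \<Omega>\<close> with \<open>z\<close> in the commutant give functionals \<open>\<langle>z \<Omega>, \<phi> x (z \<Omega>)\<rangle>\<close> dominated by a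
  multiple of the vacuum state, hence of the form \<open>\<langle>G \<Omega>, x \<Omega>\<rangle>\<close> with a positive \<open>G\<close> in the commutant;
  writing \<open>G\<close> as a sum of squares turns them into sums of vector states of the right total norm, and
  the general functional is a series of these.

  Cyclicity is the Reeh--Schlieder argument, arranged so as to need only the rotations and
  no additivity: if an arc \<open>I\<close> is contracted by a hyperbolic transformation from a half circle, the
  conjugated rotations move \<open>I\<close> slightly for small times and onto its complement for time \<open>\<pi>\<close>.
  Positive energy makes the corresponding matrix elements periodic functions with one-sided Fourier
  series, which vanish identically if they vanish near \<open>0\<close>. So the orthogonal complement of
  \<open>A(J) \<Omega>\<close> does not depend on the arc \<open>J\<close>, is invariant under all local algebras, and is zero by
  cyclicity of the vacuum for the whole net.\<close>

section \<open>Hilbert spaces\<close>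

text \<open>Normality is tested on series of \<open>cinner (\<xi> n) (\<phi> x (\<eta> n))\<close>
  with square summable vectors, so continuity of each single term does not suffice: every term must
  have total mass at most a fixed multiple of the product of the two norms. The vectors
  \<open>z \<Omega>\<close> with \<open>z\<close> in the commutant are dense, but there is no
  control of \<open>onorm z\<close> along an approximation, so the mass of a diagonal functional
  must be bounded through \<open>norm (z \<Omega>)\<close> alone. It is, because the mass is the
  value at \<open>id\<close> and the maps are unital. The final multiple is 64 = 4 * 4 * 4, from one
  polarisation and two geometric series. For compactness, the coordinates describe weak convergence
  while the topology on the maps is ultraweak. The radii of the discs do not depend on the map, so
  the defining series converge uniformly and decoding is continuous. The proof does not compare
  \<open>Vir U I\<close> with \<open>A I\<close>. Outside \<open>A I\<close> a map has the value
  \<open>undefined\<close>; a given element of \<open>UCP\<close> settles what the condition on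
  \<open>Vir U I\<close> means there, and the case of empty \<open>UCP\<close> is separated.\<close>

instance complex_hilbert \<subseteq> banach ..

lemma cinner_add_left: "cinner (x + y) z = cinner x z + cinner y z"
  by (metis cinner_add_right cinner_commute complex_cnj_add)

lemma cinner_scaleC_left: "cinner (a *\<^sub>C x) y = cnj a * cinner x y"
  by (metis cinner_scaleC_right cinner_commute complex_cnj_mult)

lemma cinner_self: "cinner x x = of_real ((norm x)\<^sup>2)"
proof -
  have "Im (cinner x x) = 0"
    using arg_cong[OF cinner_commute[of x x], of Im] by simp
  then show ?thesis
    by (simp add: complex_eq_iff Re_cinner power2_norm_eq_inner)
qed

lemma cinner_scaleR_right: "cinner x (r *\<^sub>R y) = r *\<^sub>R cinner x y"
  by (metis cinner_scaleC_right scaleC_of_real scaleR_conv_of_real)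

lemma cinner_scaleR_left: "cinner (r *\<^sub>R x) y = r *\<^sub>R cinner x y"
  by (metis cinner_scaleC_left scaleC_of_real scaleR_conv_of_real complex_cnj_complex_of_real)

lemma scaleC_one [simp]: "1 *\<^sub>C x = x"
  using scaleC_of_real[of 1 x] by simp

lemma scaleC_scaleR: "c *\<^sub>C (r *\<^sub>R x) = r *\<^sub>R (c *\<^sub>C x)"
  by (metis scaleC_scaleC scaleC_of_real mult.commute)

lemma norm_scaleC: "norm (a *\<^sub>C x) = cmod a * norm x"
proof -
  have "complex_of_real ((norm (a *\<^sub>C x))\<^sup>2) = of_real ((cmod a * norm x)\<^sup>2)"
    using cinner_self[of "a *\<^sub>C x"] cinner_self[of x] complex_norm_square[of a]
    by (simp add: cinner_scaleC_left cinner_scaleC_right power_mult_distrib mult_ac)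
  then have "(norm (a *\<^sub>C x))\<^sup>2 = (cmod a * norm x)\<^sup>2"
    using of_real_eq_iff by blast
  then show ?thesis by (simp add: power2_eq_iff_nonneg)
qed

lemma norm_cinner_le: "cmod (cinner x y) \<le> norm x * norm y"
proof (cases "cinner x y = 0")
  case False
  define c where "c = cnj (cinner x y) / cmod (cinner x y)"
  have c: "cmod c = 1" using False by (simp add: c_def norm_divide)
  have "c * cinner x y = of_real (cmod (cinner x y))"
    using False by (simp add: c_def complex_norm_square[symmetric] mult.commute power2_eq_square)
  then have "cmod (cinner x y) = Re (cinner x (c *\<^sub>C y))"
    by (simp add: cinner_scaleC_right)
  also have "\<dots> \<le> norm x * norm (c *\<^sub>C y)"
    unfolding Re_cinner by (rule norm_cauchy_schwarz)
  finally show ?thesis by (simp add: norm_scaleC c)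
qed auto

interpretation cinner: bounded_bilinear cinner
  by standard (auto simp: cinner_add_left cinner_add_right cinner_scaleR_left cinner_scaleR_right
      intro!: exI[of _ 1] norm_cinner_le)

interpretation scaleC: bounded_bilinear scaleC
proof
  show "(r *\<^sub>R a) *\<^sub>C (b::'a) = r *\<^sub>R (a *\<^sub>C b)" for r a b
    by (metis scaleC_scaleC scaleC_of_real scaleR_conv_of_real)
  show "\<exists>K. \<forall>a b. norm (a *\<^sub>C (b::'a)) \<le> norm a * norm b * K"
    by (auto simp: norm_scaleC intro!: exI[of _ 1])
qed (auto simp: scaleC_add_left scaleC_add_right scaleC_scaleR)

lemmas scaleC_simps [simp] = scaleC.zero_left scaleC.zero_right cinner.zero_left cinner.zero_right

lemma cinner_eqI: "(\<And>\<xi>. cinner \<xi> x = cinner \<xi> y) \<Longrightarrow> x = (y::'a::complex_hilbert)"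
proof -
  assume "\<And>\<xi>. cinner \<xi> x = cinner \<xi> y"
  then have "cinner (x - y) (x - y) = 0" by (simp add: cinner.diff_right)
  then show ?thesis by (simp add: cinner_self)
qed

text \<open>The representing vector minimises \<open>\<parallel>e b\<parallel>\<^sup>2 - 2 g b\<close>; by the parallelogram law every
  minimising sequence converges. Indexing by \<open>e\<close> allows functionals whose dependence on
  the vector alone is not known beforehand.\<close>

lemma riesz_indexed_real:
  fixes e :: "'b \<Rightarrow> 'a::{real_inner,complete_space}" and g :: "'b \<Rightarrow> real"
  assumes ne: "M \<noteq> {}"
    and lin: "\<And>a b s t. a \<in> M \<Longrightarrow> b \<in> M \<Longrightarrow>
      \<exists>c\<in>M. e c = s *\<^sub>R e a + t *\<^sub>R e b \<and> g c = s * g a + t * g b"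
    and bd: "\<And>b. b \<in> M \<Longrightarrow> g b \<le> C * norm (e b)"
  shows "\<exists>w\<in>closure (e ` M). \<forall>b\<in>M. inner w (e b) = g b"
proof -
  define J where "J b = (norm (e b))\<^sup>2 - 2 * g b" for b
  have lower: "J b \<ge> - C\<^sup>2" if "b \<in> M" for b
  proof -
    have "0 \<le> (norm (e b) - C)\<^sup>2" by simp
    then show ?thesis using bd[OF that] by (simp add: J_def power2_eq_square algebra_simps)
  qed
  then have bdd: "bdd_below (J ` M)" by (auto intro!: bdd_belowI[of _ "- C\<^sup>2"])
  define m where "m = Inf (J ` M)"
  have m: "m \<le> J b" if "b \<in> M" for b
    unfolding m_def using bdd that by (auto intro: cInf_lower)
  have "\<exists>u\<in>M. J u < m + 1 / real (Suc n)" for n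
  proof -
    have "Inf (J ` M) < m + 1 / real (Suc n)" by (simp add: m_def)
    then show ?thesis using ne by (subst (asm) cInf_less_iff) (use bdd in auto)
  qed
  then obtain u where u: "\<And>n. u n \<in> M" and Ju: "\<And>n. J (u n) < m + 1 / real (Suc n)"
    by metis
  \<comment> \<open>The index \<open>c\<close> realises the midpoint of \<open>e a\<close> and
    \<open>e b\<close>. Since \<open>J c\<close> is at least \<open>m\<close>, the parallelogram law
    bounds the distance by the excess of \<open>J\<close> over its infimum.\<close>
  have par: "(norm (e a - e b))\<^sup>2 \<le> 2 * (J a + J b - 2 * m)" if ab: "a \<in> M" "b \<in> M" for a b
  proof -
    obtain c where c: "c \<in> M" "e c = (1/2) *\<^sub>R e a + (1/2) *\<^sub>R e b" "g c = 1/2 * g a + 1/2 * g b"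
      using lin[OF ab] by blast
    have "J c = J a / 2 + J b / 2 - (norm (e a - e b))\<^sup>2 / 4"
      unfolding J_def c power2_norm_eq_inner
      by (simp add: inner_simps inner_commute algebra_simps) (simp add: field_simps)
    then show ?thesis using m[OF c(1)] by (simp add: field_simps)
  qed
  have "Cauchy (\<lambda>n. e (u n))"
  proof (rule metric_CauchyI)
    fix r :: real assume r: "0 < r"
    obtain N where N: "4 / r\<^sup>2 < real N" using reals_Archimedean2 by blast
    show "\<exists>N. \<forall>n\<ge>N. \<forall>k\<ge>N. dist (e (u n)) (e (u k)) < r"
    proof (intro exI allI impI)
      fix n k assume nk: "N \<le> n" "N \<le> k"
      have N0: "real N > 0" using N r by (smt (verit) divide_nonneg_nonneg zero_le_power2)
      have b: "1 / real (Suc i) \<le> 1 / real N" if "N \<le> i" for i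
        using that N0 by (intro divide_left_mono) auto
      have "(norm (e (u n) - e (u k)))\<^sup>2 \<le> 2 * (J (u n) + J (u k) - 2 * m)"
        using par u by blast
      also have "2 * (J (u n) + J (u k) - 2 * m) < 2 * (1 / real N + 1 / real N)"
      proof -
        have "x < m + z \<Longrightarrow> y < m + z \<Longrightarrow> 2 * (x + y - 2 * m) < 2 * (z + z)" for x y z :: real
          by argo
        then show ?thesis using less_le_trans[OF Ju add_left_mono[OF b[OF nk(1)]]]
          less_le_trans[OF Ju add_left_mono[OF b[OF nk(2)]]] by blast
      qed
      also have "\<dots> = 4 / real N" by simp
      also have "\<dots> < r\<^sup>2" using N N0 r by (simp add: field_simps)
      finally show "dist (e (u n)) (e (u k)) < r"
        unfolding dist_norm using r by (simp add: power2_less_imp_less)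
    qed
  qed
  then obtain w where w: "(\<lambda>n. e (u n)) \<longlonglongrightarrow> w" using Cauchy_convergent_iff convergent_def by blast
  have "w \<in> closure (e ` M)" unfolding closure_sequential using w u
    by (intro exI[of _ "\<lambda>n. e (u n)"]) auto
  moreover have "inner w (e b) = g b" if b: "b \<in> M" for b
  proof -
    \<comment> \<open>Moving from \<open>u n\<close> in the direction of \<open>b\<close> cannot
      bring \<open>J\<close> below \<open>m\<close>. In the limit a quadratic polynomial in
      \<open>t\<close> without constant term is nonnegative, so its linear coefficient must
      vanish.\<close>
    have ineq: "0 \<le> 2 * t * (inner w (e b) - g b) + t\<^sup>2 * (norm (e b))\<^sup>2" for t
    proof -
      have "m - J (u n) \<le> 2 * t * (inner (e (u n)) (e b) - g b) + t\<^sup>2 * (norm (e b))\<^sup>2" for n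
      proof -
        obtain c where c: "c \<in> M" "e c = 1 *\<^sub>R e (u n) + t *\<^sub>R e b" "g c = 1 * g (u n) + t * g b"
          using lin[OF u b] by blast
        have "J c = J (u n) + 2 * t * (inner (e (u n)) (e b) - g b) + t\<^sup>2 * (norm (e b))\<^sup>2"
          unfolding J_def c power2_norm_eq_inner
          by (simp add: inner_simps inner_commute algebra_simps power2_eq_square)
        then show ?thesis using m[OF c(1)] by linarith
      qed
      moreover have "- (1 / real (Suc n)) \<le> m - J (u n)" for n using Ju[of n] by linarith
      ultimately have le: "- (1 / real (Suc n)) \<le>
          2 * t * (inner (e (u n)) (e b) - g b) + t\<^sup>2 * (norm (e b))\<^sup>2" for n
        using order_trans by blast
      have 1: "(\<lambda>n. - (1 / real (Suc n))) \<longlonglongrightarrow> 0"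
        using tendsto_minus[OF LIMSEQ_Suc[OF lim_1_over_n]] by simp
      have 2: "(\<lambda>n. 2 * t * (inner (e (u n)) (e b) - g b) + t\<^sup>2 * (norm (e b))\<^sup>2)
          \<longlonglongrightarrow> 2 * t * (inner w (e b) - g b) + t\<^sup>2 * (norm (e b))\<^sup>2"
        by (intro tendsto_intros w)
      show ?thesis by (rule LIMSEQ_le[OF 1 2]) (use le in blast)
    qed
    show ?thesis
    proof (rule ccontr)
      define d where "d = inner w (e b) - g b"
      assume "inner w (e b) \<noteq> g b"
      then have d: "d \<noteq> 0" by (simp add: d_def)
      \<comment> \<open>The added 1 permits division when \<open>e b = 0\<close>; the test value is
        \<open>t = - d / K\<close>.\<close>
      define K where "K = (norm (e b))\<^sup>2 + 1"
      have K: "K > 0" by (simp add: K_def add_nonneg_pos)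
      have "0 \<le> 2 * (- d / K) * d + (- d / K)\<^sup>2 * (norm (e b))\<^sup>2"
        using ineq[of "- d / K"] by (simp add: d_def)
      also have "\<dots> \<le> 2 * (- d / K) * d + (- d / K)\<^sup>2 * K"
        by (intro add_left_mono mult_left_mono) (auto simp: K_def)
      also have "\<dots> = - (d\<^sup>2 / K)" using K by (simp add: power2_eq_square field_simps)
      finally show False using d K by (simp add: divide_le_0_iff)
    qed
  qed
  ultimately show ?thesis by blast
qed

text \<open>A complex functional is determined by its real part, since an index with vector
  \<open>\<i> *\<^sub>C e b\<close> supplies the imaginary part. The position of \<open>w\<close> in
  the closure of the range is recorded because projections and cyclicity are obtained from
  it.\<close>

lemma riesz_indexed:
  fixes e :: "'b \<Rightarrow> 'a::complex_hilbert" and g :: "'b \<Rightarrow> complex"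
  assumes ne: "M \<noteq> {}"
    and lin: "\<And>a b s t. a \<in> M \<Longrightarrow> b \<in> M \<Longrightarrow>
      \<exists>c\<in>M. e c = s *\<^sub>C e a + t *\<^sub>C e b \<and> g c = s * g a + t * g b"
    and bd: "\<And>b. b \<in> M \<Longrightarrow> cmod (g b) \<le> C * norm (e b)" and C: "C \<ge> 0"
  shows "\<exists>w\<in>closure (e ` M). norm w \<le> C \<and> (\<forall>b\<in>M. cinner w (e b) = g b)"
proof -
  have "\<exists>w\<in>closure (e ` M). \<forall>b\<in>M. inner w (e b) = Re (g b)"
  proof (rule riesz_indexed_real[OF ne])
    show "\<exists>c\<in>M. e c = s *\<^sub>R e a + t *\<^sub>R e b \<and> Re (g c) = s * Re (g a) + t * Re (g b)"
      if ab: "a \<in> M" "b \<in> M" for a b s t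
    proof -
      obtain c where "c \<in> M" "e c = of_real s *\<^sub>C e a + of_real t *\<^sub>C e b"
          "g c = of_real s * g a + of_real t * g b"
        using lin[OF ab] by blast
      then show ?thesis by (intro bexI[of _ c]) (auto simp: scaleC_of_real)
    qed
    show "Re (g b) \<le> C * norm (e b)" if "b \<in> M" for b
      using bd[OF that] complex_Re_le_cmod order_trans by blast
  qed
  then obtain w where wc: "w \<in> closure (e ` M)" and w: "\<And>b. b \<in> M \<Longrightarrow> inner w (e b) = Re (g b)"
    by blast
  have eq: "cinner w (e b) = g b" if b: "b \<in> M" for b
  proof (rule complex_eqI)
    show "Re (cinner w (e b)) = Re (g b)" using w[OF b] by (simp add: Re_cinner)
    obtain c where c: "c \<in> M" "e c = \<i> *\<^sub>C e b + 0 *\<^sub>C e b" "g c = \<i> * g b + 0 * g b"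
      using lin[OF b b] by blast
    have "Re (cinner w (\<i> *\<^sub>C e b)) = Re (\<i> * g b)"
      using w[OF c(1)] c by (simp add: Re_cinner)
    then show "Im (cinner w (e b)) = Im (g b)" by (simp add: cinner_scaleC_right)
  qed
  \<comment> \<open>As \<open>w\<close> lies in the closure of the range, the bound applies to
    \<open>v = w\<close> and limits the norm of \<open>w\<close>.\<close>
  have "closed {v. inner w v \<le> C * norm v}"
    by (intro closed_Collect_le continuous_intros)
  moreover have "e ` M \<subseteq> {v. inner w v \<le> C * norm v}"
    using w order_trans[OF complex_Re_le_cmod bd] by auto
  ultimately have "w \<in> {v. inner w v \<le> C * norm v}" using wc closure_minimal by blast
  then have "norm w * norm w \<le> C * norm w"
    by (simp add: power2_norm_eq_inner[symmetric] power2_eq_square)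
  then have "norm w \<le> C"
    by (metis C mult_right_le_imp_le norm_ge_zero order_le_less)
  with wc eq show ?thesis by blast
qed

subsection \<open>Bounded operators\<close>

lemma bounded_opsI:
  assumes "\<And>x y. T (x + y) = T x + T y" "\<And>c x. T (c *\<^sub>C x) = c *\<^sub>C T x"
    "\<And>x. norm (T x) \<le> K * norm x"
  shows "T \<in> bounded_ops"
proof -
  have "bounded_linear T"
    by (rule bounded_linear_intro[of T K])
      (use assms in \<open>auto simp: mult.commute scaleC_of_real[symmetric]\<close>)
  then show ?thesis using assms(2) by (simp add: bounded_ops_def)
qed

lemma bounded_opsD:
  assumes "T \<in> bounded_ops"
  shows "bounded_linear T" "T (x + y) = T x + T y" "T (c *\<^sub>C x) = c *\<^sub>C T x" "T (x - y) = T x - T y"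
    "T 0 = 0" "T (- x) = - T x" "T (r *\<^sub>R x) = r *\<^sub>R T x"
    "continuous_on S T" "norm (T x) \<le> onorm T * norm x" "onorm T \<ge> 0"
proof -
  show *: "bounded_linear T" using assms by (simp add: bounded_ops_def)
  then interpret bounded_linear T .
  show "T (x + y) = T x + T y" "T (x - y) = T x - T y" "T 0 = 0" "T (- x) = - T x"
    "T (r *\<^sub>R x) = r *\<^sub>R T x"
    by (rule add diff zero neg scaleR)+
  show "T (c *\<^sub>C x) = c *\<^sub>C T x" using assms by (simp add: bounded_ops_def)
  show "continuous_on S T" using * by (rule linear_continuous_on)
  show "norm (T x) \<le> onorm T * norm x" using * by (rule onorm)
  show "onorm T \<ge> 0" using * by (rule onorm_pos_le)
qed

lemma bounded_ops_add: "S \<in> bounded_ops \<Longrightarrow> T \<in> bounded_ops \<Longrightarrow> (\<lambda>\<xi>. S \<xi> + T \<xi>) \<in> bounded_ops"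
  unfolding bounded_ops_def by (auto intro: bounded_linear_add simp: scaleC_add_right)

lemma bounded_ops_scaleC: "T \<in> bounded_ops \<Longrightarrow> (\<lambda>\<xi>. c *\<^sub>C T \<xi>) \<in> bounded_ops"
  unfolding bounded_ops_def
  by (auto intro: bounded_linear_compose[OF scaleC.bounded_linear_right] simp: scaleC_scaleC mult.commute)

lemma bounded_ops_id: "id \<in> bounded_ops"
  by (rule bounded_opsI[where K=1]) auto

lemma bounded_ops_zero: "(\<lambda>_. 0) \<in> bounded_ops"
  by (rule bounded_opsI[where K=1]) auto

lemma bounded_ops_comp: "S \<in> bounded_ops \<Longrightarrow> T \<in> bounded_ops \<Longrightarrow> S \<circ> T \<in> bounded_ops"
  unfolding bounded_ops_def comp_def by (auto intro: bounded_linear_compose)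

lemma bounded_ops_diff: "S \<in> bounded_ops \<Longrightarrow> T \<in> bounded_ops \<Longrightarrow> (\<lambda>\<xi>. S \<xi> - T \<xi>) \<in> bounded_ops"
  using bounded_ops_add[OF _ bounded_ops_scaleC[of T "-1"], of S]
  by (simp add: scaleC.minus_left)

lemma bounded_ops_scaleR: "T \<in> bounded_ops \<Longrightarrow> (\<lambda>\<xi>. r *\<^sub>R T \<xi>) \<in> bounded_ops"
  using bounded_ops_scaleC[of T "of_real r"] by (simp add: scaleC_of_real)

text \<open>The form is antilinear in its first argument, so the Riesz lemma is applied to its
  conjugate for each fixed \<open>\<eta>\<close>. Linearity of \<open>T\<close> then follows from
  the uniqueness of representing vectors.\<close>

lemma sesquilinear_form_op:
  fixes B :: "'a::complex_hilbert \<Rightarrow> 'a \<Rightarrow> complex"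
  assumes l: "\<And>\<xi> \<xi>' \<eta>. B (\<xi> + \<xi>') \<eta> = B \<xi> \<eta> + B \<xi>' \<eta>" "\<And>c \<xi> \<eta>. B (c *\<^sub>C \<xi>) \<eta> = cnj c * B \<xi> \<eta>"
    and r: "\<And>\<xi> \<eta> \<eta>'. B \<xi> (\<eta> + \<eta>') = B \<xi> \<eta> + B \<xi> \<eta>'" "\<And>c \<xi> \<eta>. B \<xi> (c *\<^sub>C \<eta>) = c * B \<xi> \<eta>"
    and bd: "\<And>\<xi> \<eta>. cmod (B \<xi> \<eta>) \<le> C * norm \<xi> * norm \<eta>" and C: "C \<ge> 0"
  shows "\<exists>T\<in>bounded_ops. (\<forall>\<xi> \<eta>. cinner \<xi> (T \<eta>) = B \<xi> \<eta>) \<and> (\<forall>\<eta>. norm (T \<eta>) \<le> C * norm \<eta>)"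
proof -
  have "\<exists>w. norm w \<le> C * norm \<eta> \<and> (\<forall>\<xi>. cinner \<xi> w = B \<xi> \<eta>)" for \<eta>
  proof -
    have "\<exists>w\<in>closure ((\<lambda>x. x) ` UNIV). norm w \<le> C * norm \<eta> \<and>
        (\<forall>\<xi>\<in>UNIV. cinner w \<xi> = cnj (B \<xi> \<eta>))"
    proof (rule riesz_indexed)
      show "\<exists>c\<in>UNIV. c = s *\<^sub>C a + t *\<^sub>C b \<and>
          cnj (B c \<eta>) = s * cnj (B a \<eta>) + t * cnj (B b \<eta>)" for a b s t
        by (simp add: l)
      show "cmod (cnj (B b \<eta>)) \<le> C * norm \<eta> * norm b" for b
        using bd[of b \<eta>] by (simp add: mult_ac)
    qed (auto simp: C)
    then obtain w where "norm w \<le> C * norm \<eta>" "\<And>\<xi>. cinner w \<xi> = cnj (B \<xi> \<eta>)" by blast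
    then show ?thesis by (metis cinner_commute complex_cnj_cnj)
  qed
  then obtain T where T: "\<And>\<eta>. norm (T \<eta>) \<le> C * norm \<eta>" "\<And>\<xi> \<eta>. cinner \<xi> (T \<eta>) = B \<xi> \<eta>"
    by metis
  have "T \<in> bounded_ops"
    by (rule bounded_opsI[where K=C])
      (rule cinner_eqI, simp add: T(2) r cinner_add_right cinner_scaleC_right | rule T(1))+
  then show ?thesis using T by blast
qed

text \<open>Gives meaning to the definite description in \<open>adj\<close>: existence comes from
  the bounded form \<open>cinner (x \<xi>) \<eta>\<close>, uniqueness from the separation of vectors
  by inner products.\<close>

lemma adj_properties:
  assumes x: "x \<in> bounded_ops"
  shows adj_bounded_ops: "adj x \<in> bounded_ops"
    and cinner_adj_left: "cinner (adj x \<xi>) \<eta> = cinner \<xi> (x \<eta>)"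
proof -
  have "\<exists>T\<in>bounded_ops. (\<forall>\<xi> \<eta>. cinner \<xi> (T \<eta>) = cinner (x \<xi>) \<eta>) \<and>
      (\<forall>\<eta>. norm (T \<eta>) \<le> onorm x * norm \<eta>)"
  proof (rule sesquilinear_form_op)
    show "cmod (cinner (x \<xi>) \<eta>) \<le> onorm x * norm \<xi> * norm \<eta>" for \<xi> \<eta>
      using bounded_opsD(9)[OF x, of \<xi>] norm_cinner_le[of "x \<xi>" \<eta>]
      by (meson mult_right_mono norm_ge_zero order_trans)
  qed (simp_all add: bounded_opsD[OF x] cinner_add_left cinner_add_right cinner_scaleC_left
      cinner_scaleC_right)
  then obtain T where T: "T \<in> bounded_ops" "\<And>\<xi> \<eta>. cinner \<xi> (T \<eta>) = cinner (x \<xi>) \<eta>" by blast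
  have T': "cinner (T \<xi>) \<eta> = cinner \<xi> (x \<eta>)" for \<xi> \<eta>
    by (metis T(2) cinner_commute)
  have "adj x = T"
    unfolding adj_def
  proof (rule the_equality)
    show "y = T" if "\<forall>\<xi> \<eta>. cinner (y \<xi>) \<eta> = cinner \<xi> (x \<eta>)" for y
    proof
      show "y \<xi> = T \<xi>" for \<xi>
        by (rule cinner_eqI) (metis that T' cinner_commute)
    qed
  qed (use T' in blast)
  then show "adj x \<in> bounded_ops" "cinner (adj x \<xi>) \<eta> = cinner \<xi> (x \<eta>)"
    using T T' by auto
qed

lemma cinner_adj_right: "x \<in> bounded_ops \<Longrightarrow> cinner \<xi> (adj x \<eta>) = cinner (x \<xi>) \<eta>"
  by (metis cinner_adj_left cinner_commute)

lemma adj_eqI: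
  assumes "x \<in> bounded_ops" "\<And>\<xi> \<eta>. cinner (y \<xi>) \<eta> = cinner \<xi> (x \<eta>)"
  shows "adj x = y"
proof
  show "adj x \<xi> = y \<xi>" for \<xi>
    by (rule cinner_eqI) (metis assms cinner_adj_left cinner_commute)
qed

text \<open>The projection of \<open>x\<close> is the Riesz vector of the functional
  \<open>cinner x\<close> restricted to \<open>N\<close>; closedness keeps it in \<open>N\<close>.
  The algebraic properties hold because an element of \<open>N\<close> is determined by its inner
  products with \<open>N\<close>.\<close>

lemma orthogonal_projection:
  fixes N :: "'a::complex_hilbert set"
  assumes cl: "closed N" and z: "0 \<in> N"
    and lin: "\<And>a b x y. x \<in> N \<Longrightarrow> y \<in> N \<Longrightarrow> a *\<^sub>C x + b *\<^sub>C y \<in> N"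
  obtains P where "P \<in> bounded_ops" "\<And>x. P x \<in> N" "\<And>x. x \<in> N \<Longrightarrow> P x = x"
    "\<And>x y. cinner (P x) y = cinner x (P y)"
proof -
  have "\<exists>p\<in>closure ((\<lambda>y. y) ` N). norm p \<le> norm x \<and> (\<forall>y\<in>N. cinner p y = cinner x y)" for x
  proof (rule riesz_indexed)
    show "\<exists>c\<in>N. c = s *\<^sub>C a + t *\<^sub>C b \<and> cinner x c = s * cinner x a + t * cinner x b"
      if "a \<in> N" "b \<in> N" for a b s t
      using lin[OF that] by (auto simp: cinner_add_right cinner_scaleC_right)
  qed (use z norm_cinner_le in auto)
  then obtain P where P: "\<And>x. P x \<in> N" "\<And>x. norm (P x) \<le> norm x"
      "\<And>x y. y \<in> N \<Longrightarrow> cinner (P x) y = cinner x y"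
    using cl by (simp add: closure_closed) metis
  have uniq: "p = q" if "p \<in> N" "q \<in> N" "\<And>y. y \<in> N \<Longrightarrow> cinner p y = cinner q y" for p q
  proof -
    have "1 *\<^sub>C p + (-1) *\<^sub>C q \<in> N" using that lin by blast
    then have "cinner p (p - q) = cinner q (p - q)"
      using that(3) by (simp add: scaleC.minus_left)
    then have "cinner (p - q) (p - q) = 0" by (simp add: cinner.diff_left)
    then show ?thesis by (simp add: cinner_self)
  qed
  have fix': "P x = x" if "x \<in> N" for x by (rule uniq) (use P that in auto)
  have lin1: "x + y \<in> N" "c *\<^sub>C x \<in> N" if "x \<in> N" "y \<in> N" for x y c
    using lin[OF that, of 1 1] lin[OF that, of c 0] by auto
  have "P \<in> bounded_ops"
  proof (rule bounded_opsI[where K=1])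
    show "P (x + y) = P x + P y" for x y
      by (rule uniq) (auto simp: P lin1 cinner_add_left)
    show "P (c *\<^sub>C x) = c *\<^sub>C P x" for c x
      by (rule uniq) (auto simp: P lin1[OF P(1) P(1)] cinner_scaleC_left)
  qed (use P in auto)
  moreover have "cinner (P x) y = cinner x (P y)" for x y
    by (metis P(1,3) cinner_commute)
  ultimately show ?thesis using that P(1) fix' by blast
qed

subsection \<open>Positive operators\<close>

text \<open>The determinant inequality for a nonnegative form in two variables. It is the common
  source of the Cauchy-Schwarz inequalities for positive operators, for the contractivity of
  completely positive maps and for the form in \<open>nuclear_diagonal\<close>.\<close>

lemma positive_hermitian_2x2:
  assumes pos: "\<And>s t. cnj s * s * p + cnj s * t * r + cnj t * s * r' + cnj t * t * q \<in> \<real>\<^sub>\<ge>\<^sub>0"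
  shows "r' = cnj r" "(cmod r)\<^sup>2 \<le> Re p * Re q"
proof -
  have p: "Im p = 0" "Re p \<ge> 0" and q: "Im q = 0" "Re q \<ge> 0"
    using pos[of 1 0] pos[of 0 1] by (auto simp: complex_nonneg_Reals_iff)
  show r': "r' = cnj r"
    using pos[of 1 1] pos[of 1 \<i>] p q by (auto simp: complex_nonneg_Reals_iff complex_eq_iff)
  \<comment> \<open>The choice \<open>t = - u * cnj r\<close> turns the cross terms into real
    multiples of \<open>(cmod r)\<^sup>2\<close>.\<close>
  have form: "0 \<le> s\<^sup>2 * Re p - 2 * s * u * (cmod r)\<^sup>2 + u\<^sup>2 * (cmod r)\<^sup>2 * Re q" for s u :: real
  proof -
    have "Re (cnj (of_real s) * of_real s * p + cnj (of_real s) * (- of_real u * cnj r) * r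
        + cnj (- of_real u * cnj r) * of_real s * r' + cnj (- of_real u * cnj r) * (- of_real u * cnj r) * q) \<ge> 0"
      using pos by (simp only: complex_nonneg_Reals_iff)
    also have "cnj (of_real s) * of_real s * p + cnj (of_real s) * (- of_real u * cnj r) * r
        + cnj (- of_real u * cnj r) * of_real s * r' + cnj (- of_real u * cnj r) * (- of_real u * cnj r) * q
        = of_real (s\<^sup>2) * p - of_real (2 * s * u) * (r * cnj r) + of_real (u\<^sup>2) * (r * cnj r) * q"
      by (simp add: r' algebra_simps power2_eq_square)
    also have "\<dots> = of_real (s\<^sup>2) * p - of_real (2 * s * u * (cmod r)\<^sup>2) + of_real (u\<^sup>2 * (cmod r)\<^sup>2) * q"
      by (simp flip: complex_norm_square)
    finally show ?thesis using p q by simp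
  qed
  show "(cmod r)\<^sup>2 \<le> Re p * Re q"
  proof (cases "Re q = 0")
    case True
    \<comment> \<open>Without a quadratic term in \<open>u\<close>, the form at
      \<open>s = e\<close>, \<open>u = 1\<close> bounds \<open>(cmod r)\<^sup>2\<close> by
      arbitrarily small numbers.\<close>
    have r0: "(cmod r)\<^sup>2 \<le> e * Re p / 2" if "e > 0" for e
    proof -
      have "2 * e * (cmod r)\<^sup>2 \<le> e * (e * Re p)"
        using form[of e 1] True by (simp add: power2_eq_square mult_ac)
      then show ?thesis using that by (simp add: field_simps)
    qed
    have "(cmod r)\<^sup>2 \<le> 0"
    proof (rule field_le_epsilon)
      fix e :: real assume e: "e > 0"
      have "(cmod r)\<^sup>2 \<le> (e / (Re p + 1)) * Re p / 2" using r0[of "e / (Re p + 1)"] e p by simp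
      also have "\<dots> \<le> e" using e p by (simp add: field_simps mult_nonneg_nonneg)
      finally show "(cmod r)\<^sup>2 \<le> 0 + e" by simp
    qed
    then show ?thesis using True by simp
  next
    case False
    then have "Re q > 0" using q by simp
    moreover have "0 \<le> Re q * (Re p * Re q - (cmod r)\<^sup>2)"
      using form[of "Re q" 1] by (simp add: power2_eq_square algebra_simps)
    ultimately show ?thesis by (simp add: zero_le_mult_iff)
  qed
qed

lemma positive_opI_dense:
  assumes T: "T \<in> bounded_ops" and D: "closure D = UNIV"
    and pos: "\<And>\<xi>. \<xi> \<in> D \<Longrightarrow> cinner \<xi> (T \<xi>) \<in> \<real>\<^sub>\<ge>\<^sub>0"
  shows "positive_op T"
proof -
  have "closed {\<xi>. Re (cinner \<xi> (T \<xi>)) \<ge> 0 \<and> Im (cinner \<xi> (T \<xi>)) = 0}"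
    by (intro closed_Collect_conj closed_Collect_le closed_Collect_eq continuous_intros
        cinner.continuous_on bounded_opsD(8)[OF T])
  then have "closure D \<subseteq> {\<xi>. Re (cinner \<xi> (T \<xi>)) \<ge> 0 \<and> Im (cinner \<xi> (T \<xi>)) = 0}"
    using pos by (intro closure_minimal) (auto simp: complex_nonneg_Reals_iff)
  then show ?thesis using D by (auto simp: positive_op_def complex_nonneg_Reals_iff)
qed

lemma positive_op_cauchy_schwarz:
  assumes T: "T \<in> bounded_ops" and pos: "positive_op T"
  shows positive_op_selfadjoint: "cinner (T \<xi>) \<eta> = cinner \<xi> (T \<eta>)"
    and positive_op_norm_cinner_le:
      "(cmod (cinner \<xi> (T \<eta>)))\<^sup>2 \<le> Re (cinner \<xi> (T \<xi>)) * Re (cinner \<eta> (T \<eta>))"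
proof -
  have *: "cnj s * s * cinner \<xi> (T \<xi>) + cnj s * t * cinner \<xi> (T \<eta>) + cnj t * s * cinner \<eta> (T \<xi>)
      + cnj t * t * cinner \<eta> (T \<eta>) \<in> \<real>\<^sub>\<ge>\<^sub>0" for s t
  proof -
    have "cinner (s *\<^sub>C \<xi> + t *\<^sub>C \<eta>) (T (s *\<^sub>C \<xi> + t *\<^sub>C \<eta>)) \<in> \<real>\<^sub>\<ge>\<^sub>0"
      using pos by (simp add: positive_op_def)
    then show ?thesis
      by (simp add: bounded_opsD[OF T] cinner_add_left cinner_add_right cinner_scaleC_left
          cinner_scaleC_right algebra_simps)
  qed
  show "cinner (T \<xi>) \<eta> = cinner \<xi> (T \<eta>)"
    using positive_hermitian_2x2(1)[OF *] by (metis cinner_commute)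
  show "(cmod (cinner \<xi> (T \<eta>)))\<^sup>2 \<le> Re (cinner \<xi> (T \<xi>)) * Re (cinner \<eta> (T \<eta>))"
    by (rule positive_hermitian_2x2(2)[OF *])
qed

definition effect :: "('h::complex_hilbert \<Rightarrow> 'h) \<Rightarrow> bool" where
  "effect T \<longleftrightarrow> T \<in> bounded_ops \<and> positive_op T \<and> (\<forall>\<xi>. Re (cinner \<xi> (T \<xi>)) \<le> (norm \<xi>)\<^sup>2)"

text \<open>This is \<open>T\<^sup>2 \<le> T\<close> without square roots: Cauchy-Schwarz for the
  form of \<open>T\<close> at the pair \<open>T \<xi>\<close>, \<open>\<xi>\<close>, then the upper
  bound on \<open>T\<close> at \<open>T \<xi>\<close>, and cancellation of
  \<open>(norm (T \<xi>))\<^sup>2\<close>.\<close>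

lemma effect_norm_sq_le:
  assumes "effect T" shows "(norm (T \<xi>))\<^sup>2 \<le> Re (cinner \<xi> (T \<xi>))"
proof (cases "T \<xi> = 0")
  case False
  have T: "T \<in> bounded_ops" "positive_op T" using assms by (auto simp: effect_def)
  have pos: "Re (cinner \<xi> (T \<xi>)) \<ge> 0"
    using T by (auto simp: positive_op_def complex_nonneg_Reals_iff)
  have "((norm (T \<xi>))\<^sup>2)\<^sup>2 = (cmod (cinner (T \<xi>) (T \<xi>)))\<^sup>2"
    by (simp only: cinner_self norm_of_real abs_power2)
  also have "\<dots> \<le> Re (cinner (T \<xi>) (T (T \<xi>))) * Re (cinner \<xi> (T \<xi>))"
    by (rule positive_op_norm_cinner_le[OF T])
  also have "\<dots> \<le> (norm (T \<xi>))\<^sup>2 * Re (cinner \<xi> (T \<xi>))"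
    using assms pos by (intro mult_right_mono) (auto simp: effect_def)
  finally show ?thesis using False by (simp add: power2_eq_square)
qed simp

text \<open>The recursion \<open>T\<^sub>0 = T\<close>, \<open>T\<^sub>n\<^sub>+\<^sub>1 = T\<^sub>n - T\<^sub>n\<^sup>2\<close> writes an operator \<open>0 \<le> T \<le> 1\<close> as the sum of
  the squares \<open>T\<^sub>n\<^sup>2\<close>. It replaces square roots and the spectral theorem.\<close>

fun square_rest :: "('h::complex_hilbert \<Rightarrow> 'h) \<Rightarrow> nat \<Rightarrow> 'h \<Rightarrow> 'h" where
  "square_rest T 0 = T"
| "square_rest T (Suc n) = (\<lambda>\<xi>. square_rest T n \<xi> - square_rest T n (square_rest T n \<xi>))"

text \<open>The inequality \<open>T\<^sup>2 \<le> T\<close> keeps the next remainder nonnegative,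
  and subtracting a square keeps it below 1.\<close>

lemma effect_square_rest: "effect T \<Longrightarrow> effect (square_rest T n)"
proof (induction n)
  case (Suc n)
  define S where "S = square_rest T n"
  have S: "effect S" "S \<in> bounded_ops" "positive_op S"
    using Suc by (auto simp: effect_def S_def)
  have B: "(\<lambda>\<xi>. S \<xi> - S (S \<xi>)) \<in> bounded_ops"
    using bounded_ops_diff[OF S(2) bounded_ops_comp[OF S(2) S(2)]] by simp
  have eq: "cinner \<xi> (S \<xi> - S (S \<xi>)) = cinner \<xi> (S \<xi>) - of_real ((norm (S \<xi>))\<^sup>2)" for \<xi>
    by (simp only: cinner.diff_right positive_op_selfadjoint[OF S(2,3), symmetric] cinner_self)
  have "positive_op (\<lambda>\<xi>. S \<xi> - S (S \<xi>))"
    unfolding positive_op_def eq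
    using effect_norm_sq_le[OF S(1)] S(3)
    by (auto simp: complex_nonneg_Reals_iff positive_op_def)
  moreover have "Re (cinner \<xi> (S \<xi> - S (S \<xi>))) \<le> (norm \<xi>)\<^sup>2" for \<xi>
  proof -
    have "Re (cinner \<xi> (S \<xi>)) \<le> (norm \<xi>)\<^sup>2" using S(1) by (simp add: effect_def)
    moreover have "0 \<le> (norm (S \<xi>))\<^sup>2" by simp
    ultimately show ?thesis unfolding eq minus_complex.simps Re_complex_of_real by linarith
  qed
  ultimately show ?case using B by (simp add: effect_def S_def)
qed simp

text \<open>The partial sums telescope to \<open>T\<close> minus the current remainder. On the
  diagonal they are bounded, so the squared norms of the remainders applied to a vector are summable
  and the remainders tend to 0 strongly.\<close>

lemma square_decomposition_sums:
  assumes "effect T"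
  shows "(\<lambda>n. cinner (square_rest T n \<xi>) (square_rest T n \<eta>)) sums cinner \<xi> (T \<eta>)"
proof -
  let ?S = "square_rest T"
  have E: "effect (?S n)" for n using assms by (rule effect_square_rest)
  then have S: "?S n \<in> bounded_ops" "positive_op (?S n)" for n by (auto simp: effect_def)
  have part: "(\<Sum>i<n. cinner (?S i \<xi>) (?S i \<eta>)) = cinner \<xi> (T \<eta>) - cinner \<xi> (?S n \<eta>)" for n \<xi> \<eta>
    by (induction n) (simp_all add: cinner.diff_right positive_op_selfadjoint[OF S])
  have summ: "summable (\<lambda>n. (norm (?S n \<xi>))\<^sup>2)" for \<xi>
  proof (rule bounded_imp_summable)
    show "(\<Sum>k\<le>n. (norm (?S k \<xi>))\<^sup>2) \<le> Re (cinner \<xi> (T \<xi>))" for n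
    proof -
      have "complex_of_real (\<Sum>k<Suc n. (norm (?S k \<xi>))\<^sup>2) = cinner \<xi> (T \<xi>) - cinner \<xi> (?S (Suc n) \<xi>)"
        unfolding part[symmetric] by (simp add: cinner_self)
      then have "(\<Sum>k<Suc n. (norm (?S k \<xi>))\<^sup>2) = Re (cinner \<xi> (T \<xi>)) - Re (cinner \<xi> (?S (Suc n) \<xi>))"
        by (metis Re_complex_of_real minus_complex.simps(1))
      moreover have "Re (cinner \<xi> (?S (Suc n) \<xi>)) \<ge> 0"
        using S(2)[of "Suc n"] by (simp only: positive_op_def complex_nonneg_Reals_iff)
      ultimately show ?thesis by (simp only: lessThan_Suc_atMost)
    qed
  qed simp
  have "(\<lambda>n. ?S n \<eta>) \<longlonglongrightarrow> 0"
    using tendsto_real_sqrt[OF summable_LIMSEQ_zero[OF summ]] by (simp add: tendsto_norm_zero_iff)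
  then have "(\<lambda>n. cinner \<xi> (T \<eta>) - cinner \<xi> (?S n \<eta>)) \<longlonglongrightarrow> cinner \<xi> (T \<eta>) - cinner \<xi> 0"
    by (intro tendsto_intros cinner.tendsto)
  then show "(\<lambda>n. cinner (?S n \<xi>) (?S n \<eta>)) sums cinner \<xi> (T \<eta>)"
    unfolding sums_def part by simp
qed

lemma effect_scaled:
  assumes T: "T \<in> bounded_ops" and pos: "positive_op T" and k: "k > 0"
    and bd: "\<And>\<xi>. Re (cinner \<xi> (T \<xi>)) \<le> k * (norm \<xi>)\<^sup>2"
  shows "effect (\<lambda>\<xi>. (1 / k) *\<^sub>R T \<xi>)"
  using assms bounded_ops_scaleR[OF T, of "1/k"]
  by (auto simp: effect_def positive_op_def cinner_scaleR_right complex_nonneg_Reals_iff field_simps)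

section \<open>Von Neumann algebras\<close>

lemma commutant_bounded_ops: "commutant S \<subseteq> bounded_ops"
  by (auto simp: commutant_def)

lemma commutantD: "y \<in> commutant S \<Longrightarrow> x \<in> S \<Longrightarrow> x (y \<xi>) = y (x \<xi>)"
  unfolding commutant_def by (metis (mono_tags, lifting) comp_apply mem_Collect_eq)

lemma commutantI: "y \<in> bounded_ops \<Longrightarrow> (\<And>x \<xi>. x \<in> S \<Longrightarrow> x (y \<xi>) = y (x \<xi>)) \<Longrightarrow> y \<in> commutant S"
  unfolding commutant_def by auto

lemma commutant_id:
  assumes "S \<subseteq> bounded_ops" shows "id \<in> commutant S"
  by (rule commutantI[OF bounded_ops_id]) simp

lemma commutant_lincomb:
  assumes "S \<subseteq> bounded_ops" "x \<in> commutant S" "y \<in> commutant S"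
  shows "(\<lambda>\<xi>. a *\<^sub>C x \<xi> + b *\<^sub>C y \<xi>) \<in> commutant S"
proof (rule commutantI)
  show "(\<lambda>\<xi>. a *\<^sub>C x \<xi> + b *\<^sub>C y \<xi>) \<in> bounded_ops"
    using assms commutant_bounded_ops by (intro bounded_ops_add bounded_ops_scaleC) auto
  show "s (a *\<^sub>C x \<xi> + b *\<^sub>C y \<xi>) = a *\<^sub>C x (s \<xi>) + b *\<^sub>C y (s \<xi>)" if "s \<in> S" for s \<xi>
    using assms commutantD[OF assms(2) that] commutantD[OF assms(3) that] that
    by (auto simp: bounded_opsD subsetD)
qed

lemma commutant_comp:
  assumes "x \<in> commutant S" "y \<in> commutant S" shows "x \<circ> y \<in> commutant S"
proof (rule commutantI)
  show "x \<circ> y \<in> bounded_ops" using assms commutant_bounded_ops by (intro bounded_ops_comp) auto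
  show "s ((x \<circ> y) \<xi>) = (x \<circ> y) (s \<xi>)" if "s \<in> S" for s \<xi>
    using commutantD[OF assms(1) that] commutantD[OF assms(2) that] by simp
qed

lemma commutant_adj:
  assumes S: "S \<subseteq> bounded_ops" "\<And>x. x \<in> S \<Longrightarrow> adj x \<in> S" and y: "y \<in> commutant S"
  shows "adj y \<in> commutant S"
proof (rule commutantI)
  have yb: "y \<in> bounded_ops" using y commutant_bounded_ops by auto
  then show "adj y \<in> bounded_ops" by (rule adj_bounded_ops)
  show "x (adj y \<xi>) = adj y (x \<xi>)" if x: "x \<in> S" for x \<xi>
  proof (rule cinner_eqI)
    fix \<zeta>
    have xb: "x \<in> bounded_ops" using S x by auto
    have "cinner \<zeta> (x (adj y \<xi>)) = cinner (y (adj x \<zeta>)) \<xi>"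
      by (simp add: xb yb flip: cinner_adj_left cinner_adj_right)
    also have "\<dots> = cinner (adj x (y \<zeta>)) \<xi>" using commutantD[OF y S(2)[OF x]] by simp
    also have "\<dots> = cinner \<zeta> (adj y (x \<xi>))"
      by (simp add: xb yb cinner_adj_left cinner_adj_right)
    finally show "cinner \<zeta> (x (adj y \<xi>)) = cinner \<zeta> (adj y (x \<xi>))" .
  qed
qed

lemma von_neumann_algebraD:
  assumes "von_neumann_algebra M"
  shows von_neumann_bounded: "M \<subseteq> bounded_ops" "x \<in> M \<Longrightarrow> x \<in> bounded_ops"
    and von_neumann_adj: "x \<in> M \<Longrightarrow> adj x \<in> M"
    and von_neumann_bicommutant: "commutant (commutant M) = M"
    and von_neumann_id: "id \<in> M"
    and von_neumann_lincomb: "x \<in> M \<Longrightarrow> y \<in> M \<Longrightarrow> (\<lambda>\<xi>. a *\<^sub>C x \<xi> + b *\<^sub>C y \<xi>) \<in> M"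
    and von_neumann_comp: "x \<in> M \<Longrightarrow> y \<in> M \<Longrightarrow> x \<circ> y \<in> M"
proof -
  show M: "M \<subseteq> bounded_ops" "x \<in> M \<Longrightarrow> x \<in> bounded_ops" "x \<in> M \<Longrightarrow> adj x \<in> M"
    and b: "commutant (commutant M) = M"
    using assms by (auto simp: von_neumann_algebra_def)
  show "id \<in> M" "x \<in> M \<Longrightarrow> y \<in> M \<Longrightarrow> (\<lambda>\<xi>. a *\<^sub>C x \<xi> + b *\<^sub>C y \<xi>) \<in> M"
    "x \<in> M \<Longrightarrow> y \<in> M \<Longrightarrow> x \<circ> y \<in> M"
    using commutant_id[OF commutant_bounded_ops, of M]
      commutant_lincomb[OF commutant_bounded_ops, of x M y a b]
      commutant_comp[of x "commutant M" y] b by auto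
qed

lemma von_neumann_zero: "von_neumann_algebra M \<Longrightarrow> (\<lambda>_. 0) \<in> M"
  using von_neumann_lincomb[of M id id 0 0] von_neumann_id[of M] by simp

lemma von_neumann_diff:
  assumes "von_neumann_algebra M" "x \<in> M" "y \<in> M" shows "(\<lambda>\<xi>. x \<xi> - y \<xi>) \<in> M"
  using von_neumann_lincomb[OF assms, of 1 "-1"] by (simp add: scaleC.minus_left)

lemma von_neumann_scaleR:
  assumes "von_neumann_algebra M" "x \<in> M" shows "(\<lambda>\<xi>. r *\<^sub>R x \<xi>) \<in> M"
  using von_neumann_lincomb[OF assms assms(2), of "of_real r" 0] by (simp add: scaleC_of_real)

lemma von_neumann_commutant:
  assumes "von_neumann_algebra M" shows "von_neumann_algebra (commutant M)"
  using von_neumann_algebraD(1,3,4)[OF assms] commutant_bounded_ops[of M] commutant_adj[of M]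
  by (simp add: von_neumann_algebra_def)

text \<open>The recursion uses products and differences only, so the squares stay in the algebra and
  commute with its commutant. Both later uses of the decomposition depend on this.\<close>

lemma von_neumann_square_rest:
  assumes "von_neumann_algebra M" "T \<in> M" shows "square_rest T n \<in> M"
proof (induction n)
  case (Suc n)
  show ?case
    using von_neumann_diff[OF assms(1) Suc von_neumann_comp[OF assms(1) Suc Suc]] by simp
qed (simp add: assms)

text \<open>Up to scaling \<open>y\<close> is a sum of squares of operators \<open>S\<close> in
  \<open>M\<close>. Each of them commutes with \<open>z\<close>, so \<open>norm (S (z v))\<close> is
  at most \<open>onorm z * norm (S v)\<close>, and these estimates are summed.\<close>

lemma commutant_dominated:
  assumes M: "von_neumann_algebra M" and y: "y \<in> M" "positive_op y" and z: "z \<in> commutant M"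
  shows "Re (cinner (z v) (y (z v))) \<le> (onorm z)\<^sup>2 * Re (cinner v (y v))"
proof -
  have zb: "z \<in> bounded_ops" using z commutant_bounded_ops by auto
  have yb: "y \<in> bounded_ops" using M y von_neumann_bounded by blast
  \<comment> \<open>The added 1 makes the scaling factor positive also for
    \<open>y = 0\<close>.\<close>
  define k where "k = onorm y + 1"
  have k: "k > 0" using bounded_opsD(10)[OF yb] by (simp add: k_def)
  have bd: "Re (cinner \<xi> (y \<xi>)) \<le> k * (norm \<xi>)\<^sup>2" for \<xi>
  proof -
    have "Re (cinner \<xi> (y \<xi>)) \<le> norm \<xi> * norm (y \<xi>)"
      using complex_Re_le_cmod norm_cinner_le order_trans by blast
    also have "\<dots> \<le> norm \<xi> * (k * norm \<xi>)"
    proof (intro mult_left_mono)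
      have "norm (y \<xi>) \<le> onorm y * norm \<xi>" by (rule bounded_opsD(9)[OF yb])
      also have "\<dots> \<le> k * norm \<xi>" by (intro mult_right_mono) (auto simp: k_def)
      finally show "norm (y \<xi>) \<le> k * norm \<xi>" .
    qed simp
    finally show ?thesis by (simp add: power2_eq_square mult_ac)
  qed
  define T where "T = (\<lambda>\<xi>. (1 / k) *\<^sub>R y \<xi>)"
  have E: "effect T" unfolding T_def by (rule effect_scaled[OF yb y(2) k bd])
  have TM: "T \<in> M" unfolding T_def by (rule von_neumann_scaleR[OF M y(1)])
  let ?S = "square_rest T"
  have s: "(\<lambda>n. (norm (?S n \<xi>))\<^sup>2) sums Re (cinner \<xi> (T \<xi>))" for \<xi>
    using sums_Re[OF square_decomposition_sums[OF E, of \<xi> \<xi>]] by (simp add: cinner_self)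
  have "Re (cinner (z v) (T (z v))) \<le> (onorm z)\<^sup>2 * Re (cinner v (T v))"
  proof (rule sums_le[OF _ s sums_mult[OF s]])
    fix n
    have "?S n (z v) = z (?S n v)"
      using commutantD[OF z von_neumann_square_rest[OF M TM]] .
    then have "norm (?S n (z v)) \<le> onorm z * norm (?S n v)"
      using bounded_opsD(9)[OF zb] by simp
    then show "(norm (?S n (z v)))\<^sup>2 \<le> (onorm z)\<^sup>2 * (norm (?S n v))\<^sup>2"
      by (metis norm_ge_zero power_mono power_mult_distrib)
  qed
  then show ?thesis using k by (simp add: T_def cinner_scaleR_right divide_right_mono field_simps)
qed

section \<open>Unital completely positive maps\<close>

lemma ucp_mapsD:
  assumes "\<phi> \<in> ucp_maps M"
  shows ucp_closed: "x \<in> M \<Longrightarrow> \<phi> x \<in> M"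
    and ucp_id: "\<phi> id = id"
    and ucp_linear: "x \<in> M \<Longrightarrow> y \<in> M \<Longrightarrow> \<phi> (\<lambda>\<xi>. x \<xi> + c *\<^sub>C y \<xi>) = (\<lambda>\<xi>. \<phi> x \<xi> + c *\<^sub>C \<phi> y \<xi>)"
    and ucp_positive_matrix: "(\<And>i j. i < n \<Longrightarrow> j < n \<Longrightarrow> X i j \<in> M) \<Longrightarrow> positive_matrix n X \<Longrightarrow>
        positive_matrix n (\<lambda>i j. \<phi> (X i j))"
  using assms by (auto simp: ucp_maps_def completely_positive_def)

lemma ucp_zero:
  assumes "\<phi> \<in> ucp_maps M" "von_neumann_algebra M" shows "\<phi> (\<lambda>_. 0) = (\<lambda>_. 0)"
proof -
  have "\<phi> (\<lambda>\<xi>. id \<xi> + (-1) *\<^sub>C id \<xi>) = (\<lambda>\<xi>. \<phi> id \<xi> + (-1) *\<^sub>C \<phi> id \<xi>)"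
    by (intro ucp_linear[OF assms(1)] von_neumann_id[OF assms(2)])
  then show ?thesis by (simp add: scaleC.minus_left)
qed

lemma ucp_lincomb:
  assumes "\<phi> \<in> ucp_maps M" "von_neumann_algebra M" "x \<in> M" "y \<in> M"
  shows "\<phi> (\<lambda>\<xi>. a *\<^sub>C x \<xi> + b *\<^sub>C y \<xi>) = (\<lambda>\<xi>. a *\<^sub>C \<phi> x \<xi> + b *\<^sub>C \<phi> y \<xi>)"
proof -
  have ax: "\<phi> (\<lambda>\<xi>. a *\<^sub>C x \<xi>) = (\<lambda>\<xi>. a *\<^sub>C \<phi> x \<xi>)"
    using ucp_linear[OF assms(1) von_neumann_zero[OF assms(2)] assms(3), of a]
    by (simp add: ucp_zero[OF assms(1,2)])
  have "(\<lambda>\<xi>. a *\<^sub>C x \<xi>) \<in> M"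
    using von_neumann_lincomb[OF assms(2,3,3), of a 0] by simp
  from ucp_linear[OF assms(1) this assms(4)] ax show ?thesis by simp
qed

lemma ucp_positive:
  assumes "\<phi> \<in> ucp_maps M" "x \<in> M" "positive_op x" shows "positive_op (\<phi> x)"
proof -
  have "positive_matrix 1 (\<lambda>i j. \<phi> x)"
    by (rule ucp_positive_matrix[OF assms(1)]) (use assms in \<open>auto simp: positive_matrix_def positive_op_def\<close>)
  then have "cinner \<xi> (\<phi> x \<xi>) \<in> \<real>\<^sub>\<ge>\<^sub>0" for \<xi>
    unfolding positive_matrix_def by (auto dest!: spec[of _ "\<lambda>_. \<xi>"])
  then show ?thesis by (simp add: positive_op_def)
qed

text \<open>The 2 by 2 operator matrix with \<open>onorm x\<close> on the diagonal and
  \<open>x\<close>, \<open>adj x\<close> off it is positive. Its image under the unital map has the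
  same diagonal, and the determinant inequality gives the bound. The bound fixes the radii of the
  discs in the compactness proof.\<close>

lemma ucp_contractive:
  assumes \<phi>: "\<phi> \<in> ucp_maps M" and M: "von_neumann_algebra M" and x: "x \<in> M"
  shows "cmod (cinner \<xi> (\<phi> x \<eta>)) \<le> onorm x * norm \<xi> * norm \<eta>"
proof -
  have xb: "x \<in> bounded_ops" using M x von_neumann_bounded by blast
  define k where "k = onorm x"
  have k: "k \<ge> 0" using bounded_opsD(10)[OF xb] by (simp add: k_def)
  define kid :: "'a \<Rightarrow> 'a" where "kid = (\<lambda>\<xi>. k *\<^sub>R id \<xi>)"
  have kid: "kid \<in> M" unfolding kid_def by (rule von_neumann_scaleR[OF M von_neumann_id[OF M]])
  have "\<phi> (\<lambda>\<xi>. of_real k *\<^sub>C id \<xi> + 0 *\<^sub>C id \<xi>) = (\<lambda>\<xi>. of_real k *\<^sub>C \<phi> id \<xi> + 0 *\<^sub>C \<phi> id \<xi>)"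
    by (intro ucp_lincomb[OF \<phi> M] von_neumann_id[OF M])
  then have \<phi>kid: "\<phi> kid = kid" by (simp add: kid_def ucp_id[OF \<phi>] scaleC_of_real)
  define X where "X i j = (if i = j then kid else if i = 0 then x else adj x)" for i j :: nat
  have "positive_matrix 2 X"
    unfolding positive_matrix_def
  proof
    fix \<zeta> :: "nat \<Rightarrow> 'a"
    have "(\<Sum>i<2. \<Sum>j<2. cinner (\<zeta> i) (X i j (\<zeta> j))) =
        of_real (k * (norm (\<zeta> 0))\<^sup>2 + k * (norm (\<zeta> 1))\<^sup>2) + cinner (\<zeta> 0) (x (\<zeta> 1)) + cnj (cinner (\<zeta> 0) (x (\<zeta> 1)))"
      by (simp add: numeral_2_eq_2 X_def kid_def cinner_scaleR_right cinner_self cinner_adj_right[OF xb]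
          scaleR_conv_of_real flip: cinner_commute)
    moreover have "k * (norm (\<zeta> 0))\<^sup>2 + k * (norm (\<zeta> 1))\<^sup>2 + 2 * Re (cinner (\<zeta> 0) (x (\<zeta> 1))) \<ge> 0"
    proof -
      have "cmod (cinner (\<zeta> 0) (x (\<zeta> 1))) \<le> norm (\<zeta> 0) * (k * norm (\<zeta> 1))"
        unfolding k_def
        by (rule order_trans[OF norm_cinner_le mult_left_mono[OF bounded_opsD(9)[OF xb]]]) simp
      then have "- Re (cinner (\<zeta> 0) (x (\<zeta> 1))) \<le> k * (norm (\<zeta> 0) * norm (\<zeta> 1))"
        using abs_Re_le_cmod[of "cinner (\<zeta> 0) (x (\<zeta> 1))"] by (simp add: mult_ac)
      moreover have "k * (2 * (norm (\<zeta> 0) * norm (\<zeta> 1))) \<le> k * ((norm (\<zeta> 0))\<^sup>2 + (norm (\<zeta> 1))\<^sup>2)"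
        using k sum_squares_bound[of "norm (\<zeta> 0)" "norm (\<zeta> 1)"] by (intro mult_left_mono) (auto simp: mult_ac)
      ultimately show ?thesis by (simp add: algebra_simps)
    qed
    ultimately show "(\<Sum>i<2. \<Sum>j<2. cinner (\<zeta> i) (X i j (\<zeta> j))) \<in> \<real>\<^sub>\<ge>\<^sub>0"
      by (simp add: complex_nonneg_Reals_iff)
  qed
  then have pm: "positive_matrix 2 (\<lambda>i j. \<phi> (X i j))"
    by (rule ucp_positive_matrix[OF \<phi>, rotated]) (auto simp: X_def kid x von_neumann_adj[OF M])
  have b: "\<phi> x \<in> bounded_ops" "\<phi> (adj x) \<in> bounded_ops"
    using ucp_closed[OF \<phi>] x von_neumann_adj[OF M] von_neumann_bounded[OF M] by auto
  have *: "cnj s * s * of_real (k * (norm \<xi>)\<^sup>2) + cnj s * t * cinner \<xi> (\<phi> x \<eta>) +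
      cnj t * s * cinner \<eta> (\<phi> (adj x) \<xi>) + cnj t * t * of_real (k * (norm \<eta>)\<^sup>2) \<in> \<real>\<^sub>\<ge>\<^sub>0" for s t \<xi> \<eta>
  proof -
    have h: "(\<Sum>i<2. \<Sum>j<2. cinner ((\<lambda>n::nat. if n = 0 then s *\<^sub>C \<xi> else t *\<^sub>C \<eta>) i)
        (\<phi> (X i j) ((\<lambda>n::nat. if n = 0 then s *\<^sub>C \<xi> else t *\<^sub>C \<eta>) j))) \<in> \<real>\<^sub>\<ge>\<^sub>0"
      using spec[OF pm[unfolded positive_matrix_def], of "\<lambda>n. if n = 0 then s *\<^sub>C \<xi> else t *\<^sub>C \<eta>"] .
    have nsq: "(complex_of_real (norm (c *\<^sub>C v)))\<^sup>2 = c * (cnj c * (complex_of_real (norm v))\<^sup>2)"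
      for c and v :: 'a
      using complex_norm_square[of c] by (simp add: norm_scaleC power_mult_distrib)
    show ?thesis
      using h by (simp add: numeral_2_eq_2 X_def \<phi>kid) (simp add: kid_def bounded_opsD[OF b(1)] bounded_opsD[OF b(2)]
          cinner_scaleR_right cinner_self cinner_scaleC_left cinner_scaleC_right
          scaleR_conv_of_real nsq[unfolded power2_eq_square] power2_eq_square add_ac mult_ac)
  qed
  have "(cmod (cinner \<xi> (\<phi> x \<eta>)))\<^sup>2 \<le> (k * norm \<xi> * norm \<eta>)\<^sup>2"
    using positive_hermitian_2x2(2)[OF *, of \<xi> \<eta>] by (simp add: power2_eq_square mult_ac)
  then show "cmod (cinner \<xi> (\<phi> x \<eta>)) \<le> onorm x * norm \<xi> * norm \<eta>"
    using k by (auto simp: k_def intro: power2_le_imp_le)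
qed

subsection \<open>Vacuum preserving maps are normal\<close>

lemma cinner_eq_dense:
  assumes "closure D = UNIV" "\<And>d. d \<in> D \<Longrightarrow> cinner w d = cinner w' d"
  shows "w = w'"
proof -
  have "closed {d. cinner w d = cinner w' d}"
    by (intro closed_Collect_eq continuous_intros cinner.continuous_on)
  then have "closure D \<subseteq> {d. cinner w d = cinner w' d}"
    using assms(2) by (intro closure_minimal) auto
  then have "cinner (w - w') (w - w') = 0"
    using assms(1) by (auto simp: cinner.diff_left)
  then show ?thesis by (simp add: cinner_self)
qed

lemma bounded_ops_eq_dense:
  assumes D: "closure D = UNIV" and S: "S \<in> bounded_ops" and T: "T \<in> bounded_ops"
    and eq: "\<And>d. d \<in> D \<Longrightarrow> S d = T d"
  shows "S = T"
proof -
  have "closed {d. S d = T d}"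
    by (intro closed_Collect_eq bounded_opsD(8)[OF S] bounded_opsD(8)[OF T])
  then have "closure D \<subseteq> {d. S d = T d}" using eq by (intro closure_minimal) auto
  then show ?thesis using D by auto
qed

lemma norm_cinner_op_le:
  assumes "T \<in> bounded_ops" shows "cmod (cinner \<xi> (T \<eta>)) \<le> onorm T * (norm \<xi> * norm \<eta>)"
proof -
  have "cmod (cinner \<xi> (T \<eta>)) \<le> norm \<xi> * (onorm T * norm \<eta>)"
    by (rule order_trans[OF norm_cinner_le mult_left_mono[OF bounded_opsD(9)[OF assms]]]) simp
  then show ?thesis by (simp add: mult_ac)
qed

text \<open>\<open>R\<close> is the adjoint of the desired extension and is defined on all vectors
  by the Riesz lemma. Indexing by \<open>M\<close> spares a proof that \<open>h b\<close> depends on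
  \<open>e b\<close> only; this is a consequence.\<close>

lemma dense_op_extension:
  fixes e h :: "'b \<Rightarrow> 'a::complex_hilbert"
  assumes ne: "M \<noteq> {}" and D: "closure (e ` M) = UNIV"
    and lin: "\<And>a b s t. a \<in> M \<Longrightarrow> b \<in> M \<Longrightarrow>
      \<exists>c\<in>M. e c = s *\<^sub>C e a + t *\<^sub>C e b \<and> h c = s *\<^sub>C h a + t *\<^sub>C h b"
    and bd: "\<And>b. b \<in> M \<Longrightarrow> norm (h b) \<le> C * norm (e b)" and C: "C \<ge> 0"
  shows "\<exists>T\<in>bounded_ops. \<forall>b\<in>M. T (e b) = h b"
proof -
  have "\<exists>w. norm w \<le> C * norm \<xi> \<and> (\<forall>b\<in>M. cinner w (e b) = cinner \<xi> (h b))" for \<xi>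
  proof -
    have "\<exists>w\<in>closure (e ` M). norm w \<le> norm \<xi> * C \<and> (\<forall>b\<in>M. cinner w (e b) = cinner \<xi> (h b))"
    proof (rule riesz_indexed[OF ne])
      show "\<exists>c\<in>M. e c = s *\<^sub>C e a + t *\<^sub>C e b \<and>
          cinner \<xi> (h c) = s * cinner \<xi> (h a) + t * cinner \<xi> (h b)" if "a \<in> M" "b \<in> M" for a b s t
        using lin[OF that, of s t] by (auto simp: cinner_add_right cinner_scaleC_right)
      show "cmod (cinner \<xi> (h b)) \<le> norm \<xi> * C * norm (e b)" if "b \<in> M" for b
        using order_trans[OF norm_cinner_le mult_left_mono[OF bd[OF that] norm_ge_zero]]
        by (simp add: mult_ac)
    qed (use C in auto)
    then show ?thesis by (auto simp: mult.commute)
  qed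
  then obtain R where R: "\<And>\<xi>. norm (R \<xi>) \<le> C * norm \<xi>"
      "\<And>\<xi> b. b \<in> M \<Longrightarrow> cinner (R \<xi>) (e b) = cinner \<xi> (h b)"
    by metis
  have Rb: "R \<in> bounded_ops"
  proof (rule bounded_opsI[where K=C])
    show "R (x + y) = R x + R y" for x y
      by (rule cinner_eq_dense[OF D]) (auto simp: R cinner_add_left)
    show "R (c *\<^sub>C x) = c *\<^sub>C R x" for c x
      by (rule cinner_eq_dense[OF D]) (auto simp: R cinner_scaleC_left)
  qed (rule R)
  show ?thesis
  proof (intro bexI ballI)
    show "adj R \<in> bounded_ops" by (rule adj_bounded_ops[OF Rb])
    show "adj R (e b) = h b" if "b \<in> M" for b
      by (rule cinner_eqI) (simp add: cinner_adj_right[OF Rb] R that)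
  qed
qed

lemma continuous_map_into_coarsest:
  assumes "g ` topspace T0 \<subseteq> X" "\<And>j. j \<in> J \<Longrightarrow> continuous_map T0 (T j) (f j \<circ> g)"
  shows "continuous_map T0 (coarsest_topology X J f T) g"
  unfolding coarsest_topology_def
proof (rule continuous_on_generated_topo)
  fix W assume "W \<in> insert X {{x \<in> X. f j x \<in> V} |j V. j \<in> J \<and> openin (T j) V}"
  then consider "W = X" | j V where "j \<in> J" "openin (T j) V" "W = {x \<in> X. f j x \<in> V}" by blast
  then show "openin T0 (g -` W \<inter> topspace T0)"
  proof cases
    case 1
    then have "g -` W \<inter> topspace T0 = topspace T0" using assms(1) by auto
    then show ?thesis by simp
  next
    case 2
    have "g -` W \<inter> topspace T0 = {x \<in> topspace T0. (f j \<circ> g) x \<in> V}" using 2 assms(1) by auto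
    then show ?thesis using openin_continuous_map_preimage[OF assms(2)[OF 2(1)] 2(2)] by simp
  qed
qed (use assms in auto)

section \<open>Nuclear functionals and their ultraweak continuity\<close>

lemma square_summable_product:
  fixes \<xi> \<eta> :: "nat \<Rightarrow> 'a::real_normed_vector"
  assumes "summable (\<lambda>n. (norm (\<xi> n))\<^sup>2)" "summable (\<lambda>n. (norm (\<eta> n))\<^sup>2)"
  shows "summable (\<lambda>n. norm (\<xi> n) * norm (\<eta> n))"
proof (rule summable_comparison_test[OF _ summable_add[OF assms]])
  have "norm (\<xi> n) * norm (\<eta> n) \<le> (norm (\<xi> n))\<^sup>2 + (norm (\<eta> n))\<^sup>2" for n
    using sum_squares_bound[of "norm (\<xi> n)" "norm (\<eta> n)", unfolded mult.assoc]
      mult_nonneg_nonneg[OF norm_ge_zero norm_ge_zero, of "\<xi> n" "\<eta> n"]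
    by linarith
  then show "\<exists>N. \<forall>n\<ge>N. norm (norm (\<xi> n) * norm (\<eta> n)) \<le> (norm (\<xi> n))\<^sup>2 + (norm (\<eta> n))\<^sup>2" by simp
qed

text \<open>The bound \<open>c\<close> is what makes this class of functionals closed under countable sums.\<close>

definition nuclear :: "('h::complex_hilbert \<Rightarrow> 'h) set \<Rightarrow> real \<Rightarrow> (('h \<Rightarrow> 'h) \<Rightarrow> complex) \<Rightarrow> bool" where
  "nuclear M c f \<longleftrightarrow> (\<exists>\<xi> \<eta> p. ((\<lambda>n::nat. norm (\<xi> n) * norm (\<eta> n)) has_sum p) UNIV \<and> p \<le> c \<and>
     (\<forall>x\<in>M. ((\<lambda>n. cinner (\<xi> n) (x (\<eta> n))) has_sum f x) UNIV))"

lemma nuclear_mono: "nuclear M c f \<Longrightarrow> c \<le> d \<Longrightarrow> nuclear M d f"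
  unfolding nuclear_def by force

lemma nuclear_cong: "nuclear M c f \<Longrightarrow> (\<And>x. x \<in> M \<Longrightarrow> f x = g x) \<Longrightarrow> nuclear M c g"
  unfolding nuclear_def by simp

lemma nuclear_scale:
  assumes "nuclear M c f" shows "nuclear M (cmod a * c) (\<lambda>x. a * f x)"
proof -
  obtain \<xi> \<eta> p where *: "((\<lambda>n::nat. norm (\<xi> n) * norm (\<eta> n)) has_sum p) UNIV" "p \<le> c"
     "\<And>x. x \<in> M \<Longrightarrow> ((\<lambda>n. cinner (\<xi> n) (x (\<eta> n))) has_sum f x) UNIV"
    using assms unfolding nuclear_def by blast
  show ?thesis
    unfolding nuclear_def
  proof (intro exI conjI ballI)
    show "((\<lambda>n. norm (cnj a *\<^sub>C \<xi> n) * norm (\<eta> n)) has_sum cmod a * p) UNIV"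
      using has_sum_cmult_right[OF *(1), of "cmod a"] by (simp add: norm_scaleC mult_ac)
    show "((\<lambda>n. cinner (cnj a *\<^sub>C \<xi> n) (x (\<eta> n))) has_sum a * f x) UNIV" if "x \<in> M" for x
      using has_sum_cmult_right[OF *(3)[OF that], of a] by (simp add: cinner_scaleC_left)
  qed (use * in \<open>auto intro: mult_left_mono\<close>)
qed

text \<open>The double family of vector pairs is absolutely summable by the bounds
  \<open>c i\<close>, so it may be enumerated in any order. This is why \<open>nuclear\<close> is
  phrased with unordered sums.\<close>

lemma nuclear_countable_sum:
  assumes M: "M \<subseteq> bounded_ops" and f: "\<And>i::nat. nuclear M (c i) (f i)" and c: "(c has_sum C) UNIV"
    and g: "\<And>x. x \<in> M \<Longrightarrow> ((\<lambda>i. f i x) has_sum g x) UNIV"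
  shows "nuclear M C g"
proof -
  obtain \<xi> \<eta> p where p: "\<And>i. ((\<lambda>n::nat. norm (\<xi> i n) * norm (\<eta> i n)) has_sum p i) UNIV" "\<And>i. p i \<le> c i"
    and s: "\<And>i x. x \<in> M \<Longrightarrow> ((\<lambda>n. cinner (\<xi> i n) (x (\<eta> i n))) has_sum f i x) UNIV"
  proof -
    let ?Q = "\<lambda>i t. ((\<lambda>n::nat. norm (fst t n) * norm (fst (snd t) n)) has_sum snd (snd t)) UNIV \<and>
      snd (snd t) \<le> c i \<and> (\<forall>x\<in>M. ((\<lambda>n. cinner (fst t n) (x (fst (snd t) n))) has_sum f i x) UNIV)"
    have "\<exists>t. ?Q i t" for i
      using f[of i] unfolding nuclear_def by auto
    then obtain t where t: "\<And>i. ?Q i (t i)"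
      using choice[of ?Q] by blast
    show ?thesis
      by (rule that[of "\<lambda>i. fst (t i)" "\<lambda>i. fst (snd (t i))" "\<lambda>i. snd (snd (t i))"]) (use t in auto)
  qed
  have p0: "0 \<le> p i" for i using p(1) by (rule has_sum_nonneg) auto
  have psum: "p summable_on UNIV"
    by (rule summable_on_comparison_test[of c]) (use c p p0 in \<open>auto simp: summable_on_def\<close>)
  have dom: "(\<lambda>(i, n). norm (\<xi> i n) * norm (\<eta> i n)) summable_on UNIV \<times> UNIV"
    by (rule summable_on_SigmaI[OF _ psum]) (use p in auto)
  have norms: "((\<lambda>(i, n). norm (\<xi> i n) * norm (\<eta> i n)) has_sum infsum p UNIV) (UNIV \<times> UNIV)"
    by (rule has_sum_SigmaI[OF _ has_sum_infsum[OF psum] dom]) (use p in auto)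
  have vals: "((\<lambda>(i, n). cinner (\<xi> i n) (x (\<eta> i n))) has_sum g x) (UNIV \<times> UNIV)" if x: "x \<in> M" for x
  proof (rule has_sum_SigmaI[OF _ g[OF x]])
    have xb: "x \<in> bounded_ops" using M x by auto
    have "(\<lambda>k. onorm x * (case k of (i, n) \<Rightarrow> norm (\<xi> i n) * norm (\<eta> i n))) summable_on UNIV \<times> UNIV"
      using summable_on_cmult_right[OF dom] by blast
    moreover have "norm (case k of (i, n) \<Rightarrow> cinner (\<xi> i n) (x (\<eta> i n)))
        \<le> onorm x * (case k of (i, n) \<Rightarrow> norm (\<xi> i n) * norm (\<eta> i n))" for k
      using norm_cinner_op_le[OF xb] by (simp split: prod.split)
    ultimately have "(\<lambda>k. norm (case k of (i, n) \<Rightarrow> cinner (\<xi> i n) (x (\<eta> i n)))) summable_on UNIV \<times> UNIV"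
      by (rule Infinite_Sum.abs_summable_on_comparison_test')
    then show "(\<lambda>k. case k of (i, n) \<Rightarrow> cinner (\<xi> i n) (x (\<eta> i n))) summable_on UNIV \<times> UNIV"
      by (rule abs_summable_summable)
  qed (use s x in auto)
  have le: "infsum p UNIV \<le> C"
    using has_sum_mono[OF has_sum_infsum[OF psum] c] p by auto
  \<comment> \<open>\<open>nuclear\<close> requires sequences, so the pairs \<open>(i, n)\<close>
    are enumerated by the natural numbers.\<close>
  have bij: "bij_betw prod_decode UNIV (UNIV \<times> UNIV)" using bij_prod_decode by simp
  show ?thesis
    unfolding nuclear_def
  proof (intro exI conjI ballI)
    show "((\<lambda>k. norm (case prod_decode k of (i, n) \<Rightarrow> \<xi> i n) * norm (case prod_decode k of (i, n) \<Rightarrow> \<eta> i n))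
        has_sum infsum p UNIV) UNIV"
      using iffD2[OF has_sum_reindex_bij_betw[OF bij] norms] by (simp add: case_prod_unfold)
    show "((\<lambda>k. cinner (case prod_decode k of (i, n) \<Rightarrow> \<xi> i n) (x (case prod_decode k of (i, n) \<Rightarrow> \<eta> i n)))
        has_sum g x) UNIV" if "x \<in> M" for x
      using iffD2[OF has_sum_reindex_bij_betw[OF bij] vals[OF that]] by (simp add: case_prod_unfold)
  qed (rule le)
qed

lemma nuclear_finite_sum:
  fixes n :: nat
  assumes M: "M \<subseteq> bounded_ops" and f: "\<And>i. i < n \<Longrightarrow> nuclear M c (f i)"
    and g: "\<And>x. x \<in> M \<Longrightarrow> g x = (\<Sum>i<n. f i x)"
  shows "nuclear M (real n * c) g"
proof (rule nuclear_countable_sum[OF M, where c = "\<lambda>i. if i < n then c else 0"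
      and f = "\<lambda>i. if i < n then f i else (\<lambda>_. 0)"])
  have zero: "nuclear M 0 (\<lambda>_. 0)"
    unfolding nuclear_def by (intro exI[of _ "\<lambda>_. 0"] exI[of _ 0]) auto
  show "nuclear M (if i < n then c else 0) (if i < n then f i else (\<lambda>_. 0))" for i
    using f zero by auto
  show "((\<lambda>i. if i < n then c else 0) has_sum real n * c) UNIV"
    by (rule iffD1[OF has_sum_cong_neutral has_sum_finiteI[of "{..<n}" _ "\<lambda>_. c"]]) auto
  show "((\<lambda>i. (if i < n then f i else (\<lambda>_. 0)) x) has_sum g x) UNIV" if "x \<in> M" for x
    by (rule iffD1[OF has_sum_cong_neutral has_sum_finiteI[of "{..<n}" _ "\<lambda>i. f i x"]])
      (use g[OF that] in auto)
qed

text \<open>In \<open>nuclear\<close> only the products of the norms are summable, whereas the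
  ultraweak topology is defined by two square summable sequences. Rescaling each pair to equal norms
  passes from one to the other without changing the values.\<close>

lemma nuclear_continuous:
  assumes M: "M \<subseteq> bounded_ops" and f: "nuclear M c f"
  shows "continuous_map (ultraweak_topology M) euclidean f"
proof -
  obtain \<xi> \<eta> p where p: "((\<lambda>n::nat. norm (\<xi> n) * norm (\<eta> n)) has_sum p) UNIV"
    and s: "\<And>x. x \<in> M \<Longrightarrow> ((\<lambda>n. cinner (\<xi> n) (x (\<eta> n))) has_sum f x) UNIV"
    using f unfolding nuclear_def by blast
  have "\<exists>a b. (norm a)\<^sup>2 = norm \<alpha> * norm \<beta> \<and> (norm b)\<^sup>2 = norm \<alpha> * norm \<beta> \<and>
      (\<forall>x\<in>bounded_ops. cinner a (x b) = cinner \<alpha> (x \<beta>))" for \<alpha> \<beta> :: 'a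
  proof (cases "\<alpha> = 0 \<or> \<beta> = 0")
    case True
    then show ?thesis
      by (intro exI[of _ "0::'a"]) (auto simp: bounded_opsD)
  next
    case False
    \<comment> \<open>With this ratio the squared norms of \<open>r *\<^sub>R \<alpha>\<close> and
      \<open>(1 / r) *\<^sub>R \<beta>\<close> both equal
      \<open>norm \<alpha> * norm \<beta>\<close>.\<close>
    define r where "r = sqrt (norm \<beta> / norm \<alpha>)"
    have r: "r > 0" "r\<^sup>2 = norm \<beta> / norm \<alpha>" using False by (auto simp: r_def)
    show ?thesis
      using False r
      by (intro exI[of _ "r *\<^sub>R \<alpha>"] exI[of _ "(1 / r) *\<^sub>R \<beta>"])
        (auto simp: power_mult_distrib power_divide power2_eq_square[of "norm \<alpha>"]
          power2_eq_square[of "norm \<beta>"] bounded_opsD cinner_scaleR_left cinner_scaleR_right)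
  qed
  then obtain a b where ab: "\<And>\<alpha> \<beta> :: 'a. (norm (a \<alpha> \<beta>))\<^sup>2 = norm \<alpha> * norm \<beta>"
      "\<And>\<alpha> \<beta> :: 'a. (norm (b \<alpha> \<beta>))\<^sup>2 = norm \<alpha> * norm \<beta>"
      "\<And>\<alpha> \<beta> x. x \<in> bounded_ops \<Longrightarrow> cinner (a \<alpha> \<beta>) (x (b \<alpha> \<beta>)) = cinner \<alpha> (x \<beta>)"
    by metis
  define \<xi>' \<eta>' where "\<xi>' n = a (\<xi> n) (\<eta> n)" and "\<eta>' n = b (\<xi> n) (\<eta> n)" for n
  have sq: "(\<xi>', \<eta>') \<in> square_summable \<times> square_summable"
    using has_sum_imp_sums[OF p] by (auto simp: square_summable_def \<xi>'_def \<eta>'_def ab sums_iff)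
  have val: "(\<Sum>n. cinner (\<xi>' n) (x (\<eta>' n))) = f x" if "x \<in> M" for x
    using has_sum_imp_sums[OF s[OF that]] that M by (auto simp: \<xi>'_def \<eta>'_def ab sums_iff)
  have "continuous_map (ultraweak_topology M) euclidean (\<lambda>x. \<Sum>n. cinner (\<xi>' n) (x (\<eta>' n)))"
    using continuous_map_coarsest_topology[OF sq, of "\<lambda>(\<xi>, \<eta>) x. \<Sum>n. cinner (\<xi> n) (x (\<eta> n))" M "\<lambda>_. euclidean"]
    by (simp add: ultraweak_topology_def)
  then show ?thesis
    by (rule continuous_map_eq) (simp add: ultraweak_topology_def val)
qed

text \<open>Cyclicity for the commutant is the separating property in the form that supplies the
  dense set of vectors for the normality argument.\<close>

locale vacuum_algebra =
  fixes M :: "('h::complex_hilbert \<Rightarrow> 'h) set" and \<Omega> :: 'h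
  assumes vN: "von_neumann_algebra M"
    and cyclic: "closure ((\<lambda>x. x \<Omega>) ` M) = UNIV"
    and cyclic_commutant: "closure ((\<lambda>x. x \<Omega>) ` commutant M) = UNIV"
begin

lemmas Mb = von_neumann_bounded(2)[OF vN]

lemma separating:
  assumes "x \<in> M" "x \<Omega> = 0" shows "x = (\<lambda>_. 0)"
proof (rule bounded_ops_eq_dense[OF cyclic_commutant Mb[OF assms(1)] bounded_ops_zero])
  fix d assume "d \<in> (\<lambda>x. x \<Omega>) ` commutant M"
  then obtain y where "y \<in> commutant M" "d = y \<Omega>" by blast
  then show "x d = 0"
    using commutantD[of y M x] assms commutant_bounded_ops[of M] bounded_opsD(5)[of y] by auto
qed

end

locale vacuum_preserving_map = vacuum_algebra M \<Omega>
  for M :: "('h::complex_hilbert \<Rightarrow> 'h) set" and \<Omega> :: 'h +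
  fixes \<phi> :: "('h \<Rightarrow> 'h) \<Rightarrow> ('h \<Rightarrow> 'h)"
  assumes \<phi>: "\<phi> \<in> ucp_maps M"
    and vacuum: "x \<in> M \<Longrightarrow> cinner \<Omega> (\<phi> x \<Omega>) = cinner \<Omega> (x \<Omega>)"
begin

lemma faithful: "faithful_map M \<phi>"
  unfolding faithful_map_def
proof (intro ballI impI)
  fix x assume x: "x \<in> M" "positive_op x" "\<phi> x = (\<lambda>_. 0)"
  have "cinner \<Omega> (x \<Omega>) = 0" using vacuum[OF x(1)] x(3) by simp
  \<comment> \<open>Cauchy-Schwarz for the form of \<open>x\<close> at \<open>x \<Omega>\<close> and
    \<open>\<Omega>\<close> yields \<open>x \<Omega> = 0\<close> without a square root of
    \<open>x\<close>.\<close>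
  then have "(cmod (cinner (x \<Omega>) (x \<Omega>)))\<^sup>2 \<le> 0"
    using positive_op_norm_cinner_le[OF Mb[OF x(1)] x(2), of "x \<Omega>" \<Omega>] by simp
  then have "x \<Omega> = 0" by (simp add: cinner_self)
  then show "x = (\<lambda>_. 0)" by (rule separating[OF x(1)])
qed

text \<open>A Radon-Nikodym argument. The form \<open>s\<close> is bounded on the vectors
  \<open>a \<Omega>\<close>, hence given by a positive operator \<open>G\<close>, which lies in the
  commutant. Writing a multiple of \<open>G\<close> as a sum of squares exhibits the functional as a
  sum of vector states.\<close>

lemma nuclear_diagonal:
  assumes z: "z \<in> commutant M"
  shows "nuclear M ((norm (z \<Omega>))\<^sup>2) (\<lambda>x. cinner (z \<Omega>) (\<phi> x (z \<Omega>)))"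
proof -
  define s where "s a b = cinner (z \<Omega>) (\<phi> (adj a \<circ> b) (z \<Omega>))" for a b
  have adjM: "adj a \<in> M" if "a \<in> M" for a using that von_neumann_adj[OF vN] by blast
  have prodM: "adj a \<circ> b \<in> M" if "a \<in> M" "b \<in> M" for a b
    using that by (intro von_neumann_comp[OF vN] adjM)
  have pos: "positive_op (adj a \<circ> a)" if "a \<in> M" for a
    using that by (auto simp: positive_op_def cinner_adj_right[OF Mb] cinner_self)
  have spos: "s a a \<in> \<real>\<^sub>\<ge>\<^sub>0" if "a \<in> M" for a
    using ucp_positive[OF \<phi> prodM[OF that that] pos[OF that]] by (simp add: s_def positive_op_def)
  have sr: "s a (\<lambda>\<xi>. p *\<^sub>C b \<xi> + q *\<^sub>C c \<xi>) = p * s a b + q * s a c"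
    if "a \<in> M" "b \<in> M" "c \<in> M" for a b c p q
  proof -
    have "adj a \<circ> (\<lambda>\<xi>. p *\<^sub>C b \<xi> + q *\<^sub>C c \<xi>) = (\<lambda>\<xi>. p *\<^sub>C (adj a \<circ> b) \<xi> + q *\<^sub>C (adj a \<circ> c) \<xi>)"
      using bounded_opsD[OF Mb[OF adjM[OF that(1)]]] by auto
    then show ?thesis
      using ucp_lincomb[OF \<phi> vN prodM prodM, of a b a c p q] that
      by (simp add: s_def cinner_add_right cinner_scaleC_right)
  qed
  have sl: "s (\<lambda>\<xi>. p *\<^sub>C b \<xi> + q *\<^sub>C c \<xi>) a = cnj p * s b a + cnj q * s c a"
    if "a \<in> M" "b \<in> M" "c \<in> M" for a b c p q
  proof -
    have "adj (\<lambda>\<xi>. p *\<^sub>C b \<xi> + q *\<^sub>C c \<xi>) = (\<lambda>\<xi>. cnj p *\<^sub>C adj b \<xi> + cnj q *\<^sub>C adj c \<xi>)"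
      using that by (intro adj_eqI Mb von_neumann_lincomb[OF vN])
        (auto simp: cinner_add_left cinner_add_right cinner_scaleC_left cinner_scaleC_right cinner_adj_left[OF Mb])
    then have "adj (\<lambda>\<xi>. p *\<^sub>C b \<xi> + q *\<^sub>C c \<xi>) \<circ> a
        = (\<lambda>\<xi>. cnj p *\<^sub>C (adj b \<circ> a) \<xi> + cnj q *\<^sub>C (adj c \<circ> a) \<xi>)" by auto
    then show ?thesis
      using ucp_lincomb[OF \<phi> vN prodM prodM, of b a c a "cnj p" "cnj q"] that
      by (simp add: s_def cinner_add_right cinner_scaleC_right)
  qed
  have form: "cnj p * p * s a a + cnj p * q * s a b + cnj q * p * s b a + cnj q * q * s b b \<in> \<real>\<^sub>\<ge>\<^sub>0"
    if ab: "a \<in> M" "b \<in> M" for a b p q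
  proof -
    have c: "(\<lambda>\<xi>. p *\<^sub>C a \<xi> + q *\<^sub>C b \<xi>) \<in> M" using von_neumann_lincomb[OF vN ab] .
    show ?thesis
      using spos[OF c] by (simp add: sr[OF c ab] sl ab algebra_simps)
  qed
  have sherm: "s b a = cnj (s a b)" if "a \<in> M" "b \<in> M" for a b
    by (rule positive_hermitian_2x2(1)[OF form[OF that]])
  define K where "K = onorm z + 1"
  have zb: "z \<in> bounded_ops" using z commutant_bounded_ops by auto
  have K: "K > 0" using bounded_opsD(10)[OF zb] by (simp add: K_def)
  \<comment> \<open>Since \<open>\<phi>\<close> maps into \<open>M\<close>, \<open>z\<close>
    commutes with its values and can be traded for the factor \<open>(onorm z)\<^sup>2\<close>;
    invariance of the vacuum then removes \<open>\<phi>\<close>.\<close>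
  have sdiag: "Re (s a a) \<le> (K * norm (a \<Omega>))\<^sup>2" if a: "a \<in> M" for a
  proof -
    have "Re (s a a) \<le> (onorm z)\<^sup>2 * Re (cinner \<Omega> (\<phi> (adj a \<circ> a) \<Omega>))"
      unfolding s_def
      by (rule commutant_dominated[OF vN ucp_closed[OF \<phi> prodM] ucp_positive[OF \<phi> prodM pos] z]) (use a in auto)
    also have "\<dots> = (onorm z)\<^sup>2 * (norm (a \<Omega>))\<^sup>2"
      by (simp add: vacuum prodM a cinner_adj_right[OF Mb[OF a]] cinner_self)
    also have "\<dots> \<le> K\<^sup>2 * (norm (a \<Omega>))\<^sup>2"
      using bounded_opsD(10)[OF zb] by (intro mult_right_mono power_mono) (auto simp: K_def)
    finally show ?thesis by (simp add: power_mult_distrib)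
  qed
  have sbound: "cmod (s a b) \<le> K\<^sup>2 * norm (a \<Omega>) * norm (b \<Omega>)" if ab: "a \<in> M" "b \<in> M" for a b
  proof (rule power2_le_imp_le)
    have "(cmod (s a b))\<^sup>2 \<le> Re (s a a) * Re (s b b)"
      by (rule positive_hermitian_2x2(2)[OF form[OF ab]])
    also have "\<dots> \<le> (K * norm (a \<Omega>))\<^sup>2 * (K * norm (b \<Omega>))\<^sup>2"
      using spos ab sdiag by (intro mult_mono) (auto simp: complex_nonneg_Reals_iff)
    finally show "(cmod (s a b))\<^sup>2 \<le> (K\<^sup>2 * norm (a \<Omega>) * norm (b \<Omega>))\<^sup>2"
      by (simp add: power_mult_distrib power2_eq_square mult_ac)
  qed (use K in auto)
  have ne: "M \<noteq> {}" using von_neumann_id[OF vN] by auto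
  \<comment> \<open>A priori \<open>w\<close> depends on \<open>a\<close> and not only on the vector
    \<open>a \<Omega>\<close>; the indexed versions of the Riesz and extension lemmas are made for
    this.\<close>
  have "\<exists>w. norm w \<le> K\<^sup>2 * norm (a \<Omega>) \<and> (\<forall>b\<in>M. cinner w (b \<Omega>) = s a b)" if a: "a \<in> M" for a
  proof -
    have "\<exists>w\<in>closure ((\<lambda>b. b \<Omega>) ` M). norm w \<le> K\<^sup>2 * norm (a \<Omega>) \<and> (\<forall>b\<in>M. cinner w (b \<Omega>) = s a b)"
    proof (rule riesz_indexed[OF ne])
      show "\<exists>d\<in>M. d \<Omega> = p *\<^sub>C b \<Omega> + q *\<^sub>C c \<Omega> \<and> s a d = p * s a b + q * s a c"
        if "b \<in> M" "c \<in> M" for b c p q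
        using that a by (intro bexI[OF _ von_neumann_lincomb[OF vN that]]) (auto simp: sr)
    qed (use sbound a K in auto)
    then show ?thesis by blast
  qed
  then obtain w where w: "\<And>a. a \<in> M \<Longrightarrow> norm (w a) \<le> K\<^sup>2 * norm (a \<Omega>)"
      "\<And>a b. a \<in> M \<Longrightarrow> b \<in> M \<Longrightarrow> cinner (w a) (b \<Omega>) = s a b"
    by metis
  have "\<exists>G\<in>bounded_ops. \<forall>a\<in>M. G (a \<Omega>) = w a"
  proof (rule dense_op_extension[OF ne cyclic])
    show "\<exists>c\<in>M. c \<Omega> = p *\<^sub>C a \<Omega> + q *\<^sub>C b \<Omega> \<and> w c = p *\<^sub>C w a + q *\<^sub>C w b"
      if ab: "a \<in> M" "b \<in> M" for a b p q
    proof (intro bexI[OF _ von_neumann_lincomb[OF vN ab]] conjI)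
      show "w (\<lambda>\<xi>. p *\<^sub>C a \<xi> + q *\<^sub>C b \<xi>) = p *\<^sub>C w a + q *\<^sub>C w b"
        using ab by (intro cinner_eq_dense[OF cyclic])
          (auto simp: w von_neumann_lincomb[OF vN] sl cinner_add_left cinner_scaleC_left)
    qed simp
  qed (use w in auto)
  then obtain G where G: "G \<in> bounded_ops" "\<And>a. a \<in> M \<Longrightarrow> G (a \<Omega>) = w a" by blast
  have Gs: "cinner (G (a \<Omega>)) (b \<Omega>) = s a b" if "a \<in> M" "b \<in> M" for a b
    using that by (simp add: G w)
  have Gs': "cinner (a \<Omega>) (G (b \<Omega>)) = s a b" if "a \<in> M" "b \<in> M" for a b
    using Gs[OF that(2,1)] sherm[OF that] by (metis cinner_commute complex_cnj_cnj)
  have Gpos: "positive_op G"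
    by (rule positive_opI_dense[OF G(1) cyclic]) (auto simp: Gs' spos)
  \<comment> \<open>On the dense set commutation becomes
    \<open>s a (adj x \<circ> b) = s (x \<circ> a) b\<close>, where both sides evaluate
    \<open>\<phi>\<close> at the same product.\<close>
  have Gcomm: "G \<in> commutant M"
  proof (rule commutantI[OF G(1)])
    fix x \<xi> assume x: "x \<in> M"
    have "x \<circ> G = G \<circ> x"
    proof (rule bounded_ops_eq_dense[OF cyclic])
      fix d assume "d \<in> (\<lambda>x. x \<Omega>) ` M"
      then obtain a where a: "a \<in> M" "d = a \<Omega>" by blast
      show "(x \<circ> G) d = (G \<circ> x) d"
      proof (rule cinner_eq_dense[OF cyclic])
        fix e assume "e \<in> (\<lambda>x. x \<Omega>) ` M"
        then obtain b where b: "b \<in> M" "e = b \<Omega>" by blast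
        have "cinner (x (G (a \<Omega>))) (b \<Omega>) = cinner (G (a \<Omega>)) ((adj x \<circ> b) \<Omega>)"
          by (simp add: cinner_adj_right[OF Mb[OF x]])
        also have "\<dots> = s a (adj x \<circ> b)" using a b x by (intro Gs prodM)
        also have "\<dots> = s (x \<circ> a) b"
        proof -
          have "adj (x \<circ> a) = adj a \<circ> adj x"
            using x a by (intro adj_eqI Mb von_neumann_comp[OF vN]) (auto simp: cinner_adj_left[OF Mb])
          then show ?thesis by (simp add: s_def comp_assoc)
        qed
        also have "\<dots> = cinner (G ((x \<circ> a) \<Omega>)) (b \<Omega>)"
          using a b x by (intro Gs[symmetric] von_neumann_comp[OF vN])
        finally show "cinner ((x \<circ> G) d) e = cinner ((G \<circ> x) d) e" using a b by simp
      qed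
    qed (intro bounded_ops_comp G(1) Mb x)+
    then show "x (G \<xi>) = G (x \<xi>)" by (simp add: fun_eq_iff)
  qed
  define k where "k = onorm G + 1"
  have k: "k > 0" using bounded_opsD(10)[OF G(1)] by (simp add: k_def)
  have bd: "Re (cinner \<xi> (G \<xi>)) \<le> k * (norm \<xi>)\<^sup>2" for \<xi>
  proof -
    have "Re (cinner \<xi> (G \<xi>)) \<le> norm \<xi> * (onorm G * norm \<xi>)"
      by (rule order_trans[OF complex_Re_le_cmod
            order_trans[OF norm_cinner_le mult_left_mono[OF bounded_opsD(9)[OF G(1)]]]]) simp
    also have "\<dots> \<le> k * (norm \<xi>)\<^sup>2" by (simp add: k_def power2_eq_square algebra_simps)
    finally show ?thesis .
  qed
  define T where "T = (\<lambda>\<xi>. (1 / k) *\<^sub>R G \<xi>)"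
  have T: "effect T" unfolding T_def by (rule effect_scaled[OF G(1) Gpos k bd])
  have M': "von_neumann_algebra (commutant M)" by (rule von_neumann_commutant[OF vN])
  have TM': "T \<in> commutant M" unfolding T_def by (rule von_neumann_scaleR[OF M' Gcomm])
  define t where "t n = square_rest T n \<Omega>" for n
  have tx: "square_rest T n (x \<Omega>) = x (t n)" if "x \<in> M" for x n
    unfolding t_def using commutantD[OF von_neumann_square_rest[OF M' TM'] that] by simp
  have sumsT: "(\<lambda>n. k *\<^sub>R cinner (t n) (x (t n))) sums cinner (z \<Omega>) (\<phi> x (z \<Omega>))" if x: "x \<in> M" for x
  proof -
    have "(\<lambda>n. k *\<^sub>R cinner (t n) (x (t n))) sums (k *\<^sub>R cinner \<Omega> (T (x \<Omega>)))"
      using sums_scaleR_right[OF square_decomposition_sums[OF T, of \<Omega> "x \<Omega>"], of k]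
      by (simp add: tx[OF x]) (simp add: t_def)
    also have "k *\<^sub>R cinner \<Omega> (T (x \<Omega>)) = cinner (id \<Omega>) (G (x \<Omega>))"
      using k by (simp add: T_def cinner_scaleR_right)
    also have "\<dots> = s id x" by (rule Gs'[OF von_neumann_id[OF vN] x])
    also have "\<dots> = cinner (z \<Omega>) (\<phi> x (z \<Omega>))"
    proof -
      have "adj id = (id :: 'h \<Rightarrow> 'h)" by (rule adj_eqI[OF bounded_ops_id]) simp
      then show ?thesis by (simp add: s_def)
    qed
    finally show ?thesis .
  qed
  \<comment> \<open>At \<open>x = id\<close> unitality of \<open>\<phi>\<close> gives exactly
    \<open>(norm (z \<Omega>))\<^sup>2\<close>; the operator norms of \<open>z\<close> and
    \<open>G\<close> have dropped out.\<close>
  have norms: "(\<lambda>n. k * (norm (t n))\<^sup>2) sums (norm (z \<Omega>))\<^sup>2"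
    using sums_Re[OF sumsT[OF von_neumann_id[OF vN]]] by (simp add: ucp_id[OF \<phi>] cinner_self)
  show ?thesis
    unfolding nuclear_def
  proof (intro exI conjI ballI)
    show "((\<lambda>n. norm (k *\<^sub>R t n) * norm (t n)) has_sum (norm (z \<Omega>))\<^sup>2) UNIV"
      using sums_nonneg_imp_has_sum[OF norms] k by (simp add: power2_eq_square mult_ac)
    show "((\<lambda>n. cinner (k *\<^sub>R t n) (x (t n))) has_sum cinner (z \<Omega>) (\<phi> x (z \<Omega>))) UNIV" if x: "x \<in> M" for x
    proof (rule norm_summable_imp_has_sum)
      show "(\<lambda>n. cinner (k *\<^sub>R t n) (x (t n))) sums cinner (z \<Omega>) (\<phi> x (z \<Omega>))"
        using sumsT[OF x] by (simp add: cinner_scaleR_left)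
      show "summable (\<lambda>n. norm (cinner (k *\<^sub>R t n) (x (t n))))"
      proof (rule summable_comparison_test)
        show "summable (\<lambda>n. onorm x * (k * (norm (t n))\<^sup>2))"
          by (rule summable_mult[OF sums_summable[OF norms]])
        have "norm (cinner (k *\<^sub>R t n) (x (t n))) \<le> onorm x * (k * (norm (t n))\<^sup>2)" for n
          using order_trans[OF norm_cinner_le mult_left_mono[OF bounded_opsD(9)[OF Mb[OF x]]], of "k *\<^sub>R t n" "t n"] k
          by (simp add: power2_eq_square mult_ac)
        then show "\<exists>N. \<forall>n\<ge>N. norm (norm (cinner (k *\<^sub>R t n) (x (t n)))) \<le> onorm x * (k * (norm (t n))\<^sup>2)"
          by simp
      qed
    qed
  qed simp
qed

text \<open>Polarisation. It is done first for vectors of equal norm, because otherwise the bound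
  would be quadratic in the sum of the norms and not their product.\<close>

lemma nuclear_commutant_vectors:
  assumes z: "z \<in> commutant M" and w: "w \<in> commutant M"
  shows "nuclear M (4 * (norm (w \<Omega>) * norm (z \<Omega>))) (\<lambda>x. cinner (w \<Omega>) (\<phi> x (z \<Omega>)))"
proof -
  have M': "von_neumann_algebra (commutant M)" by (rule von_neumann_commutant[OF vN])
  have Mb0: "M \<subseteq> bounded_ops" by (rule von_neumann_bounded(1)[OF vN])
  have \<phi>b: "\<phi> x \<in> bounded_ops" if "x \<in> M" for x using that ucp_closed[OF \<phi>] Mb by blast
  have balanced: "nuclear M (4 * (r * r)) (\<lambda>x. cinner (w \<Omega>) (\<phi> x (z \<Omega>)))"
    if z: "z \<in> commutant M" and w: "w \<in> commutant M" and r: "norm (w \<Omega>) = r" "norm (z \<Omega>) = r" for z w r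
  proof -
    \<comment> \<open>Four diagonal terms at \<open>w + d i z\<close> with weights
      \<open>c i / 4\<close>: only the sum of the products \<open>c i * d i\<close> survives, and it
      is 4. Each term has mass at most \<open>(2 * r)\<^sup>2 / 4\<close>, which gives the factor 4
      in the bound.\<close>
    define c where "c i = [1, -1, -\<i>, \<i>] ! i" for i :: nat
    define d where "d i = [1, -1, \<i>, -\<i>] ! i" for i :: nat
    define v where "v i = (\<lambda>\<xi>. 1 *\<^sub>C w \<xi> + d i *\<^sub>C z \<xi>)" for i
    have v: "v i \<in> commutant M" for i
      unfolding v_def by (rule von_neumann_lincomb[OF M' w z])
    have cd: "cmod (c i) = 1" "cmod (d i) = 1" if "i < 4" for i
      using that by (auto simp: c_def d_def less_Suc_eq numeral_eq_Suc)
    have nv: "norm (v i \<Omega>) \<le> 2 * r" if "i < 4" for i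
      using norm_triangle_ineq[of "w \<Omega>" "d i *\<^sub>C z \<Omega>"] cd[OF that] r by (simp add: v_def norm_scaleC)
    have "nuclear M (real 4 * (r * r)) (\<lambda>x. cinner (w \<Omega>) (\<phi> x (z \<Omega>)))"
    proof (rule nuclear_finite_sum[OF Mb0])
      fix i :: nat assume i: "i < 4"
      have "nuclear M (cmod (c i / 4) * (norm (v i \<Omega>))\<^sup>2) (\<lambda>x. c i / 4 * cinner (v i \<Omega>) (\<phi> x (v i \<Omega>)))"
        by (intro nuclear_scale nuclear_diagonal v)
      moreover have "cmod (c i / 4) * (norm (v i \<Omega>))\<^sup>2 \<le> r * r"
        using power_mono[OF nv[OF i], of 2] cd[OF i] by (simp add: norm_divide power2_eq_square)
      ultimately show "nuclear M (r * r) (\<lambda>x. c i / 4 * cinner (v i \<Omega>) (\<phi> x (v i \<Omega>)))"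
        by (rule nuclear_mono)
    next
      fix x assume x: "x \<in> M"
      have "4 * cinner (w \<Omega>) (\<phi> x (z \<Omega>)) = (\<Sum>i<4. c i * cinner (v i \<Omega>) (\<phi> x (v i \<Omega>)))"
        by (simp add: numeral_eq_Suc c_def d_def v_def bounded_opsD[OF \<phi>b[OF x]] cinner_add_left
            cinner_add_right cinner_scaleC_left cinner_scaleC_right algebra_simps)
      then show "cinner (w \<Omega>) (\<phi> x (z \<Omega>)) = (\<Sum>i<4. c i / 4 * cinner (v i \<Omega>) (\<phi> x (v i \<Omega>)))"
        by (simp add: sum_divide_distrib[symmetric] field_simps)
    qed
    then show ?thesis by simp
  qed
  show ?thesis
  proof (cases "w \<Omega> = 0 \<or> z \<Omega> = 0")
    case True
    have "nuclear M (real 0 * 0) (\<lambda>x. cinner (w \<Omega>) (\<phi> x (z \<Omega>)))"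
      by (rule nuclear_finite_sum[OF Mb0, where f="\<lambda>_ _. 0"]) (use True bounded_opsD(5)[OF \<phi>b] in auto)
    then show ?thesis using True by auto
  next
    case False
    \<comment> \<open>Multiplying \<open>w\<close> by \<open>q\<close> and \<open>z\<close> by its
      inverse equalises the norms and leaves the functional unchanged.\<close>
    define q where "q = sqrt (norm (z \<Omega>) / norm (w \<Omega>))"
    have q: "q > 0" "q * q = norm (z \<Omega>) / norm (w \<Omega>)" using False by (auto simp: q_def)
    have eq: "norm (q *\<^sub>R w \<Omega>) = q * norm (w \<Omega>)" "norm ((1 / q) *\<^sub>R z \<Omega>) = q * norm (w \<Omega>)"
      using q False by (auto simp: field_simps)
    have qq: "(q * norm (w \<Omega>)) * (q * norm (w \<Omega>)) = norm (w \<Omega>) * norm (z \<Omega>)"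
    proof -
      have "(q * norm (w \<Omega>)) * (q * norm (w \<Omega>)) = (q * q) * (norm (w \<Omega>) * norm (w \<Omega>))" by (simp add: mult_ac)
      then show ?thesis using False by (simp add: q)
    qed
    have bal: "nuclear M (4 * ((q * norm (w \<Omega>)) * (q * norm (w \<Omega>)))) (\<lambda>x. cinner (q *\<^sub>R w \<Omega>) (\<phi> x ((1 / q) *\<^sub>R z \<Omega>)))"
      by (rule balanced[OF von_neumann_scaleR[OF M' z] von_neumann_scaleR[OF M' w] eq])
    show ?thesis
    proof (rule nuclear_cong[OF bal[unfolded qq]])
      show "cinner (q *\<^sub>R w \<Omega>) (\<phi> x ((1 / q) *\<^sub>R z \<Omega>)) = cinner (w \<Omega>) (\<phi> x (z \<Omega>))" if "x \<in> M" for x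
        using q by (simp add: bounded_opsD[OF \<phi>b[OF that]] cinner_scaleR_left cinner_scaleR_right)
    qed
  qed
qed

text \<open>Differences of successive approximations with errors \<open>norm \<xi> / 2 ^ l\<close>
  have norms at most \<open>2 * norm \<xi> / 2 ^ i\<close>, whence the factor 4.\<close>

lemma dense_series:
  fixes \<xi> :: "'h"
  obtains a p where "\<And>i::nat. a i \<in> commutant M" "((\<lambda>i. a i \<Omega>) has_sum \<xi>) UNIV"
    "((\<lambda>i. norm (a i \<Omega>)) has_sum p) UNIV" "p \<le> 4 * norm \<xi>"
proof -
  have M': "von_neumann_algebra (commutant M)" by (rule von_neumann_commutant[OF vN])
  \<comment> \<open>The vector of the zeroth approximation is required to vanish so that the
    telescoping series starts from 0.\<close>
  have "\<exists>b\<in>commutant M. norm (\<xi> - b \<Omega>) \<le> norm \<xi> * (1 / 2) ^ l \<and> (l = 0 \<longrightarrow> b \<Omega> = 0)" for l :: nat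
  proof (cases "l = 0 \<or> \<xi> = 0")
    case True
    then show ?thesis by (intro bexI[OF _ von_neumann_zero[OF M']]) auto
  next
    case False
    have "\<xi> \<in> closure ((\<lambda>x. x \<Omega>) ` commutant M)" using cyclic_commutant by simp
    then have "\<exists>y\<in>(\<lambda>x. x \<Omega>) ` commutant M. dist y \<xi> < norm \<xi> * (1 / 2) ^ l"
      unfolding closure_approachable using False by (auto dest: spec[of _ "norm \<xi> * (1 / 2) ^ l"])
    then show ?thesis using False by (force simp: dist_norm norm_minus_commute)
  qed
  then obtain b where b: "\<And>l. b l \<in> commutant M" "\<And>l. norm (\<xi> - b l \<Omega>) \<le> norm \<xi> * (1 / 2) ^ l"
      "b 0 \<Omega> = 0"
    by metis
  define a where "a i = (\<lambda>\<zeta>. b (Suc i) \<zeta> - b i \<zeta>)" for i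
  have aM: "a i \<in> commutant M" for i unfolding a_def by (intro von_neumann_diff[OF M'] b)
  have an: "norm (a i \<Omega>) \<le> 2 * norm \<xi> * (1 / 2) ^ i" for i
  proof -
    have "norm (a i \<Omega>) \<le> norm (\<xi> - b i \<Omega>) + norm (\<xi> - b (Suc i) \<Omega>)"
      using norm_triangle_ineq4[of "\<xi> - b i \<Omega>" "\<xi> - b (Suc i) \<Omega>"] by (simp add: a_def)
    also have "\<dots> \<le> norm \<xi> * (1 / 2) ^ i + norm \<xi> * (1 / 2) ^ Suc i" by (intro add_mono b)
    also have "\<dots> \<le> 2 * norm \<xi> * (1 / 2) ^ i" by simp
    finally show ?thesis .
  qed
  have geo: "(\<lambda>i. 2 * norm \<xi> * (1 / 2) ^ i) sums (2 * norm \<xi> * 2)"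
    using sums_mult[OF geometric_sums[of "1 / 2 :: real"], of "2 * norm \<xi>"] by simp
  then have summ: "summable (\<lambda>i. norm (a i \<Omega>))"
    by (intro summable_comparison_test[OF _ sums_summable[OF geo]]) (use an in auto)
  have "(\<lambda>n. \<xi> - b n \<Omega>) \<longlonglongrightarrow> 0"
  proof (rule Lim_null_comparison)
    show "\<forall>\<^sub>F n in sequentially. norm (\<xi> - b n \<Omega>) \<le> norm \<xi> * (1 / 2) ^ n" using b by simp
    show "(\<lambda>n. norm \<xi> * (1 / 2) ^ n) \<longlonglongrightarrow> 0"
      by (intro tendsto_mult_right_zero LIMSEQ_power_zero) simp
  qed
  from tendsto_diff[OF tendsto_const[of \<xi>] this] have "(\<lambda>n. b n \<Omega>) \<longlonglongrightarrow> \<xi>" by simp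
  moreover have "(\<Sum>i<n. a i \<Omega>) = b n \<Omega>" for n by (induction n) (auto simp: a_def b)
  ultimately have "(\<lambda>i. a i \<Omega>) sums \<xi>" by (simp add: sums_def)
  then have "((\<lambda>i. a i \<Omega>) has_sum \<xi>) UNIV" by (rule norm_summable_imp_has_sum[OF summ])
  moreover have "((\<lambda>i. norm (a i \<Omega>)) has_sum (\<Sum>i. norm (a i \<Omega>))) UNIV"
    by (rule sums_nonneg_imp_has_sum[OF summable_sums[OF summ]]) simp
  moreover have "(\<Sum>i. norm (a i \<Omega>)) \<le> 4 * norm \<xi>"
    using sums_le[OF an summable_sums[OF summ] geo] by simp
  ultimately show ?thesis by (rule that[OF aM])
qed

text \<open>Both vectors are expanded by \<open>dense_series\<close>, first the left and then the
  right one. Each expansion costs a factor 4, in addition to the 4 of the polarisation.\<close>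

lemma nuclear_vectors: "nuclear M (64 * (norm \<xi> * norm \<eta>)) (\<lambda>x. cinner \<xi> (\<phi> x \<eta>))"
proof -
  have Mb0: "M \<subseteq> bounded_ops" by (rule von_neumann_bounded(1)[OF vN])
  have \<phi>b: "bounded_linear (\<phi> x)" if "x \<in> M" for x using that ucp_closed[OF \<phi>] Mb bounded_opsD(1) by blast
  have left: "nuclear M (16 * (norm \<xi> * norm (z \<Omega>))) (\<lambda>x. cinner \<xi> (\<phi> x (z \<Omega>)))"
    if z: "z \<in> commutant M" for z
  proof -
    obtain a p where a: "\<And>i::nat. a i \<in> commutant M" "((\<lambda>i. a i \<Omega>) has_sum \<xi>) UNIV"
      "((\<lambda>i. norm (a i \<Omega>)) has_sum p) UNIV" "p \<le> 4 * norm \<xi>"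
      by (rule dense_series[of \<xi>]) (rule that)
    have "nuclear M (4 * norm (z \<Omega>) * p) (\<lambda>x. cinner \<xi> (\<phi> x (z \<Omega>)))"
    proof (rule nuclear_countable_sum[OF Mb0])
      show "nuclear M (4 * (norm (a i \<Omega>) * norm (z \<Omega>))) (\<lambda>x. cinner (a i \<Omega>) (\<phi> x (z \<Omega>)))" for i
        by (rule nuclear_commutant_vectors[OF z a(1)])
      show "((\<lambda>i. 4 * (norm (a i \<Omega>) * norm (z \<Omega>))) has_sum 4 * norm (z \<Omega>) * p) UNIV"
        using has_sum_cmult_right[OF a(3), of "4 * norm (z \<Omega>)"] by (simp add: mult_ac)
    qed (rule has_sum_bounded_linear[OF cinner.bounded_linear_left a(2)])
    moreover have "4 * norm (z \<Omega>) * p \<le> 4 * norm (z \<Omega>) * (4 * norm \<xi>)"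
      by (intro mult_left_mono a) auto
    ultimately show ?thesis by (auto intro: nuclear_mono simp: mult_ac)
  qed
  obtain a p where a: "\<And>i::nat. a i \<in> commutant M" "((\<lambda>i. a i \<Omega>) has_sum \<eta>) UNIV"
    "((\<lambda>i. norm (a i \<Omega>)) has_sum p) UNIV" "p \<le> 4 * norm \<eta>"
    by (rule dense_series[of \<eta>]) (rule that)
  have "nuclear M (16 * norm \<xi> * p) (\<lambda>x. cinner \<xi> (\<phi> x \<eta>))"
  proof (rule nuclear_countable_sum[OF Mb0])
    show "nuclear M (16 * (norm \<xi> * norm (a i \<Omega>))) (\<lambda>x. cinner \<xi> (\<phi> x (a i \<Omega>)))" for i
      by (rule left[OF a(1)])
    show "((\<lambda>i. 16 * (norm \<xi> * norm (a i \<Omega>))) has_sum 16 * norm \<xi> * p) UNIV"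
      using has_sum_cmult_right[OF a(3), of "16 * norm \<xi>"] by (simp add: mult_ac)
    show "((\<lambda>i. cinner \<xi> (\<phi> x (a i \<Omega>))) has_sum cinner \<xi> (\<phi> x \<eta>)) UNIV" if "x \<in> M" for x
      by (rule has_sum_bounded_linear[OF bounded_linear_compose[OF cinner.bounded_linear_right \<phi>b[OF that]] a(2)])
  qed
  moreover have "16 * norm \<xi> * p \<le> 16 * norm \<xi> * (4 * norm \<eta>)"
    by (intro mult_left_mono a) auto
  ultimately show ?thesis by (auto intro: nuclear_mono simp: mult_ac)
qed

text \<open>Continuity is checked on the functionals that generate the ultraweak topology. Their
  terms composed with \<open>\<phi>\<close> are nuclear with summable bounds
  \<open>64 * (norm (\<xi> n) * norm (\<eta> n))\<close>, so the whole series is nuclear.\<close>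

lemma normal: "normal_map M \<phi>"
  unfolding normal_map_def
  unfolding ultraweak_topology_def[of M]
proof (rule continuous_map_into_coarsest)
  show "\<phi> ` topspace (coarsest_topology M (square_summable \<times> square_summable)
       (\<lambda>(\<xi>, \<eta>) x. \<Sum>n. cinner (\<xi> n) (x (\<eta> n))) (\<lambda>_. euclidean)) \<subseteq> M"
    using ucp_closed[OF \<phi>] by auto
next
  fix j :: "(nat \<Rightarrow> 'h) \<times> (nat \<Rightarrow> 'h)" assume "j \<in> square_summable \<times> square_summable"
  then obtain \<xi> \<eta> where j: "j = (\<xi>, \<eta>)" and s: "summable (\<lambda>n. (norm (\<xi> n))\<^sup>2)" "summable (\<lambda>n. (norm (\<eta> n))\<^sup>2)"
    by (auto simp: square_summable_def)
  have summ: "summable (\<lambda>n. norm (\<xi> n) * norm (\<eta> n))"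
    by (rule square_summable_product[OF s])
  have hs: "((\<lambda>n. 64 * (norm (\<xi> n) * norm (\<eta> n))) has_sum (\<Sum>n. 64 * (norm (\<xi> n) * norm (\<eta> n)))) UNIV"
    by (intro sums_nonneg_imp_has_sum summable_sums summable_mult summ) auto
  have Mb0: "M \<subseteq> bounded_ops" by (rule von_neumann_bounded(1)[OF vN])
  have "nuclear M (\<Sum>n. 64 * (norm (\<xi> n) * norm (\<eta> n))) (\<lambda>x. \<Sum>n. cinner (\<xi> n) (\<phi> x (\<eta> n)))"
  proof (rule nuclear_countable_sum[OF Mb0 nuclear_vectors hs])
    fix x assume "x \<in> M"
    then have b: "\<phi> x \<in> bounded_ops" using ucp_closed[OF \<phi>] Mb by blast
    have "summable (\<lambda>n. norm (cinner (\<xi> n) (\<phi> x (\<eta> n))))"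
    proof (rule summable_comparison_test[OF _ summable_mult[OF summ]])
      show "\<exists>N. \<forall>n\<ge>N. norm (norm (cinner (\<xi> n) (\<phi> x (\<eta> n)))) \<le> onorm (\<phi> x) * (norm (\<xi> n) * norm (\<eta> n))"
        using norm_cinner_op_le[OF b] by simp
    qed
    then show "((\<lambda>n. cinner (\<xi> n) (\<phi> x (\<eta> n))) has_sum (\<Sum>n. cinner (\<xi> n) (\<phi> x (\<eta> n)))) UNIV"
      by (intro norm_summable_imp_has_sum summable_sums) (auto dest: summable_norm_cancel)
  qed
  then show "continuous_map (coarsest_topology M (square_summable \<times> square_summable)
       (\<lambda>(\<xi>, \<eta>) x. \<Sum>n. cinner (\<xi> n) (x (\<eta> n))) (\<lambda>_. euclidean)) euclidean
      ((case j of (\<xi>, \<eta>) \<Rightarrow> \<lambda>x. \<Sum>n. cinner (\<xi> n) (x (\<eta> n))) \<circ> \<phi>)"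
    using nuclear_continuous[OF Mb0] by (simp add: j o_def ultraweak_topology_def)
qed

end

section \<open>Moebius transformations of the circle\<close>

text \<open>The \<open>SU(1,1)\<close> form of a Moebius transformation. When
  \<open>(cmod \<alpha>)\<^sup>2 - (cmod \<beta>)\<^sup>2 = 1\<close>, the inverse has the same form
  with parameters \<open>cnj \<alpha>\<close> and \<open>- \<beta>\<close>.\<close>

definition circle_map :: "complex \<Rightarrow> complex \<Rightarrow> complex \<Rightarrow> complex" where
  "circle_map \<alpha> \<beta> z = (if z \<in> S1 then (\<alpha> * z + \<beta>) / (cnj \<beta> * z + cnj \<alpha>) else z)"

lemma mobius_eq_circle_map:
  assumes "A \<in> SL2"
  obtains \<alpha> \<beta> where "(cmod \<alpha>)\<^sup>2 - (cmod \<beta>)\<^sup>2 = 1" "mobius A = circle_map \<alpha> \<beta>"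
proof (rule that)
  let ?\<alpha> = "Complex ((A$1$1 + A$2$2) / 2) ((A$1$2 - A$2$1) / 2)"
  let ?\<beta> = "Complex ((A$1$1 - A$2$2) / 2) (- (A$1$2 + A$2$1) / 2)"
  show "mobius A = circle_map ?\<alpha> ?\<beta>"
    by (rule ext) (simp add: mobius_def circle_map_def Let_def)
  have "A$1$1 * A$2$2 - A$1$2 * A$2$1 = 1" using assms by (simp add: SL2_def det_2)
  then show "(cmod ?\<alpha>)\<^sup>2 - (cmod ?\<beta>)\<^sup>2 = 1"
    unfolding cmod_power2 by (simp add: power2_eq_square field_simps)
qed

context
  fixes \<alpha> \<beta> :: complex
  assumes N: "(cmod \<alpha>)\<^sup>2 - (cmod \<beta>)\<^sup>2 = 1"
begin

lemma circle_map_denominator: "z \<in> S1 \<Longrightarrow> cnj \<beta> * z + cnj \<alpha> \<noteq> 0"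
proof
  assume "z \<in> S1" "cnj \<beta> * z + cnj \<alpha> = 0"
  then have "cmod \<alpha> = cmod \<beta>"
    by (metis add_eq_0_iff2 complex_mod_cnj dist_0_norm mem_sphere mult.right_neutral norm_minus_cancel norm_mult)
  then show False using N by simp
qed

text \<open>On the circle \<open>z * cnj z = 1\<close>. The identity shows that numerator and
  denominator have the same modulus, so the circle is preserved.\<close>

lemma circle_map_numerator:
  assumes "z \<in> S1" shows "\<alpha> * z + \<beta> = z * cnj (cnj \<beta> * z + cnj \<alpha>)"
proof -
  have "z * cnj z = 1" using assms by (simp flip: complex_norm_square)
  then show ?thesis by (simp add: algebra_simps)
qed

lemma circle_map_in: "z \<in> S1 \<Longrightarrow> circle_map \<alpha> \<beta> z \<in> S1"
  using circle_map_denominator[of z]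
  by (simp add: circle_map_def circle_map_numerator norm_divide norm_mult del: complex_cnj_add)

lemma circle_map_inverse: "circle_map (cnj \<alpha>) (- \<beta>) (circle_map \<alpha> \<beta> z) = z"
proof (cases "z \<in> S1")
  case True
  let ?d = "cnj \<beta> * z + cnj \<alpha>"
  have d: "?d \<noteq> 0" by (rule circle_map_denominator[OF True])
  have n: "\<alpha> * cnj \<alpha> - \<beta> * cnj \<beta> = 1"
    using N by (metis complex_norm_square of_real_1 of_real_diff)
  have 1: "cnj \<alpha> * (\<alpha> * z + \<beta>) - \<beta> * ?d = (\<alpha> * cnj \<alpha> - \<beta> * cnj \<beta>) * z"
    by (simp add: algebra_simps)
  have 2: "\<alpha> * ?d - cnj \<beta> * (\<alpha> * z + \<beta>) = \<alpha> * cnj \<alpha> - \<beta> * cnj \<beta>"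
    by (simp add: algebra_simps)
  have w: "circle_map \<alpha> \<beta> z = (\<alpha> * z + \<beta>) / ?d" using True by (simp add: circle_map_def)
  have "circle_map (cnj \<alpha>) (- \<beta>) (circle_map \<alpha> \<beta> z) =
      (cnj \<alpha> * ((\<alpha> * z + \<beta>) / ?d) - \<beta>) / (\<alpha> - cnj \<beta> * ((\<alpha> * z + \<beta>) / ?d))"
    using circle_map_in[OF True] unfolding w by (simp add: circle_map_def)
  also have "cnj \<alpha> * ((\<alpha> * z + \<beta>) / ?d) - \<beta> = z / ?d"
    using 1 d by (simp add: n field_simps)
  also have "\<alpha> - cnj \<beta> * ((\<alpha> * z + \<beta>) / ?d) = 1 / ?d"
    using 2 d by (simp add: n field_simps)
  finally show ?thesis using d by simp
qed (simp add: circle_map_def)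

end

lemma circle_map_inv:
  assumes N: "(cmod \<alpha>)\<^sup>2 - (cmod \<beta>)\<^sup>2 = 1"
  shows "inv (circle_map \<alpha> \<beta>) = circle_map (cnj \<alpha>) (- \<beta>)" "bij (circle_map \<alpha> \<beta>)"
    "circle_map \<alpha> \<beta> (circle_map (cnj \<alpha>) (- \<beta>) z) = z"
proof -
  have N': "(cmod (cnj \<alpha>))\<^sup>2 - (cmod (- \<beta>))\<^sup>2 = 1" using N by simp
  show 1: "circle_map \<alpha> \<beta> (circle_map (cnj \<alpha>) (- \<beta>) z) = z" for z
    using circle_map_inverse[OF N'] by simp
  show "inv (circle_map \<alpha> \<beta>) = circle_map (cnj \<alpha>) (- \<beta>)"
    by (rule inv_unique_comp) (auto simp: fun_eq_iff 1 circle_map_inverse[OF N])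
  show "bij (circle_map \<alpha> \<beta>)"
    by (rule o_bij[of "circle_map (cnj \<alpha>) (- \<beta>)"]) (auto simp: fun_eq_iff 1 circle_map_inverse[OF N])
qed

lemma circle_map_continuous:
  assumes N: "(cmod \<alpha>)\<^sup>2 - (cmod \<beta>)\<^sup>2 = 1"
  shows "continuous_on S1 (circle_map \<alpha> \<beta>)"
proof -
  have "continuous_on S1 (\<lambda>z. (\<alpha> * z + \<beta>) / (cnj \<beta> * z + cnj \<alpha>))"
    using circle_map_denominator[OF N] by (intro continuous_intros) auto
  then show ?thesis
    by (rule continuous_on_eq) (simp add: circle_map_def)
qed

lemma circle_map_homeomorphism:
  assumes N: "(cmod \<alpha>)\<^sup>2 - (cmod \<beta>)\<^sup>2 = 1"
  shows "homeomorphism S1 S1 (circle_map \<alpha> \<beta>) (circle_map (cnj \<alpha>) (- \<beta>))"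
proof -
  have N': "(cmod (cnj \<alpha>))\<^sup>2 - (cmod (- \<beta>))\<^sup>2 = 1" using N by simp
  have im: "circle_map \<alpha> \<beta> ` S1 = S1"
  proof
    show "circle_map \<alpha> \<beta> ` S1 \<subseteq> S1" using circle_map_in[OF N] by blast
    show "S1 \<subseteq> circle_map \<alpha> \<beta> ` S1"
      using circle_map_in[OF N'] circle_map_inv(3)[OF N] by (metis image_eqI subsetI)
  qed
  have im': "circle_map (cnj \<alpha>) (- \<beta>) ` S1 = S1"
  proof
    show "circle_map (cnj \<alpha>) (- \<beta>) ` S1 \<subseteq> S1" using circle_map_in[OF N'] by blast
    show "S1 \<subseteq> circle_map (cnj \<alpha>) (- \<beta>) ` S1"
      using circle_map_in[OF N] circle_map_inverse[OF N] by (metis image_eqI subsetI)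
  qed
  show ?thesis
    unfolding homeomorphism_def
    using im im' circle_map_inverse[OF N] circle_map_inv(3)[OF N] circle_map_continuous[OF N]
      circle_map_continuous[OF N'] by auto
qed

text \<open>Differentiation with respect to the angle becomes the operator \<open>L\<close>, which
  takes \<open>H\<close> to \<open>\<i> * w * deriv H w\<close> and preserves holomorphic functions
  on \<open>D\<close>. Hence all iterated derivatives exist.\<close>

lemma smooth_comp_cis:
  assumes D: "open D" "S1 \<subseteq> D" and H: "H holomorphic_on D"
  shows "smooth (H \<circ> cis)"
proof -
  define L where "L H = (\<lambda>w. \<i> * w * deriv H w)" for H :: "complex \<Rightarrow> complex"
  have L: "L G holomorphic_on D" if "G holomorphic_on D" for G
    unfolding L_def using that D by (intro holomorphic_intros)
  have der: "((G \<circ> cis) has_vector_derivative L G (cis t)) (at t)" if "G holomorphic_on D" for G t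
  proof -
    have "(cis has_vector_derivative \<i> * cis t) (at t)"
      unfolding has_vector_derivative_def by (auto intro!: derivative_eq_intros)
    moreover have "(G has_field_derivative deriv G (cis t)) (at (cis t))"
    proof (rule holomorphic_derivI[OF that D(1)])
      have "cis t \<in> S1" by simp
      then show "cis t \<in> D" using D(2) by (rule rev_subsetD)
    qed
    ultimately show ?thesis
      unfolding L_def by (rule field_vector_diff_chain_at)
  qed
  have "((\<lambda>g s. vector_derivative g (at s)) ^^ k) (H \<circ> cis) = (L ^^ k) H \<circ> cis
      \<and> (L ^^ k) H holomorphic_on D" for k
  proof (induction k)
    case (Suc k)
    have "(\<lambda>s. vector_derivative ((L ^^ k) H \<circ> cis) (at s)) = L ((L ^^ k) H) \<circ> cis"
      using der Suc vector_derivative_at by fastforce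
    then show ?case using Suc L by (simp add: o_def)
  qed (simp add: H)
  then show ?thesis
    unfolding smooth_def using der by (metis differentiableI_vector)
qed

lemma circle_map_smooth:
  assumes N: "(cmod \<alpha>)\<^sup>2 - (cmod \<beta>)\<^sup>2 = 1"
  shows "smooth (circle_map \<alpha> \<beta> \<circ> cis)"
    and "Im (cnj (circle_map \<alpha> \<beta> (cis t)) * vector_derivative (circle_map \<alpha> \<beta> \<circ> cis) (at t)) > 0"
proof -
  define H where "H w = (\<alpha> * w + \<beta>) / (cnj \<beta> * w + cnj \<alpha>)" for w
  define D where "D = {w. cnj \<beta> * w + cnj \<alpha> \<noteq> 0}"
  have oD: "open D" unfolding D_def by (intro open_Collect_neq continuous_intros)
  have sD: "S1 \<subseteq> D" using circle_map_denominator[OF N] by (auto simp: D_def)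
  have H: "H holomorphic_on D" unfolding H_def D_def by (intro holomorphic_intros) auto
  have eq: "circle_map \<alpha> \<beta> \<circ> cis = H \<circ> cis" by (auto simp: circle_map_def H_def)
  show "smooth (circle_map \<alpha> \<beta> \<circ> cis)" unfolding eq by (rule smooth_comp_cis[OF oD sD H])
  define w where "w = cis t"
  define d where "d = cnj \<beta> * w + cnj \<alpha>"
  have w: "w \<in> S1" "w * cnj w = 1" by (auto simp: w_def simp flip: complex_norm_square)
  have d: "d \<noteq> 0" unfolding d_def by (rule circle_map_denominator[OF N w(1)])
  have n: "\<alpha> * cnj \<alpha> - \<beta> * cnj \<beta> = 1"
    using N by (metis complex_norm_square of_real_1 of_real_diff)
  \<comment> \<open>The normalisation of the parameters makes the numerator of the derivative 1. The
    angular speed is then the reciprocal of \<open>(cmod d)\<^sup>2\<close>, which is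
    positive.\<close>
  have dH: "(H has_field_derivative 1 / d\<^sup>2) (at w)"
  proof -
    have "(H has_field_derivative (\<alpha> * d - (\<alpha> * w + \<beta>) * cnj \<beta>) / (d * d)) (at w)"
      unfolding H_def d_def using d[unfolded d_def] by (auto intro!: derivative_eq_intros)
    moreover have "\<alpha> * d - (\<alpha> * w + \<beta>) * cnj \<beta> = 1"
      using n by (simp add: d_def algebra_simps)
    ultimately show ?thesis by (simp add: power2_eq_square)
  qed
  have "(cis has_vector_derivative \<i> * w) (at t)"
    unfolding has_vector_derivative_def w_def by (auto intro!: derivative_eq_intros)
  then have "((H \<circ> cis) has_vector_derivative \<i> * w * (1 / d\<^sup>2)) (at t)"
    by (rule field_vector_diff_chain_at) (rule dH[unfolded w_def])
  then have vd: "vector_derivative (circle_map \<alpha> \<beta> \<circ> cis) (at t) = \<i> * w / d\<^sup>2"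
    unfolding eq by (simp add: vector_derivative_at)
  have "cnj (circle_map \<alpha> \<beta> w) = cnj (w * cnj d) / cnj d"
    using w(1) circle_map_numerator[OF N w(1)] by (simp add: circle_map_def d_def)
  then have "cnj (circle_map \<alpha> \<beta> w) * (\<i> * w / d\<^sup>2) = \<i> * (w * cnj w) / (d * cnj d)"
    using d by (simp add: power2_eq_square field_simps)
  also have "\<dots> = \<i> / of_real ((cmod d)\<^sup>2)" by (simp only: w mult_1_right complex_norm_square)
  also have "Im \<dots> > 0" using d by (simp add: Im_divide_of_real)
  finally show "Im (cnj (circle_map \<alpha> \<beta> (cis t)) * vector_derivative (circle_map \<alpha> \<beta> \<circ> cis) (at t)) > 0"
    unfolding vd by (simp add: w_def)
qed

lemma PSL2_circle_map:
  assumes "g \<in> PSL2"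
  obtains \<alpha> \<beta> where "(cmod \<alpha>)\<^sup>2 - (cmod \<beta>)\<^sup>2 = 1" "g = circle_map \<alpha> \<beta>"
  using assms mobius_eq_circle_map unfolding PSL2_def by blast

text \<open>Makes unitarity and covariance, which are axioms about \<open>Diff\<close>, available
  for Moebius transformations.\<close>

lemma PSL2_subset_Diff: "PSL2 \<subseteq> Diff"
proof
  fix g assume "g \<in> PSL2"
  then obtain \<alpha> \<beta> where N: "(cmod \<alpha>)\<^sup>2 - (cmod \<beta>)\<^sup>2 = 1" and g: "g = circle_map \<alpha> \<beta>"
    by (rule PSL2_circle_map)
  have N': "(cmod (cnj \<alpha>))\<^sup>2 - (cmod (- \<beta>))\<^sup>2 = 1" using N by simp
  have "bij_betw g S1 S1"
    using circle_map_homeomorphism[OF N] unfolding g homeomorphism_def bij_betw_def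
    by (auto intro: inj_on_inverseI)
  moreover have "g z = z" if "z \<notin> S1" for z using that unfolding g circle_map_def by argo
  ultimately show "g \<in> Diff"
    using circle_map_smooth[OF N] circle_map_smooth(1)[OF N'] circle_map_inv(1)[OF N]
    unfolding Diff_def by (auto simp: g)
qed

lemma PSL2_image_S1: "g \<in> PSL2 \<Longrightarrow> g ` S1 = S1"
  using PSL2_subset_Diff unfolding Diff_def bij_betw_def by blast

lemma PSL2_image_arcs:
  assumes "g \<in> PSL2" "I \<in> arcs" shows "g ` I \<in> arcs"
proof -
  obtain \<alpha> \<beta> where N: "(cmod \<alpha>)\<^sup>2 - (cmod \<beta>)\<^sup>2 = 1" and g: "g = circle_map \<alpha> \<beta>"
    using assms(1) by (rule PSL2_circle_map)
  have hom: "homeomorphism S1 S1 g (circle_map (cnj \<alpha>) (- \<beta>))"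
    unfolding g by (rule circle_map_homeomorphism[OF N])
  have I: "openin (top_of_set S1) I" "connected I" "I \<noteq> {}" "closure I \<noteq> S1"
    using assms(2) by (auto simp: arcs_def)
  have IS: "I \<subseteq> S1" using I(1) openin_imp_subset by blast
  have cS: "closure I \<subseteq> S1" by (rule closure_minimal[OF IS closed_sphere])
  have cont: "continuous_on S1 g" and inj: "inj g" and im: "g ` S1 = S1"
    using circle_map_continuous[OF N] circle_map_inv(2)[OF N] hom
    by (auto simp: g bij_def homeomorphism_def)
  have "closure (g ` I) \<subseteq> g ` closure I"
  proof (rule closure_minimal)
    show "g ` I \<subseteq> g ` closure I" using closure_subset by blast
    have "compact (closure I)" using cS by (metis bounded_sphere bounded_subset closed_closure compact_eq_bounded_closed)
    then have "compact (g ` closure I)"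
      by (rule compact_continuous_image[OF continuous_on_subset[OF cont cS]])
    then show "closed (g ` closure I)" by (rule compact_imp_closed)
  qed
  moreover have "g ` closure I \<subset> S1" 
    using image_mono[OF cS, of g] inj_image_eq_iff[OF inj, of "closure I" S1] im I(4) by blast
  ultimately have "closure (g ` I) \<noteq> S1" by blast
  moreover have "openin (top_of_set S1) (g ` I)" by (rule homeomorphism_imp_open_map[OF hom I(1)])
  moreover have "connected (g ` I)"
    by (rule connected_continuous_image[OF continuous_on_subset[OF cont IS] I(2)])
  ultimately show ?thesis using I(3) by (simp add: arcs_def)
qed

lemma rotation_PSL2: "rotation t \<in> PSL2"
  unfolding PSL2_def rotation_eq_mobius
  by (intro imageI) (simp add: SL2_def det_2 flip: power2_eq_square)

lemma rotation_comp: "rotation s \<circ> rotation t = rotation (s + t)"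
  by (auto simp: rotation_def fun_eq_iff norm_mult cis_mult mult.assoc[symmetric])

lemma rotation_add_2pi: "rotation (t + 2 * pi) = rotation t"
  by (auto simp: rotation_def fun_eq_iff cis_mult[symmetric])

section \<open>Contraction of the half circle to small arcs\<close>

definition half_circle :: "complex set" where
  "half_circle = {z \<in> S1. Re z > 0}"

lemma half_circle_arc: "half_circle \<in> arcs"
proof -
  have o: "open {z. Re z > 0}" by (rule open_halfspace_Re_gt)
  have eq: "half_circle = S1 \<inter> {z. Re z > 0}" by (auto simp: half_circle_def)
  have img: "half_circle = cis ` {- (pi/2)<..<pi/2}"
  proof
    show "cis ` {- (pi/2)<..<pi/2} \<subseteq> half_circle"
      by (auto simp: half_circle_def intro!: cos_gt_zero_pi)
    show "half_circle \<subseteq> cis ` {- (pi/2)<..<pi/2}"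
    proof
      fix z assume z: "z \<in> half_circle"
      then have "z \<noteq> 0" by (auto simp: half_circle_def)
      then have "z = cis (Arg z)" using cis_Arg[of z] z by (auto simp: half_circle_def sgn_eq)
      moreover have "\<bar>Arg z\<bar> < pi / 2"
        using z Arg_Re_pos[of z] unfolding half_circle_def by blast
      ultimately show "z \<in> cis ` {- (pi/2)<..<pi/2}" by (metis abs_less_iff greaterThanLessThan_iff image_eqI minus_less_iff)
    qed
  qed
  have "connected half_circle" unfolding img
    by (intro connected_continuous_image continuous_intros) (auto intro: convex_connected)
  moreover have "closure half_circle \<noteq> S1"
  proof -
    have "closure half_circle \<subseteq> {z. Re z \<ge> 0}"
      by (rule closure_minimal) (auto simp: half_circle_def closed_halfspace_Re_ge)
    then have "-1 \<notin> closure half_circle" by auto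
    moreover have "(-1::complex) \<in> S1" by simp
    ultimately show ?thesis by blast
  qed
  moreover have "half_circle \<noteq> {}" 
  proof -
    have "1 \<in> half_circle" by (simp add: half_circle_def)
    then show ?thesis by blast
  qed
  moreover have "openin (top_of_set S1) half_circle" unfolding eq by (rule openin_open_Int[OF o])
  ultimately show ?thesis by (simp add: arcs_def)
qed

text \<open>The diagonal matrix with entries \<open>r\<close> and \<open>1 / r\<close> acts as a
  hyperbolic transformation with attracting fixed point 1 and repelling fixed point -1. The region
  \<open>Re w \<ge> - 1/2\<close> of the circle stays away from the latter.\<close>

lemma dilation_concentrates:
  assumes e: "e > 0"
  obtains g where "g \<in> PSL2" "\<And>w. w \<in> S1 \<Longrightarrow> Re w \<ge> - 1/2 \<Longrightarrow> g w \<in> ball 1 e"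
proof -
  \<comment> \<open>The estimate below gives distance at most \<open>8 / (r * r)\<close>, hence at
    most \<open>8 / r\<close> as \<open>r \<ge> 1\<close>; the 9 makes the last inequality
    strict.\<close>
  define r where "r = max 1 (9 / e)"
  have r: "r \<ge> 1" "9 / e \<le> r" by (auto simp: r_def)
  define a b where "a = (r + 1 / r) / 2" and "b = (r - 1 / r) / 2"
  have b0: "b \<ge> 0" using r(1) by (simp add: b_def field_simps) (smt (verit) mult_less_cancel_left2)
  have ab: "a - b = 1 / r" by (simp add: a_def b_def field_simps)
  define A :: "real^2^2" where "A = vector [vector [r, 0], vector [0, 1 / r]]"
  have A: "A \<in> SL2" using r by (simp add: A_def SL2_def det_2)
  have gA: "mobius A w = (of_real a * w + of_real b) / (of_real b * w + of_real a)" if "w \<in> S1" for w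
  proof -
    have "Complex ((r + 1 / r) / 2) 0 = of_real a" "Complex ((r - 1 / r) / 2) 0 = of_real b"
      by (simp_all add: a_def b_def complex_eq_iff)
    then show ?thesis using that by (simp add: mobius_def A_def Let_def)
  qed
  show thesis
  proof (rule that)
    show "mobius A \<in> PSL2" using A by (simp add: PSL2_def)
    fix w :: complex assume w: "w \<in> S1" "Re w \<ge> - 1/2"
    let ?d = "of_real b * w + of_real a"
    have "r / 4 \<le> a - b / 2" using r by (simp add: a_def b_def field_simps)
    also have "\<dots> \<le> Re ?d" using w(2) b0 mult_left_mono[of "-1/2" "Re w" b] by simp
    also have "\<dots> \<le> cmod ?d" by (rule complex_Re_le_cmod)
    finally have d: "r / 4 \<le> cmod ?d" .
    then have d0: "?d \<noteq> 0" "cmod ?d > 0" using r by (auto simp del: zero_less_norm_iff) 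
    have "mobius A w - 1 = of_real (a - b) * (w - 1) / ?d"
      using d0 by (simp add: gA[OF w(1)] field_simps)
    then have "cmod (mobius A w - 1) = 1 / r * cmod (w - 1) / cmod ?d"
      unfolding ab using r by (simp add: norm_divide norm_mult)
    also have "\<dots> \<le> 1 / r * 2 / (r / 4)"
      using norm_triangle_ineq4[of w 1] w(1) r d d0
      by (intro frac_le mult_left_mono) auto
    also have "\<dots> = 8 / (r * r)" by simp
    also have "\<dots> \<le> 8 / r" using r by (intro divide_left_mono) auto
    also have "\<dots> < e" using r e by (simp add: field_simps)
    finally show "mobius A w \<in> ball 1 e" by (simp add: dist_norm norm_minus_commute)
  qed
qed

text \<open>A rotation by at most 1/2 moves points by at most 1/2, so the half circle stays in the
  region that \<open>h\<close> contracts to 1, and \<open>g\<close> rotates 1 to \<open>z\<close>.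
  Points not sent into the ball come from \<open>Re w < - 1/2\<close>, which lies in the half circle
  rotated by \<open>pi\<close>.\<close>

lemma concentrating_arcs:
  assumes z: "z \<in> S1" and e: "e > 0"
  obtains g h where "g \<in> PSL2" "h \<in> PSL2"
    "\<And>t. \<bar>t\<bar> \<le> 1/2 \<Longrightarrow> g ` h ` rotation t ` half_circle \<subseteq> ball z e"
    "S1 - ball z e \<subseteq> g ` h ` rotation pi ` half_circle"
proof -
  obtain h where h: "h \<in> PSL2" "\<And>w. w \<in> S1 \<Longrightarrow> Re w \<ge> - 1/2 \<Longrightarrow> h w \<in> ball 1 e"
    using dilation_concentrates[OF e] by blast
  have hS: "h ` S1 = S1" by (rule PSL2_image_S1[OF h(1)])
  define g where "g = rotation (Arg z)"
  have "z \<noteq> 0" using z by auto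
  then have zc: "cis (Arg z) = z" using z by (simp add: cis_Arg sgn_eq)
  have g: "g \<in> PSL2" "\<And>w. w \<in> S1 \<Longrightarrow> g w = z * w"
    by (simp_all add: g_def rotation_PSL2 rotation_def zc)
  have gb: "g w \<in> ball z e \<longleftrightarrow> w \<in> ball 1 e" if "w \<in> S1" for w
  proof -
    have "z - z * w = z * (1 - w)" by (simp add: algebra_simps)
    then show ?thesis using z by (simp add: g(2)[OF that] dist_norm norm_mult)
  qed
  show thesis
  proof (rule that[OF g(1) h(1)])
    fix t :: real assume t: "\<bar>t\<bar> \<le> 1/2"
    show "g ` h ` rotation t ` half_circle \<subseteq> ball z e"
    proof clarify
      fix c assume c: "c \<in> half_circle"
      then have cS: "c \<in> S1" "Re c > 0" by (auto simp: half_circle_def)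
      have rS: "rotation t c = cis t * c" "cis t * c \<in> S1" using cS by (auto simp: rotation_def norm_mult)
      have "cmod (cis t * c - c) = cmod (cis t - 1)"
        using cS by (metis left_diff_distrib mult_1 mult_1_right norm_mult dist_0_norm mem_sphere)
      also have "\<dots> \<le> \<bar>t\<bar>"
        using dist_exp_i_1[of t] abs_sin_x_le_abs_x[of "t/2"] by (simp add: cis_conv_exp)
      finally have "cmod (cis t * c - c) \<le> 1/2" using t by simp
      then have "Re (cis t * c) \<ge> - 1/2"
        using abs_Re_le_cmod[of "cis t * c - c"] cS(2) by (simp del: times_complex.sel)
      then have "h (cis t * c) \<in> ball 1 e" using h(2) rS by blast
      moreover have "h (cis t * c) \<in> S1" using hS rS by blast
      ultimately show "g (h (rotation t c)) \<in> ball z e" using gb rS by simp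
    qed
  next
    show "S1 - ball z e \<subseteq> g ` h ` rotation pi ` half_circle"
    proof
      fix y assume y: "y \<in> S1 - ball z e"
      have "g ` S1 = S1" by (rule PSL2_image_S1[OF g(1)])
      then obtain w where w: "w \<in> S1" "y = g (h w)" using hS y by (metis DiffD1 imageE)
      have "h w \<in> S1" using hS w by blast
      then have "h w \<notin> ball 1 e" using gb y w by blast
      then have "Re w < - 1/2" using h(2)[OF w(1)] by linarith
      then have "- w \<in> half_circle" using w by (simp add: half_circle_def)
      moreover have "rotation pi (- w) = w" using w by (simp add: rotation_def)
      ultimately show "y \<in> g ` h ` rotation pi ` half_circle" using w by (metis image_eqI)
    qed
  qed
qed

section \<open>Positive energy\<close>

text \<open>The Cauchy integral of \<open>f\<close> vanishes outside the closed unit disc, extends holomorphically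
  through the arc of zeros around \<open>1\<close>, and so vanishes inside the disc too. Its Taylor coefficients
  there are the remaining Fourier coefficients of \<open>f\<close>.\<close>

lemma fourier_gap_zero:
  fixes f :: "real \<Rightarrow> complex"
  assumes e: "0 < e" "e < pi" and cont: "continuous_on {e..2 * pi - e} f"
    and coeff: "\<And>k::nat. k \<ge> 1 \<Longrightarrow> integral {e..2 * pi - e} (\<lambda>t. cis (real k * t) * f t) = 0"
    and t: "t \<in> {e..2 * pi - e}"
  shows "f t = 0"
proof -
  define a b where "a = e" and "b = 2 * pi - e"
  have ab: "a < b" "0 < a" "b < 2 * pi" using e by (auto simp: a_def b_def)
  have cf: "continuous_on {a..b} f" using cont by (simp add: a_def b_def)
  \<comment> \<open>For \<open>m = 1\<close> this is the Cauchy integral of \<open>f\<close> up to a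
    constant; the other weights shift the Fourier coefficients.\<close>
  define F where "F m z = integral {a..b} (\<lambda>t. cis (of_int m * t) * f t / (cis t - z))" for m :: int and z
  define c where "c m = integral {a..b} (\<lambda>t. cis (of_int m * t) * f t)" for m :: int
  have c_pos: "c m = 0" if "m \<ge> 1" for m
    using coeff[of "nat m"] that by (simp add: c_def a_def b_def)
  define G where "G = {z. \<forall>t\<in>{a..b}. cis t \<noteq> z}"
  have FI: "(\<lambda>t. cis (of_int m * t) * f t / (cis t - z)) integrable_on {a..b}" if "z \<in> G" for m z
    using that by (intro integrable_continuous_interval continuous_intros cf) (auto simp: G_def)
  have cI: "(\<lambda>t. cis (of_int m * t) * f t) integrable_on {a..b}" for m
    by (intro integrable_continuous_interval continuous_intros cf)
  \<comment> \<open>Writing \<open>cis t\<close> as \<open>z\<close> plus \<open>cis t - z\<close>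
    cancels the denominator in one of the two terms.\<close>
  have rec: "F (m + 1) z = c m + z * F m z" if "z \<in> G" for m z
  proof -
    have "F (m + 1) z = integral {a..b} (\<lambda>t. cis (of_int m * t) * f t
        + z * (cis (of_int m * t) * f t / (cis t - z)))"
      unfolding F_def
    proof (rule integral_cong)
      fix t assume "t \<in> {a..b}"
      then have "cis t - z \<noteq> 0" using that by (auto simp: G_def)
      moreover have "cis (of_int (m + 1) * t) = cis (of_int m * t) * cis t"
        by (simp add: cis_mult algebra_simps)
      ultimately show "cis (of_int (m + 1) * t) * f t / (cis t - z) =
          cis (of_int m * t) * f t + z * (cis (of_int m * t) * f t / (cis t - z))"
        by (simp add: field_simps)
    qed
    also have "\<dots> = c m + z * F m z"
      unfolding c_def F_def
      by (subst integral_add[OF cI integrable_on_mult_right[OF FI[OF that]]])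
        (simp only: integral_mult_right)
    finally show ?thesis .
  qed
  have hol: "F m holomorphic_on U" if "convex U" "U \<subseteq> G" for m U
  proof -
    have "(\<lambda>z. integral (cbox a b) (\<lambda>t. cis (of_int m * t) * f t / (cis t - z))) holomorphic_on U"
    proof (rule leibniz_rule_holomorphic[OF _ _ _ that(1)])
      show "((\<lambda>z. cis (of_int m * t) * f t / (cis t - z)) has_field_derivative
          cis (of_int m * t) * f t / (cis t - z)\<^sup>2) (at z within U)"
        if "z \<in> U" "t \<in> cbox a b" for z t
      proof -
        have "cis t - z \<noteq> 0" using that \<open>U \<subseteq> G\<close> by (force simp: G_def)
        then show ?thesis by (auto intro!: derivative_eq_intros simp: power2_eq_square)
      qed
      show "(\<lambda>t. cis (of_int m * t) * f t / (cis t - z)) integrable_on cbox a b" if "z \<in> U" for z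
        using FI that \<open>U \<subseteq> G\<close> by auto
      have "continuous_on (U \<times> {a..b}) (\<lambda>p. cis (of_int m * snd p) * f (snd p) / (cis (snd p) - fst p)\<^sup>2)"
        using that(2)
        by (intro continuous_intros continuous_on_compose2[OF cf]) (force simp: G_def)+
      then show "continuous_on (U \<times> cbox a b) (\<lambda>(z, t). cis (of_int m * t) * f t / (cis t - z)\<^sup>2)"
        by (simp add: case_prod_unfold)
    qed
    then show ?thesis unfolding F_def by simp
  qed
  have out_G: "z \<in> G" if "cmod z \<noteq> 1" for z using that by (auto simp: G_def)
  \<comment> \<open>As the coefficients \<open>c m\<close> with \<open>m \<ge> 1\<close> vanish, the
    recursion makes \<open>F (1 + int n) z\<close> grow like \<open>z ^ n\<close> unless
    \<open>F 1 z = 0\<close>, while all \<open>F m z\<close> have a common bound.\<close>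
  have out: "F 1 z = 0" if z: "cmod z > 1" for z
  proof -
    have zG: "z \<in> G" using z by (intro out_G) simp
    have pw: "F (1 + int n) z = z ^ n * F 1 z" for n
    proof (induction n)
      case (Suc n)
      have "F (1 + int (Suc n)) z = F ((1 + int n) + 1) z" by (simp add: algebra_simps)
      also have "\<dots> = z * F (1 + int n) z" unfolding rec[OF zG] using c_pos[of "1 + int n"] by simp
      finally show ?case using Suc by simp
    qed simp
    have "compact ((\<lambda>t. f t / (cis t - z)) ` {a..b})"
      using zG by (intro compact_continuous_image continuous_intros cf) (auto simp: G_def)
    from compact_imp_bounded[OF this]
    have "\<exists>B. \<forall>t\<in>{a..b}. cmod (f t / (cis t - z)) \<le> B" by (simp only: bounded_iff ball_simps)
    then obtain B where B: "\<And>t. t \<in> {a..b} \<Longrightarrow> cmod (f t / (cis t - z)) \<le> B" by blast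
    have bd: "cmod (F m z) \<le> B * (b - a)" for m
      unfolding F_def
    proof (rule integral_bound)
      show "continuous_on {a..b} (\<lambda>t. cis (of_int m * t) * f t / (cis t - z))"
        using zG by (intro continuous_intros cf) (auto simp: G_def)
      show "cmod (cis (of_int m * t) * f t / (cis t - z)) \<le> B" if "t \<in> {a..b}" for t
        using B[OF that] by (simp add: norm_mult norm_divide)
    qed (use ab in simp)
    have "cmod (F 1 z) \<le> B * (b - a) * (1 / cmod z) ^ n" for n
    proof -
      have "cmod z ^ n * cmod (F 1 z) \<le> B * (b - a)"
        using bd[of "1 + int n"] unfolding pw by (simp only: norm_mult norm_power)
      moreover have "0 < cmod z ^ n" by (rule zero_less_power) (use z in linarith)
      ultimately have "cmod (F 1 z) \<le> B * (b - a) / cmod z ^ n"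
        by (simp add: pos_le_divide_eq mult.commute)
      then show ?thesis by (simp add: power_one_over)
    qed
    moreover have "(\<lambda>n. B * (b - a) * (1 / cmod z) ^ n) \<longlonglongrightarrow> 0"
      by (intro tendsto_mult_right_zero LIMSEQ_power_zero) (use z in \<open>auto simp: divide_simps\<close>)
    ultimately have "cmod (F 1 z) \<le> 0" by (intro LIMSEQ_le_const[where X="\<lambda>n. B * (b - a) * (1 / cmod z) ^ n"]) auto
    then show ?thesis by simp
  qed
  have cis1: "x = 0" if "cis x = 1" "\<bar>x\<bar> < 2 * pi" for x
  proof -
    have "cos x = 1" using that(1) by (metis cis.sel(1) one_complex.sel(1))
    then obtain n :: int where n: "x = real_of_int n * 2 * pi" using cos_one_2pi_int by blast
    then have "\<bar>real_of_int n\<bar> < 1" using that(2) by (simp add: abs_mult)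
    then show ?thesis using n by simp
  qed
  have "\<exists>d>0. ball 1 d \<subseteq> G"
  proof -
    have "1 \<notin> cis ` {a..b}"
    proof
      assume "1 \<in> cis ` {a..b}"
      then obtain s where s: "s \<in> {a..b}" "cis s = 1" by (elim imageE) simp
      then show False using cis1[of s] ab by auto
    qed
    moreover have "closed (cis ` {a..b})"
      by (intro compact_imp_closed compact_continuous_image continuous_intros) auto
    ultimately obtain d where "d > 0" "ball 1 d \<subseteq> - (cis ` {a..b})"
      by (metis ComplI openE open_Compl)
    then show ?thesis by (intro exI[of _ d]) (auto simp: G_def)
  qed
  then obtain d where d: "d > 0" "ball 1 d \<subseteq> G" by blast
  have near: "F 1 z = 0" if z: "z \<in> ball 1 d" for z
  proof (rule analytic_continuation_open[of "ball 1 d \<inter> - cball 0 1" "ball 1 d" "F 1" "\<lambda>_. 0"])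
    have "cmod (of_real (1 + d / 2)) = 1 + d / 2" using d by (simp only: norm_of_real)
    moreover have "cmod (1 - of_real (1 + d / 2)) = d / 2" using d by (simp add: norm_divide)
    ultimately have "of_real (1 + d / 2) \<in> ball (1::complex) d \<inter> - cball 0 1"
      using d by (auto simp only: Int_iff Compl_iff mem_ball mem_cball dist_norm norm_minus_cancel diff_0)
    then show "ball (1::complex) d \<inter> - cball 0 1 \<noteq> {}" by blast
    show "F 1 holomorphic_on ball 1 d" by (rule hol[OF convex_ball d(2)])
  qed (use z out in \<open>auto simp: open_Int\<close>)
  have ball_G: "ball 0 1 \<subseteq> G" and G0: "0 \<in> G" using out_G by auto
  have "F 1 z = 0" if z: "z \<in> ball 0 1" for z
  proof (rule analytic_continuation_open[of "ball 0 1 \<inter> ball 1 d" "ball 0 1" "F 1" "\<lambda>_. 0"])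
    define r where "r = max (1/2) (1 - d / 2)"
    have r: "0 < r" "r < 1" "1 - r < d" using d by (auto simp: r_def)
    have "cmod (1 - of_real r) = 1 - r"
      using r norm_of_real[of "1 - r", where 'a=complex] by (simp del: norm_of_real)
    then have "of_real r \<in> ball (0::complex) 1 \<inter> ball 1 d"
      using r by (simp add: dist_norm)
    then show "ball (0::complex) 1 \<inter> ball 1 d \<noteq> {}" by blast
    show "F 1 holomorphic_on ball 0 1" by (rule hol[OF convex_ball ball_G])
  qed (use z near in \<open>auto simp: open_Int\<close>)
  \<comment> \<open>At \<open>z = 0\<close> the recursion gives \<open>c m = 0\<close>; off 0 it can
    then be divided by \<open>z\<close>, and continuity supplies the value at 0.\<close>
  then have inside: "F (1 - int n) z = 0" if "z \<in> ball 0 1" for n z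
    using that
  proof (induction n arbitrary: z)
    case (Suc n)
    define m where "m = 1 - int (Suc n)"
    have m1: "m + 1 = 1 - int n" by (simp add: m_def)
    have IH: "F (m + 1) z = 0" if "z \<in> ball 0 1" for z using Suc that by (simp add: m1)
    have "c m = 0" using rec[OF G0, of m] IH[of 0] by simp
    then have nz: "F m z = 0" if "z \<in> ball 0 1 - {0}" for z
      using rec[of z m] IH[of z] that ball_G by auto
    show ?case
    proof (cases "z = 0")
      case True
      have "continuous_on (ball 0 1) (F m)"
        by (rule holomorphic_on_imp_continuous_on[OF hol[OF convex_ball ball_G]])
      then have "(F m \<longlongrightarrow> F m 0) (at 0)"
        by (simp add: continuous_on_eq_continuous_at isCont_def)
      moreover have "(F m \<longlongrightarrow> 0) (at 0)"
      proof (rule tendsto_eventually)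
        have "eventually (\<lambda>z. z \<in> ball 0 1 - {0::complex}) (at 0)"
          using eventually_at_in_open[of "ball 0 1" "0::complex"] by simp
        then show "eventually (\<lambda>z. F m z = 0) (at 0)" by eventually_elim (rule nz)
      qed
      ultimately show ?thesis using True tendsto_unique[OF at_neq_bot] by (metis m_def)
    qed (use nz Suc(3) in \<open>auto simp: m_def\<close>)
  qed simp
  have c0: "c m = 0" for m
  proof (cases "m \<ge> 1")
    case False
    define n where "n = nat (- m)"
    have m: "m = - int n" "m + 1 = 1 - int n" using False by (auto simp: n_def)
    have "F (m + 1) 0 = 0" using inside[of 0 n] m by simp
    then show ?thesis using rec[OF G0, of m] by simp
  qed (simp add: c_pos)
  \<comment> \<open>\<open>V\<close> holds the continuous functions all of whose Fourier integrals
    over the interval vanish. It is stable under multiplication by powers of \<open>cis\<close>,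
    hence by real polynomials in the point \<open>cis t\<close>.\<close>
  define V where "V h \<longleftrightarrow> continuous_on {a..b} h \<and> (\<forall>k::int. integral {a..b} (\<lambda>t. cis (of_int k * t) * h t) = 0)"
    for h :: "real \<Rightarrow> complex"
  have Vf: "V f" using cf c0 by (simp add: V_def c_def)
  have Vadd: "V (\<lambda>t. g t + h t)" if "V g" "V h" for g h
  proof -
    have "integral {a..b} (\<lambda>t. cis (of_int k * t) * (g t + h t)) = 0" for k :: int
      using that unfolding distrib_left V_def
      by (subst integral_add) (auto intro!: integrable_continuous_interval continuous_intros)
    then show ?thesis using that by (auto simp: V_def intro: continuous_intros)
  qed
  have Vscale: "V (\<lambda>t. x * g t)" if "V g" for x g
    using that by (auto simp: V_def mult.left_commute[of _ x] intro: continuous_intros)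
  have Vcis: "V (\<lambda>t. cis (of_int j * t) * g t)" if "V g" for j g
  proof -
    have "cis (of_int k * t) * (cis (of_int j * t) * g t) = cis (of_int (k + j) * t) * g t" for k t
    proof -
      have "cis (of_int k * t) * cis (of_int j * t) = cis (of_int (k + j) * t)"
        by (simp add: cis_mult algebra_simps)
      then show ?thesis by (simp only: mult.assoc[symmetric])
    qed
    then show ?thesis using that unfolding V_def by (simp only: continuous_intros simp_thms)
  qed
  have Vpoly: "V (\<lambda>t. of_real (q (cis t)) * h t)" if "real_polynomial_function q" "V h" for q h
    using that
  proof (induction arbitrary: h)
    case (linear q)
    note Vh = linear(2)
    interpret bounded_linear q by fact
    \<comment> \<open>A real linear function of \<open>cis t\<close> is a combination of
      \<open>cis t\<close> and \<open>cis (- t)\<close>.\<close>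
    have "of_real (q (cis t)) * h t =
        ((of_real (q 1) - \<i> * of_real (q \<i>)) / 2) * (cis (of_int 1 * t) * h t)
        + ((of_real (q 1) + \<i> * of_real (q \<i>)) / 2) * (cis (of_int (-1) * t) * h t)" for t
    proof -
      have "cis t = cos t *\<^sub>R 1 + sin t *\<^sub>R \<i>" by (simp add: complex_eq_iff)
      then have "q (cis t) = cos t * q 1 + sin t * q \<i>" using add scaleR by (metis real_scaleR_def)
      then have "of_real (q (cis t)) =
          ((of_real (q 1) - \<i> * of_real (q \<i>)) / 2) * cis (of_int 1 * t)
          + ((of_real (q 1) + \<i> * of_real (q \<i>)) / 2) * cis (of_int (-1) * t)"
        by (simp add: complex_eq_iff field_simps)
      then show ?thesis by (simp only: distrib_right mult.assoc)
    qed
    then show ?case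
      by (simp only: Vadd[OF Vscale[OF Vcis[OF Vh, of 1]] Vscale[OF Vcis[OF Vh, of "-1"]]])
  next
    case (const x)
    then show ?case by (intro Vscale)
  next
    case (add p q)
    then show ?case using Vadd[OF add(3)[OF add(5)] add(4)[OF add(5)]] by (simp add: algebra_simps)
  next
    case (mult p q)
    then show ?case using mult(3)[OF mult(4)[OF mult(5)]] by (simp add: mult.assoc)
  qed
  have V0: "integral {a..b} h = 0" if "V h" for h
    using that unfolding V_def by (auto dest: spec[of _ 0])
  have cc: "continuous_on {a..b} cis" by (intro continuous_intros)
  have inj: "inj_on cis {a..b}"
  proof (rule inj_onI)
    fix s t assume st: "s \<in> {a..b}" "t \<in> {a..b}" "cis s = cis t"
    have "cis (s - t) = 1" using st(3) by (simp flip: cis_divide)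
    then show "s = t" using cis1[of "s - t"] st ab by auto
  qed
  \<comment> \<open>The gap makes \<open>cis\<close> injective on the interval, so
    \<open>cnj \<circ> f\<close> becomes a continuous function on a compact arc. Approximating it by
    polynomials shows that \<open>f\<close> is orthogonal to itself.\<close>
  define S where "S = cis ` {a..b}"
  define ci where "ci = the_inv_into {a..b} cis"
  have ci: "continuous_on S ci" "\<And>t. t \<in> {a..b} \<Longrightarrow> ci (cis t) = t"
    unfolding S_def ci_def using the_inv_into_f_f[OF inj]
    by (auto intro!: continuous_on_inv[OF cc compact_Icc])
  have cS: "compact S" unfolding S_def by (intro compact_continuous_image cc compact_Icc)
  have "continuous_on S (\<lambda>w. cnj (f (ci w)))"
    by (intro continuous_intros continuous_on_compose2[OF cf ci(1)]) (auto simp: S_def ci)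
  note SW = Stone_Weierstrass_polynomial_function[OF cS this]
  have cont_norm: "continuous_on {a..b} (\<lambda>t. (cmod (f t))\<^sup>2)" by (intro continuous_intros cf)
  have "integral {a..b} (\<lambda>t. (cmod (f t))\<^sup>2) \<le> 0"
  proof (rule field_le_epsilon)
    have "\<exists>B. \<forall>t\<in>{a..b}. cmod (f t) \<le> B"
      using compact_imp_bounded[OF compact_continuous_image[OF cf compact_Icc]]
      by (simp only: bounded_iff ball_simps)
    then obtain B where B: "\<And>t. t \<in> {a..b} \<Longrightarrow> cmod (f t) \<le> B" by blast
    have B0: "B \<ge> 0" using B[of a] ab by (auto intro: order_trans[OF norm_ge_zero])
    fix r :: real assume r: "r > 0"
    \<comment> \<open>The added 1 keeps the denominator positive when \<open>B = 0\<close>.\<close>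
    define \<delta> where "\<delta> = r / (B * (b - a) + 1)"
    have den: "B * (b - a) + 1 > 0" using B0 ab by (intro add_nonneg_pos mult_nonneg_nonneg) auto
    have \<delta>: "\<delta> > 0" using r den by (simp add: \<delta>_def)
    obtain p where p: "polynomial_function p" "\<And>w. w \<in> S \<Longrightarrow> cmod (cnj (f (ci w)) - p w) < \<delta>"
      using SW[OF \<delta>] by auto
    have pr: "real_polynomial_function (\<lambda>w. Re (p w))" "real_polynomial_function (\<lambda>w. Im (p w))"
      using p(1) bounded_linear_Re bounded_linear_Im by (auto simp: polynomial_function_def o_def)
    have Vp: "V (\<lambda>t. p (cis t) * f t)"
    proof -
      have "p (cis t) * f t = of_real (Re (p (cis t))) * f t + \<i> * (of_real (Im (p (cis t))) * f t)" for t
        by (simp add: complex_eq_iff)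
      then show ?thesis using Vadd[OF Vpoly[OF pr(1) Vf] Vscale[OF Vpoly[OF pr(2) Vf], of \<i>]] by simp
    qed
    have cp: "continuous_on {a..b} (\<lambda>t. p (cis t) * f t)" using Vp by (simp add: V_def)
    have "complex_of_real (integral {a..b} (\<lambda>t. (cmod (f t))\<^sup>2)) = integral {a..b} (\<lambda>t. of_real ((cmod (f t))\<^sup>2))"
      using integral_linear[OF integrable_continuous_interval[OF cont_norm] bounded_linear_of_real[where 'a=complex]]
      by (simp add: o_def)
    also have "\<dots> = integral {a..b} (\<lambda>t. cnj (f t) * f t)"
      by (simp only: complex_norm_square mult.commute)
    also have "\<dots> = integral {a..b} (\<lambda>t. cnj (f t) * f t) - integral {a..b} (\<lambda>t. p (cis t) * f t)"
      using V0[OF Vp] by simp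
    also have "\<dots> = integral {a..b} (\<lambda>t. cnj (f t) * f t - p (cis t) * f t)"
      by (intro integral_diff[symmetric] integrable_continuous_interval continuous_intros cf cp)
    finally have eq: "complex_of_real (integral {a..b} (\<lambda>t. (cmod (f t))\<^sup>2)) =
      integral {a..b} (\<lambda>t. cnj (f t) * f t - p (cis t) * f t)" .
    have "cmod (integral {a..b} (\<lambda>t. cnj (f t) * f t - p (cis t) * f t)) \<le> (\<delta> * B) * (b - a)"
    proof (rule integral_bound)
      show "continuous_on {a..b} (\<lambda>t. cnj (f t) * f t - p (cis t) * f t)"
        by (intro continuous_intros cf cp)
      fix t assume t: "t \<in> {a..b}"
      have "cmod (cnj (f t) * f t - p (cis t) * f t) = cmod (cnj (f t) - p (cis t)) * cmod (f t)"
        by (simp flip: norm_mult add: left_diff_distrib)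
      also have "\<dots> \<le> \<delta> * B"
        using p(2)[of "cis t"] ci(2)[OF t] t B[OF t] \<delta> by (intro mult_mono) (auto simp: S_def)
      finally show "cmod (cnj (f t) * f t - p (cis t) * f t) \<le> \<delta> * B" .
    qed (use ab in simp)
    then have "cmod (complex_of_real (integral {a..b} (\<lambda>t. (cmod (f t))\<^sup>2))) \<le> \<delta> * (B * (b - a))"
      unfolding eq by (simp add: mult_ac)
    then have "integral {a..b} (\<lambda>t. (cmod (f t))\<^sup>2) \<le> \<delta> * (B * (b - a))" by simp
    also have "\<dots> \<le> \<delta> * (B * (b - a) + 1)" using \<delta> by (intro mult_left_mono) auto
    also have "\<dots> = r" using den by (simp add: \<delta>_def)
    finally show "integral {a..b} (\<lambda>t. (cmod (f t))\<^sup>2) \<le> 0 + r" by simp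
  qed
  moreover have "0 \<le> integral {a..b} (\<lambda>t. (cmod (f t))\<^sup>2)"
    by (intro integral_nonneg integrable_continuous_interval cont_norm) auto
  ultimately have "integral {a..b} (\<lambda>t. (cmod (f t))\<^sup>2) = 0" by simp
  then have "((\<lambda>t. (cmod (f t))\<^sup>2) has_integral 0) (cbox a b)"
    using integrable_integral[OF integrable_continuous_interval[OF cont_norm]] by simp
  then have "(cmod (f t))\<^sup>2 = 0"
    by (rule has_integral_0_cbox_imp_0[rotated 2]) (use cont_norm ab t in \<open>auto simp: a_def b_def\<close>)
  then show ?thesis by simp
qed

section \<open>Unitary operators and the frequencies of the rotation group\<close>

lemma unitary_opsD:
  assumes "u \<in> unitary_ops"
  shows unitary_bounded: "u \<in> bounded_ops" and unitary_bij: "bij u"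
    and cinner_inv_unitary_left: "cinner (inv u \<xi>) \<eta> = cinner \<xi> (u \<eta>)"
    and unitary_inv_bounded: "inv u \<in> bounded_ops"
proof -
  show b: "u \<in> bounded_ops" using assms by (simp add: unitary_ops_def)
  have c: "cinner (u \<xi>) (u \<eta>) = cinner \<xi> \<eta>" for \<xi> \<eta> using assms by (simp add: unitary_ops_def)
  have "inj u"
  proof (rule injI)
    fix x y assume "u x = u y"
    then have "cinner (x - y) (x - y) = 0" by (simp flip: c[of "x - y"] add: bounded_opsD[OF b])
    then show "x = y" by (simp add: cinner_self)
  qed
  then show bij: "bij u" using assms by (simp add: unitary_ops_def bij_def)
  have ui: "u (inv u \<xi>) = \<xi>" for \<xi> by (rule surj_f_inv_f[OF bij_is_surj[OF bij]])
  show left: "cinner (inv u \<xi>) \<eta> = cinner \<xi> (u \<eta>)" for \<xi> \<eta>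
    using c[of "inv u \<xi>" \<eta>] by (simp add: ui)
  have n: "norm (inv u \<xi>) = norm \<xi>" for \<xi>
    using c[of "inv u \<xi>" "inv u \<xi>"] by (simp add: ui cinner_self flip: of_real_power)
  show "inv u \<in> bounded_ops"
  proof (rule bounded_opsI[where K=1])
    show "inv u (x + y) = inv u x + inv u y" for x y
      by (rule injD[OF \<open>inj u\<close>]) (simp add: ui bounded_opsD[OF b])
    show "inv u (a *\<^sub>C x) = a *\<^sub>C inv u x" for a x
      by (rule injD[OF \<open>inj u\<close>]) (simp add: ui bounded_opsD[OF b])
  qed (simp add: n)
qed

lemma integral_periodic:
  fixes G :: "real \<Rightarrow> 'a::banach"
  assumes cont: "continuous_on UNIV G" and per: "\<And>t. G (t + p) = G t" and s: "0 \<le> s" "s \<le> p"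
  shows "integral {0..p} (\<lambda>t. G (t + s)) = integral {0..p} G"
proof -
  have I: "G integrable_on {a..b}" for a b
    by (intro integrable_continuous_interval continuous_on_subset[OF cont]) auto
  have shift: "integral {a..b} (\<lambda>t. G (t + r)) = integral {a + r..b + r} G" for a b r
    using has_integral_shift_real_ivl[OF integrable_integral[OF I, of "a + r" "b + r"], of r]
    by (simp add: integral_unique)
  have "integral {0..p} (\<lambda>t. G (t + s)) = integral {s..p + s} G" by (simp add: shift)
  also have "\<dots> = integral {s..p} G + integral {p..p + s} G"
    using Henstock_Kurzweil_Integration.integral_combine[of s p "p + s" G] s I by simp
  also have "integral {p..p + s} G = integral {0..s} (\<lambda>t. G (t + p))"
    using shift[of 0 s p] by (simp add: add.commute)
  also have "\<dots> = integral {0..s} G" by (simp add: per)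
  also have "integral {s..p} G + integral {0..s} G = integral {0..p} G"
    using Henstock_Kurzweil_Integration.integral_combine[OF s I] by (simp add: add.commute)
  finally show ?thesis .
qed

context conformal_net
begin

definition rot :: "real \<Rightarrow> 'h \<Rightarrow> 'h" where "rot t = U (rotation t)"

lemma PSL2_unitary: "g \<in> PSL2 \<Longrightarrow> U g \<in> unitary_ops"
  using unitary PSL2_subset_Diff by blast

lemmas U_bounded = unitary_bounded[OF PSL2_unitary]
  and U_bij = unitary_bij[OF PSL2_unitary]
  and U_inv_bounded = unitary_inv_bounded[OF PSL2_unitary]

lemma U_inv_cancel: "g \<in> PSL2 \<Longrightarrow> U g (inv (U g) \<xi>) = \<xi>" "g \<in> PSL2 \<Longrightarrow> inv (U g) (U g \<xi>) = \<xi>"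
  using U_bij[of g] by (simp_all add: bij_is_surj surj_f_inv_f bij_is_inj)

lemma rot_bounded: "rot t \<in> bounded_ops"
  unfolding rot_def by (rule U_bounded[OF rotation_PSL2])

lemma rot_add: "rot (s + t) \<xi> = rot s (rot t \<xi>)"
  unfolding rot_def by (simp add: representation[OF rotation_PSL2 rotation_PSL2] flip: rotation_comp)

lemma rot_zero: "rot 0 \<xi> = \<xi>"
  using rot_add[of 0 0 \<xi>] U_bij[OF rotation_PSL2[of 0]] by (simp add: rot_def bij_is_inj inj_eq)

lemma rot_periodic: "rot (t + 2 * pi) = rot t"
  by (simp add: rot_def rotation_add_2pi)

lemma rot_continuous: "continuous_on S (\<lambda>t. rot t \<xi>)"
proof -
  \<comment> \<open>Strong continuity is assumed on matrices, so the rotations are lifted to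
    \<open>SL2\<close>, where the angle is halved.\<close>
  define m :: "real \<Rightarrow> real^2^2"
    where "m t = vector [vector [cos (t/2), sin (t/2)], vector [- sin (t/2), cos (t/2)]]" for t
  have m: "m t = (\<chi> i j. if i = 1 then if j = 1 then cos (t/2) else sin (t/2)
      else if j = 1 then - sin (t/2) else cos (t/2))" for t
    by (simp add: m_def vec_eq_iff forall_2)
  have "continuous_on S (\<lambda>t. if i = 1 then if j = 1 then cos (t/2) else sin (t/2)
      else if j = 1 then - sin (t/2) else cos (t/2))" for i j :: 2
    by (cases "i = 1"; cases "j = 1") (auto intro!: continuous_intros)
  then have "continuous_on S m"
    unfolding m by (intro continuous_on_vec_lambda)
  moreover have "m ` S \<subseteq> SL2" by (auto simp: m_def SL2_def det_2 simp flip: power2_eq_square)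
  ultimately have "continuous_on S (\<lambda>t. U (mobius (m t)) \<xi>)"
    by (rule continuous_on_compose2[OF strongly_continuous])
  then show ?thesis by (simp add: rot_def rotation_eq_mobius m_def)
qed

text \<open>The integral defines the component of \<open>\<eta>\<close> on which the generator acts as \<open>-k\<close>.\<close>

lemma negative_frequency_zero:
  assumes k: "k \<ge> (1::nat)"
  shows "integral {0..2 * pi} (\<lambda>t. cis (real k * t) * cinner \<xi> (rot t \<eta>)) = 0"
proof -
  define G where "G t = cis (real k * t) *\<^sub>C rot t \<eta>" for t
  have cont: "continuous_on S G" for S
    unfolding G_def by (intro scaleC.continuous_on continuous_intros rot_continuous)
  have per: "G (t + 2 * pi) = G t" for t
  proof -
    have "cis (real k * (t + 2 * pi)) = cis (real k * t) * cis (real k * (2 * pi))"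
      by (simp only: cis_mult distrib_left)
    also have "real k * (2 * pi) = 2 * pi * real k" by simp
    also have "cis (2 * pi * real k) = 1" by (rule cis_multiple_2pi) simp
    finally show ?thesis by (simp add: G_def rot_periodic)
  qed
  define v where "v = integral {0..2 * pi} G"
  have GI: "G integrable_on {0..2 * pi}" by (intro integrable_continuous_interval cont)
  have eig0: "rot s v = cis (- (real k * s)) *\<^sub>C v" if s: "0 \<le> s" "s \<le> 2 * pi" for s
  proof -
    have "rot s v = integral {0..2 * pi} (rot s \<circ> G)"
      unfolding v_def by (rule integral_linear[OF GI bounded_opsD(1)[OF rot_bounded], symmetric])
    also have "rot s \<circ> G = (\<lambda>z. cis (- (real k * s)) *\<^sub>C z) \<circ> (\<lambda>t. G (t + s))"
    proof
      fix t
      have "rot s (G t) = cis (real k * t) *\<^sub>C rot (t + s) \<eta>"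
        by (simp add: G_def bounded_opsD[OF rot_bounded] rot_add[symmetric] add.commute)
      also have "cis (real k * t) = cis (- (real k * s)) * cis (real k * (t + s))"
        by (simp add: cis_mult algebra_simps)
      finally show "(rot s \<circ> G) t = ((\<lambda>z. cis (- (real k * s)) *\<^sub>C z) \<circ> (\<lambda>t. G (t + s))) t"
        by (simp add: G_def scaleC_scaleC)
    qed
    also have "integral {0..2 * pi} \<dots> = cis (- (real k * s)) *\<^sub>C integral {0..2 * pi} (\<lambda>t. G (t + s))"
    proof (rule integral_linear[OF _ scaleC.bounded_linear_right])
      show "(\<lambda>t. G (t + s)) integrable_on {0..2 * pi}"
        by (intro integrable_continuous_interval continuous_on_compose2[OF cont[of UNIV]] continuous_intros) auto
    qed
    also have "integral {0..2 * pi} (\<lambda>t. G (t + s)) = v"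
      unfolding v_def by (rule integral_periodic[OF cont per s])
    finally show ?thesis .
  qed
  \<comment> \<open>The derivative at 0 needs a two-sided neighbourhood, while the shift of the
    integral was treated for nonnegative \<open>s\<close>; the group law gives negative
    \<open>s\<close>.\<close>
  have eig: "rot s v = cis (- (real k * s)) *\<^sub>C v" if s: "\<bar>s\<bar> < 1" for s
  proof (cases "s \<ge> 0")
    case True
    then show ?thesis using s pi_gt3 by (intro eig0) auto
  next
    case False
    have "v = rot s (rot (- s) v)" using rot_add[of s "- s" v] by (simp add: rot_zero)
    also have "\<dots> = cis (real k * s) *\<^sub>C rot s v"
      using False s pi_gt3 by (subst eig0) (auto simp: bounded_opsD[OF rot_bounded])
    finally have "cis (- (real k * s)) *\<^sub>C v = (cis (- (real k * s)) * cis (real k * s)) *\<^sub>C rot s v"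
      by (metis scaleC_scaleC)
    then show ?thesis by (simp add: cis_mult)
  qed
  let ?D = "generator_domain rot" and ?L = "generator rot"
  have "((\<lambda>t. cis (- (real k * t)) *\<^sub>C v) has_vector_derivative (- (\<i> * real k)) *\<^sub>C v) (at 0)"
  proof -
    have "((\<lambda>t. cis (- (real k * t))) has_vector_derivative - (\<i> * real k)) (at 0)"
      unfolding has_vector_derivative_def
      by (auto intro!: derivative_eq_intros simp: scaleR_conv_of_real fun_eq_iff)
    from bounded_linear.has_vector_derivative[OF scaleC.bounded_linear_left this] show ?thesis .
  qed
  then have der: "((\<lambda>t. rot t v) has_vector_derivative (- (\<i> * real k)) *\<^sub>C v) (at 0)"
    by (rule has_vector_derivative_transform_within_open[of _ _ _ "{-1<..<1}"]) (auto simp: eig)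
  have vD: "v \<in> ?D" using der unfolding generator_domain_def by (auto intro: differentiableI_vector)
  have Lv: "?L v = of_real (- real k) *\<^sub>C v"
    unfolding generator_def vector_derivative_at[OF der] by (simp add: scaleC_scaleC)
  have z0: "rot t 0 = 0" for t using bounded_opsD(5)[OF rot_bounded] .
  have zD: "0 \<in> ?D" and L0: "?L 0 = 0" by (simp_all add: generator_domain_def generator_def z0)
  \<comment> \<open>Otherwise \<open>v\<close> and 0 would be two vectors of the domain with the
    same image under the generator plus \<open>k\<close>, and \<open>-k\<close> would belong to the
    spectrum.\<close>
  have "v = 0"
  proof (rule ccontr)
    assume "v \<noteq> 0"
    moreover have "?L v - of_real (- real k) *\<^sub>C v = ?L 0 - of_real (- real k) *\<^sub>C 0"
      unfolding L0 Lv by simp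
    ultimately have "\<not> inj_on (\<lambda>\<xi>. ?L \<xi> - of_real (- real k) *\<^sub>C \<xi>) ?D"
      using inj_onD[OF _ _ vD zD] by blast
    then have "of_real (- real k) \<in> spectrum ?D ?L"
      unfolding spectrum_def bij_betw_def by blast
    then have "complex_of_real (- real k) \<in> \<real>\<^sub>\<ge>\<^sub>0"
      using positive_energy unfolding rot_def[abs_def] by blast
    then show False using k by (simp add: complex_nonneg_Reals_iff)
  qed
  have "integral {0..2 * pi} (cinner \<xi> \<circ> G) = cinner \<xi> v"
    unfolding v_def by (rule integral_linear[OF GI cinner.bounded_linear_right])
  then show ?thesis using \<open>v = 0\<close> by (simp add: o_def G_def cinner_scaleC_right)
qed

text \<open>The function vanishes at both ends of a period, so its Fourier integrals over the middle
  interval equal those over the whole period, which vanish for \<open>k \<ge> 1\<close> by positive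
  energy. The angle 1/2 is the one allowed in \<open>concentrating_arcs\<close>.\<close>

lemma rotation_matrix_element_zero:
  assumes zero: "\<And>t. \<bar>t\<bar> \<le> 1/2 \<Longrightarrow> cinner \<xi> (rot t \<eta>) = 0"
  shows "cinner \<xi> (rot pi \<eta>) = 0"
proof (rule fourier_gap_zero[of "1/2" "\<lambda>t. cinner \<xi> (rot t \<eta>)"])
  have cont: "continuous_on S (\<lambda>t. cinner \<xi> (rot t \<eta>))" for S
    by (intro cinner.continuous_on continuous_intros rot_continuous)
  show "continuous_on {1/2..2 * pi - 1/2} (\<lambda>t. cinner \<xi> (rot t \<eta>))" by (rule cont)
  show "(0::real) < 1/2" "1/2 < pi" "pi \<in> {1/2..2 * pi - 1/2}" using pi_gt3 by auto
  fix k :: nat assume k: "k \<ge> 1"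
  let ?h = "\<lambda>t. cis (real k * t) * cinner \<xi> (rot t \<eta>)"
  have I: "?h integrable_on {a..b}" for a b
    by (intro integrable_continuous_interval continuous_intros cont)
  have "integral {0..1/2::real} ?h = integral {0..1/2::real} (\<lambda>_. 0)"
    by (rule integral_cong) (use zero in auto)
  moreover have "integral {2 * pi - 1/2..2 * pi} ?h = integral {2 * pi - 1/2..2 * pi} (\<lambda>_. 0)"
  proof (rule integral_cong)
    fix t assume "t \<in> {2 * pi - 1/2..2 * pi}"
    then have "cinner \<xi> (rot (t - 2 * pi) \<eta>) = 0" by (intro zero) auto
    then show "?h t = 0" using rot_periodic[of "t - 2 * pi"] by simp
  qed
  moreover have "integral {0..1/2::real} ?h + integral {1/2..2 * pi} ?h = integral {0..2 * pi} ?h"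
    using pi_gt3 by (intro Henstock_Kurzweil_Integration.integral_combine I) auto
  moreover have "integral {1/2..2 * pi - 1/2} ?h + integral {2 * pi - 1/2..2 * pi} ?h = integral {1/2..2 * pi} ?h"
    using pi_gt3 by (intro Henstock_Kurzweil_Integration.integral_combine I) auto
  ultimately show "integral {1/2..2 * pi - 1/2} ?h = 0"
    using negative_frequency_zero[OF k, of \<xi> \<eta>] by simp
qed

section \<open>The Reeh--Schlieder property\<close>

lemma PSL2_covariance: "I \<in> arcs \<Longrightarrow> g \<in> PSL2 \<Longrightarrow> Ad (U g) ` A I = A (g ` I)"
  using covariance PSL2_subset_Diff by blast

lemma Ad_vacuum: "g \<in> PSL2 \<Longrightarrow> Ad (U g) x \<Omega> = U g (x \<Omega>)"
  using U_inv_cancel(2)[of g \<Omega>] by (simp add: Ad_def vacuum_invariant)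

lemma arc_subset: "I \<in> arcs \<Longrightarrow> I \<subseteq> S1"
  unfolding arcs_def using openin_imp_subset by blast

lemma arc_closure: "I \<in> arcs \<Longrightarrow> closure I \<subseteq> S1 \<and> closure I \<noteq> S1"
  using closure_minimal[OF arc_subset closed_sphere] by (auto simp: arcs_def)

text \<open>For small \<open>t\<close> the arc \<open>C t\<close> lies in the ball and hence in
  \<open>J\<close>; at \<open>t = pi\<close> it contains everything outside the ball and hence
  \<open>K\<close>. Orthogonality is carried from the former to the latter by positive
  energy.\<close>

lemma perp_propagates:
  assumes J: "J \<in> arcs" and K: "K \<in> arcs" and z: "z \<in> S1" and e: "e > 0"
    and zJ: "S1 \<inter> ball z e \<subseteq> J" and zK: "K \<inter> ball z e = {}"
    and perp: "\<And>x. x \<in> A J \<Longrightarrow> cinner \<xi> (x \<Omega>) = 0" and x: "x \<in> A K"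
  shows "cinner \<xi> (x \<Omega>) = 0"
proof -
  obtain g h where g: "g \<in> PSL2" and h: "h \<in> PSL2"
    and small: "\<And>t. \<bar>t\<bar> \<le> 1/2 \<Longrightarrow> g ` h ` rotation t ` half_circle \<subseteq> ball z e"
    and large: "S1 - ball z e \<subseteq> g ` h ` rotation pi ` half_circle"
    by (rule concentrating_arcs[OF z e]) (rule that)
  define C where "C t = g ` h ` rotation t ` half_circle" for t
  have C: "C t \<in> arcs" for t
    unfolding C_def by (intro PSL2_image_arcs g h rotation_PSL2 half_circle_arc)
  have AC: "A (C t) = Ad (U g) ` Ad (U h) ` Ad (rot t) ` A half_circle" for t
    unfolding C_def rot_def
    by (simp add: PSL2_covariance PSL2_image_arcs g h rotation_PSL2 half_circle_arc)
  have vac: "Ad (U g) (Ad (U h) (Ad (rot t) y)) \<Omega> = U g (U h (rot t (y \<Omega>)))" for t y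
    by (simp add: Ad_vacuum g h rotation_PSL2 rot_def)
  \<comment> \<open>Moving \<open>g\<close> and \<open>h\<close> onto the other vector leaves matrix
    elements of the plain rotations.\<close>
  define \<zeta> where "\<zeta> = inv (U h) (inv (U g) \<xi>)"
  have \<zeta>: "cinner \<zeta> \<eta> = cinner \<xi> (U g (U h \<eta>))" for \<eta>
    by (simp add: \<zeta>_def cinner_inv_unitary_left[OF PSL2_unitary] g h)
  have zero: "cinner \<zeta> (rot pi (y \<Omega>)) = 0" if y: "y \<in> A half_circle" for y
  proof (rule rotation_matrix_element_zero)
    fix t :: real assume t: "\<bar>t\<bar> \<le> 1/2"
    have "C t \<subseteq> ball z e" using small[OF t] by (simp only: C_def)
    then have "C t \<subseteq> J" using arc_subset[OF C[of t]] zJ by blast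
    then have "A (C t) \<subseteq> A J" by (rule isotony[OF C J])
    then have "Ad (U g) (Ad (U h) (Ad (rot t) y)) \<in> A J" using y unfolding AC by blast
    from perp[OF this] show "cinner \<zeta> (rot t (y \<Omega>)) = 0" by (simp add: vac \<zeta>)
  qed
  have "K \<subseteq> C pi" using large zK arc_subset[OF K] unfolding C_def by blast
  then have "x \<in> A (C pi)" using isotony[OF K C] x by blast
  then obtain y where "y \<in> A half_circle" "x = Ad (U g) (Ad (U h) (Ad (rot pi) y))"
    unfolding AC by blast
  then show ?thesis using zero by (simp add: vac \<zeta>)
qed

lemma small_arc:
  assumes "z \<in> S1" "e > 0" obtains K where "K \<in> arcs" "K \<subseteq> ball z e"
proof -
  obtain g h where "g \<in> PSL2" "h \<in> PSL2"
    "\<And>t. \<bar>t\<bar> \<le> 1/2 \<Longrightarrow> g ` h ` rotation t ` half_circle \<subseteq> ball z e"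
    by (rule concentrating_arcs[OF assms]) (rule that)
  note gh = this
  show thesis
  proof (rule that)
    show "g ` h ` rotation 0 ` half_circle \<in> arcs"
      by (intro PSL2_image_arcs half_circle_arc rotation_PSL2 gh)
    show "g ` h ` rotation 0 ` half_circle \<subseteq> ball z e" by (rule gh(3)) simp
  qed
qed

text \<open>One propagation needs a point of \<open>J\<close> outside the closure of
  \<open>K\<close>. In general two are made, through a small arc \<open>L\<close> off the closure of
  \<open>K\<close> whose own closure misses a point of \<open>J\<close>.\<close>

lemma perp_independent:
  assumes J: "J \<in> arcs" and K: "K \<in> arcs"
    and perp: "\<And>x. x \<in> A J \<Longrightarrow> cinner \<xi> (x \<Omega>) = 0" and x: "x \<in> A K"
  shows "cinner \<xi> (x \<Omega>) = 0"
proof -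
  have step: "cinner \<xi> (x \<Omega>) = 0"
    if JK: "J \<in> arcs" "K \<in> arcs" and z: "z \<in> J" "z \<notin> closure K"
      and perp: "\<And>x. x \<in> A J \<Longrightarrow> cinner \<xi> (x \<Omega>) = 0" and x: "x \<in> A K" for J K z x
  proof -
    have "openin (top_of_set S1) J" using JK by (simp add: arcs_def)
    then obtain d where d: "d > 0" "ball z d \<inter> S1 \<subseteq> J" "z \<in> S1"
      using z(1) unfolding openin_contains_ball by blast
    obtain r where r: "r > 0" "ball z r \<subseteq> - closure K"
      using z(2) by (metis ComplI closed_closure openE open_Compl)
    show ?thesis
    proof (rule perp_propagates[OF JK d(3), where e = "min d r"])
      show "min d r > 0" using d r by simp
      show "S1 \<inter> ball z (min d r) \<subseteq> J" using d(2) by auto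
      show "K \<inter> ball z (min d r) = {}" using r(2) closure_subset[of K] by auto
      show "cinner \<xi> (y \<Omega>) = 0" if "y \<in> A J" for y by (rule perp[OF that])
      show "x \<in> A K" by (rule x)
    qed
  qed
  have KS: "closure K \<subseteq> S1" "closure K \<noteq> S1"
    using arc_closure[OF K] by auto
  then obtain w where w: "w \<in> S1" "w \<notin> closure K" by blast
  \<comment> \<open>An arc is not a single point: this would be open and closed in the connected
    circle.\<close>
  have "\<exists>z\<in>J. z \<noteq> w"
  proof (rule ccontr)
    assume "\<not> ?thesis"
    then have Jw: "J = {w}" using J by (auto simp: arcs_def)
    have "connected S1" by (rule connected_sphere) simp
    moreover have "openin (top_of_set S1) J" using J by (simp add: arcs_def)
    moreover have "closedin (top_of_set S1) J" unfolding Jw using w(1) by (intro closed_subset) auto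
    ultimately have "J = {} \<or> J = S1" unfolding connected_clopen by blast
    then show False using J by (auto simp: arcs_def)
  qed
  then obtain z where z: "z \<in> J" "z \<noteq> w" by blast
  obtain r where r: "r > 0" "ball w r \<subseteq> - closure K"
    using w(2) by (metis ComplI closed_closure openE open_Compl)
  \<comment> \<open>The radius \<open>r\<close> keeps \<open>L\<close> off the closure of
    \<open>K\<close>, and half the distance keeps \<open>z\<close> off the closure of
    \<open>L\<close>.\<close>
  define e where "e = min r (dist w z / 2)"
  have e: "e > 0" using r z by (simp add: e_def)
  obtain L where L: "L \<in> arcs" "L \<subseteq> ball w e" by (rule small_arc[OF w(1) e])
  have "closure L \<subseteq> cball w e" using L(2) by (intro closure_minimal) (auto simp: subset_iff)
  moreover have "e < dist w z" using z by (simp add: e_def min_less_iff_disj)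
  ultimately have zL: "z \<notin> closure L" by auto
  obtain y where y: "y \<in> L" using L(1) by (auto simp: arcs_def)
  moreover have "ball w e \<subseteq> ball w r" by (rule subset_ball) (simp add: e_def)
  ultimately have yK: "y \<notin> closure K" using L(2) r(2) by blast
  have "cinner \<xi> (x \<Omega>) = 0" if "x \<in> A L" for x
    by (rule step[OF J L(1) z(1) zL]) (use perp that in auto)
  then show ?thesis by (intro step[OF L(1) K y yK _ x])
qed

lemma arc_bounded: "I \<in> arcs \<Longrightarrow> x \<in> A I \<Longrightarrow> x \<in> bounded_ops"
  using von_neumann von_neumann_bounded(2) by blast

theorem reeh_schlieder:
  assumes I: "I \<in> arcs" shows "closure ((\<lambda>x. x \<Omega>) ` A I) = UNIV"
proof -
  define N where "N = {\<xi>. \<forall>x\<in>A I. cinner \<xi> (x \<Omega>) = 0}"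
  have inN: "cinner \<xi> (x \<Omega>) = 0" if "\<xi> \<in> N" "K \<in> arcs" "x \<in> A K" for \<xi> K x
    using perp_independent[OF I that(2) _ that(3)] that(1) by (auto simp: N_def)
  have "closed {\<xi>. cinner \<xi> (x \<Omega>) = 0}" for x
    by (intro closed_Collect_eq cinner.continuous_on continuous_intros)
  then have "closed (\<Inter>x\<in>A I. {\<xi>. cinner \<xi> (x \<Omega>) = 0})" by (intro closed_INT) auto
  moreover have "N = (\<Inter>x\<in>A I. {\<xi>. cinner \<xi> (x \<Omega>) = 0})" by (auto simp: N_def)
  ultimately have cN: "closed N" by simp
  obtain P where P: "P \<in> bounded_ops" "\<And>x. P x \<in> N" "\<And>x. x \<in> N \<Longrightarrow> P x = x"
    "\<And>x y. cinner (P x) y = cinner x (P y)"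
    by (rule orthogonal_projection[OF cN]) (auto simp: N_def cinner_add_left cinner_scaleC_left)
  \<comment> \<open>Independence of the arc is used twice: vectors of \<open>N\<close> are
    orthogonal to \<open>A K\<close> applied to \<open>\<Omega>\<close>, a set stable under
    \<open>adj a\<close>, and orthogonality to it implies orthogonality for
    \<open>A I\<close>.\<close>
  have inv: "a \<xi> \<in> N" if \<xi>: "\<xi> \<in> N" and K: "K \<in> arcs" and a: "a \<in> A K" for a \<xi> K
  proof -
    have aa: "adj a \<in> A K" by (rule von_neumann_adj[OF von_neumann[OF K] a])
    have "cinner (a \<xi>) (b \<Omega>) = 0" if b: "b \<in> A K" for b
    proof -
      have "cinner (a \<xi>) (b \<Omega>) = cinner \<xi> ((adj a \<circ> b) \<Omega>)"
        by (simp add: cinner_adj_right[OF arc_bounded[OF K a]])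
      then show ?thesis using inN[OF \<xi> K von_neumann_comp[OF von_neumann[OF K] aa b]] by simp
    qed
    then have "\<forall>x\<in>A I. cinner (a \<xi>) (x \<Omega>) = 0" using perp_independent[OF K I] by blast
    then show ?thesis by (simp add: N_def)
  qed
  \<comment> \<open>\<open>N\<close> is invariant under \<open>a\<close> and under
    \<open>adj a\<close>, so its projection commutes with \<open>a\<close>.\<close>
  have Pcomm: "P \<in> commutant (\<Union>I\<in>arcs. A I)"
  proof (rule commutantI[OF P(1)])
    fix a \<xi> assume "a \<in> (\<Union>I\<in>arcs. A I)"
    then obtain K where K: "K \<in> arcs" "a \<in> A K" by blast
    have ab: "a \<in> bounded_ops" by (rule arc_bounded[OF K])
    have aa: "adj a \<in> A K" by (rule von_neumann_adj[OF von_neumann[OF K(1)] K(2)])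
    show "a (P \<xi>) = P (a \<xi>)"
    proof (rule cinner_eqI)
      fix \<eta>
      have "cinner \<eta> (P (a \<xi>)) = cinner (adj a (P \<eta>)) \<xi>"
        by (simp add: P(4)[symmetric] cinner_adj_left[OF ab])
      also have "adj a (P \<eta>) = P (adj a (P \<eta>))" using P(2,3) inv[OF _ K(1) aa] by simp
      also have "cinner \<dots> \<xi> = cinner \<eta> (P (a (P \<xi>)))"
        by (simp add: P(4) cinner_adj_left[OF ab])
      also have "P (a (P \<xi>)) = a (P \<xi>)" using P(2,3) inv[OF _ K] by simp
      finally show "cinner \<eta> (a (P \<xi>)) = cinner \<eta> (P (a \<xi>))" by simp
    qed
  qed
  \<comment> \<open>Since \<open>id\<close> belongs to \<open>A I\<close>, the vacuum is orthogonal
    to \<open>N\<close>. Thus \<open>P\<close> annihilates \<open>\<Omega>\<close> and, by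
    commutation, the dense set obtained from the whole net.\<close>
  have "cinner (P \<Omega>) (id \<Omega>) = 0" by (rule inN[OF P(2) I von_neumann_id[OF von_neumann[OF I]]])
  moreover have "cinner (P \<Omega>) (P \<Omega>) = cinner (P \<Omega>) \<Omega>" using P(2,3,4) by metis
  ultimately have P\<Omega>: "P \<Omega> = 0" by (simp add: cinner_self)
  have "P = (\<lambda>_. 0)"
  proof (rule bounded_ops_eq_dense[OF vacuum_cyclic P(1) bounded_ops_zero])
    fix d assume "d \<in> (\<lambda>x. x \<Omega>) ` commutant (commutant (\<Union>I\<in>arcs. A I))"
    then obtain x where x: "x \<in> commutant (commutant (\<Union>I\<in>arcs. A I))" "d = x \<Omega>" by blast
    then show "P d = 0"
      using commutantD[OF x(1) Pcomm, of \<Omega>] P\<Omega> bounded_opsD(5)[of x] commutant_bounded_ops by auto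
  qed
  then have N0: "\<xi> = 0" if "\<xi> \<in> N" for \<xi> using P(3)[OF that] by simp
  \<comment> \<open>The Riesz vector \<open>w\<close> of \<open>\<xi>\<close> lies in the closure
    and differs from \<open>\<xi>\<close> by an element of \<open>N\<close>, which is 0.\<close>
  have "\<xi> \<in> closure ((\<lambda>x. x \<Omega>) ` A I)" for \<xi>
  proof -
    have "\<exists>w\<in>closure ((\<lambda>b. b \<Omega>) ` A I). norm w \<le> norm \<xi> \<and> (\<forall>b\<in>A I. cinner w (b \<Omega>) = cinner \<xi> (b \<Omega>))"
    proof (rule riesz_indexed)
      show "A I \<noteq> {}" using von_neumann_id[OF von_neumann[OF I]] by auto
      show "\<exists>c\<in>A I. c \<Omega> = s *\<^sub>C a \<Omega> + t *\<^sub>C b \<Omega> \<and> cinner \<xi> (c \<Omega>) = s * cinner \<xi> (a \<Omega>) + t * cinner \<xi> (b \<Omega>)"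
        if "a \<in> A I" "b \<in> A I" for a b s t
        by (intro bexI[OF _ von_neumann_lincomb[OF von_neumann[OF I] that]])
          (auto simp: cinner_add_right cinner_scaleC_right)
    qed (use norm_cinner_le in auto)
    then obtain w where w: "w \<in> closure ((\<lambda>b. b \<Omega>) ` A I)" "\<And>b. b \<in> A I \<Longrightarrow> cinner w (b \<Omega>) = cinner \<xi> (b \<Omega>)"
      by blast
    have "\<xi> - w \<in> N" using w(2) by (simp add: N_def cinner.diff_left)
    then show ?thesis using N0 w(1) by force
  qed
  then show ?thesis by blast
qed

text \<open>An arc \<open>K\<close> disjoint from \<open>I\<close> exists because \<open>I\<close>
  is not dense. By locality \<open>A K\<close> lies in the commutant of \<open>A I\<close>, whose
  vacuum vectors are therefore dense as well.\<close>

lemma arc_vacuum_algebra: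
  assumes I: "I \<in> arcs" shows "vacuum_algebra (A I) \<Omega>"
proof
  show "von_neumann_algebra (A I)" by (rule von_neumann[OF I])
  show "closure ((\<lambda>x. x \<Omega>) ` A I) = UNIV" by (rule reeh_schlieder[OF I])
  have IS: "closure I \<subseteq> S1" "closure I \<noteq> S1"
    using arc_closure[OF I] by auto
  then obtain w where w: "w \<in> S1" "w \<notin> closure I" by blast
  obtain r where r: "r > 0" "ball w r \<subseteq> - closure I"
    using w(2) by (metis ComplI closed_closure openE open_Compl)
  obtain K where K: "K \<in> arcs" "K \<subseteq> ball w r" by (rule small_arc[OF w(1) r(1)])
  have "K \<inter> I = {}" using K(2) r(2) closure_subset[of I] by auto
  then have "A K \<subseteq> commutant (A I)" by (rule locality[OF K(1) I])
  then have "closure ((\<lambda>x. x \<Omega>) ` A K) \<subseteq> closure ((\<lambda>x. x \<Omega>) ` commutant (A I))"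
    by (intro closure_mono image_mono)
  then show "closure ((\<lambda>x. x \<Omega>) ` commutant (A I)) = UNIV" using reeh_schlieder[OF K(1)] by auto
qed

end

section \<open>The convex set\<close>

lemma closed_Collect_const_imp: "(P \<Longrightarrow> closed {x. Q x}) \<Longrightarrow> closed {x. P \<longrightarrow> Q x}"
  by (cases P) auto

lemma continuous_on_coordinate: "continuous_on S (\<lambda>g::'i \<Rightarrow> 'b::topological_space. g i)"
  by (rule continuous_on_subset[OF continuous_on_product_coordinates]) simp

text \<open>Tychonoff's theorem, for the topology of the function type.\<close>

lemma compact_coordinate_box:
  fixes B :: "'i \<Rightarrow> 'b::topological_space set"
  assumes "\<And>i. compact (B i)" shows "compact {g. \<forall>i. g i \<in> B i}"
proof -
  have "compactin (product_topology (\<lambda>i. euclidean) UNIV) (PiE UNIV B)"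
    using assms by (simp add: compactin_PiE)
  moreover have "PiE UNIV B = {g. \<forall>i. g i \<in> B i}" by (auto simp: PiE_def)
  ultimately show ?thesis by (simp add: euclidean_product_topology)
qed

lemma Hausdorff_space_separating:
  assumes "\<And>x y. x \<in> topspace X \<Longrightarrow> y \<in> topspace X \<Longrightarrow> x \<noteq> y \<Longrightarrow>
      \<exists>f :: 'a \<Rightarrow> complex. continuous_map X euclidean f \<and> f x \<noteq> f y"
  shows "Hausdorff_space X"
  unfolding Hausdorff_space_def
proof (intro allI impI)
  fix x y assume xy: "x \<in> topspace X \<and> y \<in> topspace X \<and> x \<noteq> y"
  then obtain f :: "'a \<Rightarrow> complex" where f: "continuous_map X euclidean f" "f x \<noteq> f y"
    using assms by blast
  obtain U V where UV: "open U" "open V" "f x \<in> U" "f y \<in> V" "U \<inter> V = {}"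
    using hausdorff[OF f(2)] by blast
  have "openin X {x \<in> topspace X. f x \<in> W}" if "open W" for W
    using openin_continuous_map_preimage[OF f(1), of W] that by simp
  then show "\<exists>U V. openin X U \<and> openin X V \<and> x \<in> U \<and> y \<in> V \<and> disjnt U V"
    using UV xy
    by (intro exI[of _ "{x \<in> topspace X. f x \<in> U}"] exI[of _ "{x \<in> topspace X. f x \<in> V}"])
      (auto simp: disjnt_def)
qed

context conformal_net
begin

lemma UCP_D:
  assumes "\<phi> \<in> UCP A U \<Omega>"
  shows UCP_ucp: "I \<in> arcs \<Longrightarrow> \<phi> I \<in> ucp_maps (A I)"
    and UCP_PiE: "\<phi> \<in> (\<Pi>\<^sub>E I\<in>arcs. ucp_maps (A I))"
    and UCP_isotone: "I \<in> arcs \<Longrightarrow> J \<in> arcs \<Longrightarrow> I \<subseteq> J \<Longrightarrow> x \<in> A I \<Longrightarrow> \<phi> J x = \<phi> I x"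
    and UCP_vacuum: "I \<in> arcs \<Longrightarrow> x \<in> A I \<Longrightarrow> cinner \<Omega> (\<phi> I x \<Omega>) = cinner \<Omega> (x \<Omega>)"
    and UCP_covariant: "I \<in> arcs \<Longrightarrow> g \<in> PSL2 \<Longrightarrow> x \<in> A (g ` I) \<Longrightarrow>
        Ad (U g) (\<phi> I (Ad (inv (U g)) x)) = \<phi> (g ` I) x"
    and UCP_Vir: "I \<in> arcs \<Longrightarrow> x \<in> Vir U I \<Longrightarrow> \<phi> I x = x"
proof -
  note c = assms[unfolded UCP_def mem_Collect_eq]
  note c' = c[THEN conjunct2, THEN conjunct2]
  show P: "\<phi> \<in> (\<Pi>\<^sub>E I\<in>arcs. ucp_maps (A I))" by (rule c[THEN conjunct1])
  show "I \<in> arcs \<Longrightarrow> \<phi> I \<in> ucp_maps (A I)" by (rule PiE_mem[OF P])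
  show "I \<in> arcs \<Longrightarrow> J \<in> arcs \<Longrightarrow> I \<subseteq> J \<Longrightarrow> x \<in> A I \<Longrightarrow> \<phi> J x = \<phi> I x"
    by (rule c'[THEN conjunct1, rule_format])
  show "I \<in> arcs \<Longrightarrow> x \<in> A I \<Longrightarrow> cinner \<Omega> (\<phi> I x \<Omega>) = cinner \<Omega> (x \<Omega>)"
    by (rule c'[THEN conjunct2, THEN conjunct1, rule_format])
  show "I \<in> arcs \<Longrightarrow> g \<in> PSL2 \<Longrightarrow> x \<in> A (g ` I) \<Longrightarrow>
      Ad (U g) (\<phi> I (Ad (inv (U g)) x)) = \<phi> (g ` I) x"
    by (rule c'[THEN conjunct2, THEN conjunct2, THEN conjunct1, rule_format])
  show "I \<in> arcs \<Longrightarrow> x \<in> Vir U I \<Longrightarrow> \<phi> I x = x"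
    by (rule c'[THEN conjunct2, THEN conjunct2, THEN conjunct2, rule_format])
qed

lemma UCP_undefined:
  assumes "\<phi> \<in> UCP A U \<Omega>" "I \<in> arcs" "x \<notin> A I" shows "\<phi> I x = undefined"
  using UCP_ucp[OF assms(1,2)] assms(3) by (auto simp: ucp_maps_def)

text \<open>The place where automatic normality and faithfulness enter; the remaining conditions are
  stable under limits of matrix elements.\<close>

lemma UCP_I:
  assumes ucp: "\<phi> \<in> (\<Pi>\<^sub>E I\<in>arcs. ucp_maps (A I))"
    and "\<And>I J x. I \<in> arcs \<Longrightarrow> J \<in> arcs \<Longrightarrow> I \<subseteq> J \<Longrightarrow> x \<in> A I \<Longrightarrow> \<phi> J x = \<phi> I x"
    and vac: "\<And>I x. I \<in> arcs \<Longrightarrow> x \<in> A I \<Longrightarrow> cinner \<Omega> (\<phi> I x \<Omega>) = cinner \<Omega> (x \<Omega>)"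
    and "\<And>I g x. I \<in> arcs \<Longrightarrow> g \<in> PSL2 \<Longrightarrow> x \<in> A (g ` I) \<Longrightarrow>
        Ad (U g) (\<phi> I (Ad (inv (U g)) x)) = \<phi> (g ` I) x"
    and "\<And>I x. I \<in> arcs \<Longrightarrow> x \<in> Vir U I \<Longrightarrow> \<phi> I x = x"
  shows "\<phi> \<in> UCP A U \<Omega>"
proof -
  have "normal_map (A I) (\<phi> I) \<and> faithful_map (A I) (\<phi> I)" if I: "I \<in> arcs" for I
  proof -
    interpret vacuum_algebra "A I" \<Omega> by (rule arc_vacuum_algebra[OF I])
    interpret vacuum_preserving_map "A I" \<Omega> "\<phi> I"
      by unfold_locales (use ucp I vac in auto)
    show ?thesis using normal faithful by blast
  qed
  then show ?thesis
    unfolding UCP_def mem_Collect_eq by (intro conjI ballI impI assms) auto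
qed

lemma Ad_inv_mem:
  assumes I: "I \<in> arcs" and g: "g \<in> PSL2" and x: "x \<in> A (g ` I)"
  shows "Ad (inv (U g)) x \<in> A I"
proof -
  obtain y where y: "y \<in> A I" "x = Ad (U g) y" using x PSL2_covariance[OF I g] by blast
  have "inv (inv (U g)) = U g" by (rule inv_inv_eq[OF U_bij[OF g]])
  then have "Ad (inv (U g)) x = y"
    using U_inv_cancel[OF g] by (auto simp: y(2) Ad_def)
  then show ?thesis using y(1) by simp
qed

lemma ucp_maps_bounded:
  assumes "\<phi> \<in> ucp_maps (A I)" "I \<in> arcs" "x \<in> A I" shows "\<phi> x \<in> bounded_ops" "\<phi> x \<in> A I"
  using ucp_closed[OF assms(1,3)] arc_bounded[OF assms(2)] by auto

lemma ucp_mapsI: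
  assumes I: "I \<in> arcs" and ext: "\<phi> \<in> A I \<rightarrow>\<^sub>E A I" and id: "\<phi> id = id"
    and lin: "\<And>x y c. x \<in> A I \<Longrightarrow> y \<in> A I \<Longrightarrow>
      \<phi> (\<lambda>\<xi>. x \<xi> + c *\<^sub>C y \<xi>) = (\<lambda>\<xi>. \<phi> x \<xi> + c *\<^sub>C \<phi> y \<xi>)"
    and pos: "\<And>n X \<zeta>. (\<And>i j. i < n \<Longrightarrow> j < n \<Longrightarrow> X i j \<in> A I) \<Longrightarrow> positive_matrix n X \<Longrightarrow>
      (\<Sum>i<n. \<Sum>j<n. cinner (\<zeta> i) (\<phi> (X i j) (\<zeta> j))) \<in> \<real>\<^sub>\<ge>\<^sub>0"
  shows "\<phi> \<in> ucp_maps (A I)"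
  using assms unfolding ucp_maps_def completely_positive_def positive_matrix_def[of _ "\<lambda>i j. \<phi> (_ i j)"]
  by (auto simp: positive_matrix_def)

section \<open>Convexity\<close>

lemma UCP_convex:
  assumes \<phi>: "\<phi> \<in> UCP A U \<Omega>" and \<psi>: "\<psi> \<in> UCP A U \<Omega>" and t: "t \<in> {0..1}"
  shows "convex_combination A t \<phi> \<psi> \<in> UCP A U \<Omega>"
proof -
  define \<rho> where "\<rho> = convex_combination A t \<phi> \<psi>"
  have val: "\<rho> I x = (\<lambda>\<xi>. t *\<^sub>R \<phi> I x \<xi> + (1 - t) *\<^sub>R \<psi> I x \<xi>)" if "I \<in> arcs" "x \<in> A I" for I x
    using that by (simp add: \<rho>_def convex_combination_def)
  have und: "\<rho> I x = undefined" if "I \<in> arcs" "x \<notin> A I" for I x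
    using that by (simp add: \<rho>_def convex_combination_def)
  have same: "t *\<^sub>R a + (1 - t) *\<^sub>R a = (a::'h)" for a
    by (simp flip: scaleR_add_left)
  have "\<rho> \<in> UCP A U \<Omega>"
  proof (rule UCP_I)
    have "\<rho> I \<in> ucp_maps (A I)" if I: "I \<in> arcs" for I
    proof (rule ucp_mapsI[OF I])
      note f = UCP_ucp[OF \<phi> I] and p = UCP_ucp[OF \<psi> I]
      have mem: "\<rho> I x \<in> A I" if x: "x \<in> A I" for x
        using von_neumann_lincomb[OF von_neumann[OF I] ucp_closed[OF f x] ucp_closed[OF p x],
            of "of_real t" "of_real (1 - t)"]
        unfolding val[OF I x] scaleC_of_real .
      show "\<rho> I \<in> A I \<rightarrow>\<^sub>E A I" using mem und[OF I] by auto
      show "\<rho> I id = id"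
        using val[OF I von_neumann_id[OF von_neumann[OF I]]] by (simp add: ucp_id[OF f] ucp_id[OF p] same fun_eq_iff)
      show "\<rho> I (\<lambda>\<xi>. x \<xi> + c *\<^sub>C y \<xi>) = (\<lambda>\<xi>. \<rho> I x \<xi> + c *\<^sub>C \<rho> I y \<xi>)"
        if xy: "x \<in> A I" "y \<in> A I" for x y c
      proof -
        have "(\<lambda>\<xi>. x \<xi> + c *\<^sub>C y \<xi>) \<in> A I"
          using von_neumann_lincomb[OF von_neumann[OF I] xy, of 1 c] by simp
        then show ?thesis
          by (simp add: val I xy ucp_linear[OF f] ucp_linear[OF p] scaleC_add_right scaleR_add_right scaleC_scaleR add_ac)
      qed
      fix n X \<zeta> assume X: "\<And>i j. i < n \<Longrightarrow> j < n \<Longrightarrow> X i j \<in> A I" "positive_matrix n X"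
      have "(\<Sum>i<n. \<Sum>j<n. cinner (\<zeta> i) (\<rho> I (X i j) (\<zeta> j))) =
          (\<Sum>i<n. \<Sum>j<n. of_real t * cinner (\<zeta> i) (\<phi> I (X i j) (\<zeta> j))
            + of_real (1 - t) * cinner (\<zeta> i) (\<psi> I (X i j) (\<zeta> j)))"
        by (intro sum.cong refl) (simp add: val I X(1) cinner_add_right cinner_scaleR_right scaleR_conv_of_real)
      also have "\<dots> = of_real t * (\<Sum>i<n. \<Sum>j<n. cinner (\<zeta> i) (\<phi> I (X i j) (\<zeta> j)))
          + of_real (1 - t) * (\<Sum>i<n. \<Sum>j<n. cinner (\<zeta> i) (\<psi> I (X i j) (\<zeta> j)))"
        by (simp only: sum.distrib sum_distrib_left)
      also have "\<dots> \<in> \<real>\<^sub>\<ge>\<^sub>0"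
      proof -
        have t': "complex_of_real t \<in> \<real>\<^sub>\<ge>\<^sub>0" "complex_of_real (1 - t) \<in> \<real>\<^sub>\<ge>\<^sub>0"
          unfolding nonneg_Reals_of_real_iff using t by auto
        show ?thesis
          using ucp_positive_matrix[OF f X] ucp_positive_matrix[OF p X]
          unfolding positive_matrix_def by (intro nonneg_Reals_add_I nonneg_Reals_mult_I t') blast+
      qed
      finally show "(\<Sum>i<n. \<Sum>j<n. cinner (\<zeta> i) (\<rho> I (X i j) (\<zeta> j))) \<in> \<real>\<^sub>\<ge>\<^sub>0" .
    qed
    then show "\<rho> \<in> (\<Pi>\<^sub>E I\<in>arcs. ucp_maps (A I))"
      by (auto simp: \<rho>_def convex_combination_def)
  next
    fix I J x assume IJ: "I \<in> arcs" "J \<in> arcs" "I \<subseteq> J" and x: "x \<in> A I"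
    then have "x \<in> A J" using isotony by blast
    then show "\<rho> J x = \<rho> I x"
      using IJ x by (simp add: val UCP_isotone[OF \<phi> IJ x] UCP_isotone[OF \<psi> IJ x])
  next
    fix I x assume I: "I \<in> arcs" and x: "x \<in> A I"
    show "cinner \<Omega> (\<rho> I x \<Omega>) = cinner \<Omega> (x \<Omega>)"
      by (simp add: val I x cinner_add_right cinner_scaleR_right UCP_vacuum[OF \<phi> I x] UCP_vacuum[OF \<psi> I x]
          flip: scaleR_add_left)
  next
    fix I g x assume I: "I \<in> arcs" and g: "g \<in> PSL2" and x: "x \<in> A (g ` I)"
    let ?y = "Ad (inv (U g)) x"
    have y: "?y \<in> A I" by (rule Ad_inv_mem[OF I g x])
    have gI: "g ` I \<in> arcs" by (rule PSL2_image_arcs[OF g I])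
    have "Ad (U g) (\<rho> I ?y) = (\<lambda>\<xi>. t *\<^sub>R Ad (U g) (\<phi> I ?y) \<xi> + (1 - t) *\<^sub>R Ad (U g) (\<psi> I ?y) \<xi>)"
      unfolding val[OF I y] by (simp add: Ad_def fun_eq_iff bounded_opsD[OF U_bounded[OF g]])
    also have "\<dots> = \<rho> (g ` I) x"
      unfolding val[OF gI x] UCP_covariant[OF \<phi> I g x] UCP_covariant[OF \<psi> I g x] ..
    finally show "Ad (U g) (\<rho> I ?y) = \<rho> (g ` I) x" .
  next
    fix I x assume I: "I \<in> arcs" and x: "x \<in> Vir U I"
    show "\<rho> I x = x"
    proof (cases "x \<in> A I")
      case True
      then show ?thesis by (simp add: val I UCP_Vir[OF \<phi> I x] UCP_Vir[OF \<psi> I x] same)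
    next
      \<comment> \<open>Outside \<open>A I\<close> both the combination and \<open>\<phi>\<close>
        take the value \<open>undefined\<close>, and the condition on \<open>\<phi>\<close> says
        that \<open>x\<close> equals it.\<close>
      case False
      then show ?thesis using und[OF I False] UCP_undefined[OF \<phi> I False] UCP_Vir[OF \<phi> I x] by simp
    qed
  qed
  then show ?thesis by (simp add: \<rho>_def)
qed

subsection \<open>Compactness\<close>

text \<open>A family of maps is encoded by its matrix elements \<open>\<langle>\<xi>, \<phi>\<^sub>I x \<eta>\<rangle>\<close>. In these coordinates the
  defining conditions are closed conditions on a product of discs.\<close>

type_synonym 'k matrix_elements = "complex set \<times> ('k \<Rightarrow> 'k) \<times> 'k \<times> 'k \<Rightarrow> complex"

text \<open>The radii are the bounds of \<open>ucp_contractive\<close>. Indices outside the net are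
  pinned to 0 so that every factor is compact.\<close>

definition disc_box :: "'h matrix_elements set" where
  "disc_box = {g. \<forall>i. g i \<in> (case i of (I, x, \<xi>, \<eta>) \<Rightarrow>
     if I \<in> arcs \<and> x \<in> A I then cball 0 (onorm x * norm \<xi> * norm \<eta>) else {0})}"

lemma disc_boxD:
  assumes "g \<in> disc_box" "I \<in> arcs" "x \<in> A I"
  shows "cmod (g (I, x, \<xi>, \<eta>)) \<le> onorm x * norm \<xi> * norm \<eta>"
proof -
  have "g (I, x, \<xi>, \<eta>) \<in> (case (I, x, \<xi>, \<eta>) of (I, x, \<xi>, \<eta>) \<Rightarrow>
     if I \<in> arcs \<and> x \<in> A I then cball 0 (onorm x * norm \<xi> * norm \<eta>) else {0})"
    using assms(1) unfolding disc_box_def by blast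
  then show ?thesis using assms(2,3) by simp
qed

text \<open>Sesquilinearity makes the coordinates those of operators. The clause with the commutant
  says, by the bicommutant property, that these lie in \<open>A I\<close>. The clause on
  \<open>Vir U I\<close> is confined to \<open>A I\<close>, where coordinates carry
  information.\<close>

definition admissible :: "'h matrix_elements \<Rightarrow> bool" where
  "admissible g \<longleftrightarrow>
     (\<forall>I x \<xi> \<xi>' \<eta>. I \<in> arcs \<and> x \<in> A I \<longrightarrow> g (I, x, \<xi> + \<xi>', \<eta>) = g (I, x, \<xi>, \<eta>) + g (I, x, \<xi>', \<eta>)) \<and>
     (\<forall>I x \<xi> \<eta> c. I \<in> arcs \<and> x \<in> A I \<longrightarrow> g (I, x, c *\<^sub>C \<xi>, \<eta>) = cnj c * g (I, x, \<xi>, \<eta>)) \<and>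
     (\<forall>I x \<xi> \<eta> \<eta>'. I \<in> arcs \<and> x \<in> A I \<longrightarrow> g (I, x, \<xi>, \<eta> + \<eta>') = g (I, x, \<xi>, \<eta>) + g (I, x, \<xi>, \<eta>')) \<and>
     (\<forall>I x \<xi> \<eta> c. I \<in> arcs \<and> x \<in> A I \<longrightarrow> g (I, x, \<xi>, c *\<^sub>C \<eta>) = c * g (I, x, \<xi>, \<eta>)) \<and>
     (\<forall>I x y \<xi> \<eta> c. I \<in> arcs \<and> x \<in> A I \<and> y \<in> A I \<longrightarrow>
        g (I, \<lambda>\<zeta>. x \<zeta> + c *\<^sub>C y \<zeta>, \<xi>, \<eta>) = g (I, x, \<xi>, \<eta>) + c * g (I, y, \<xi>, \<eta>)) \<and>
     (\<forall>I n X \<zeta>. I \<in> arcs \<and> (\<forall>i<n. \<forall>j<n. X i j \<in> A I) \<and> positive_matrix n X \<longrightarrow>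
        (\<Sum>i<n. \<Sum>j<n. g (I, X i j, \<zeta> i, \<zeta> j)) \<in> \<real>\<^sub>\<ge>\<^sub>0) \<and>
     (\<forall>I \<xi> \<eta>. I \<in> arcs \<longrightarrow> g (I, id, \<xi>, \<eta>) = cinner \<xi> \<eta>) \<and>
     (\<forall>I x y \<xi> \<eta>. I \<in> arcs \<and> x \<in> A I \<and> y \<in> commutant (A I) \<longrightarrow> g (I, x, \<xi>, y \<eta>) = g (I, x, adj y \<xi>, \<eta>)) \<and>
     (\<forall>I J x \<xi> \<eta>. I \<in> arcs \<and> J \<in> arcs \<and> I \<subseteq> J \<and> x \<in> A I \<longrightarrow> g (J, x, \<xi>, \<eta>) = g (I, x, \<xi>, \<eta>)) \<and>
     (\<forall>I x. I \<in> arcs \<and> x \<in> A I \<longrightarrow> g (I, x, \<Omega>, \<Omega>) = cinner \<Omega> (x \<Omega>)) \<and>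
     (\<forall>I h x \<xi> \<eta>. I \<in> arcs \<and> h \<in> PSL2 \<and> x \<in> A (h ` I) \<longrightarrow>
        g (I, Ad (inv (U h)) x, inv (U h) \<xi>, inv (U h) \<eta>) = g (h ` I, x, \<xi>, \<eta>)) \<and>
     (\<forall>I x \<xi> \<eta>. I \<in> arcs \<and> x \<in> A I \<and> x \<in> Vir U I \<longrightarrow> g (I, x, \<xi>, \<eta>) = cinner \<xi> (x \<eta>))"

definition coordinates :: "'h matrix_elements set" where
  "coordinates = {g \<in> disc_box. admissible g}"

text \<open>Each clause of \<open>admissible\<close> is an equation or a sign condition involving
  finitely many coordinates, hence closed.\<close>

lemma compact_coordinates: "compact coordinates"
proof -
  have "compact disc_box"
    unfolding disc_box_def by (rule compact_coordinate_box) (auto split: prod.split)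
  moreover have "closed {g. admissible g}"
    unfolding admissible_def complex_nonneg_Reals_iff
    by (intro closed_Collect_conj closed_Collect_all closed_Collect_const_imp closed_Collect_eq
        closed_Collect_le continuous_intros continuous_on_coordinate)
  moreover have "coordinates = disc_box \<inter> {g. admissible g}" by (auto simp: coordinates_def)
  ultimately show ?thesis by (simp add: compact_Int_closed)
qed

definition family_of :: "'h matrix_elements \<Rightarrow> complex set \<Rightarrow> ('h \<Rightarrow> 'h) \<Rightarrow> ('h \<Rightarrow> 'h)" where
  "family_of g = (\<lambda>I\<in>arcs. \<lambda>x\<in>A I. SOME T. T \<in> bounded_ops \<and> (\<forall>\<xi> \<eta>. cinner \<xi> (T \<eta>) = g (I, x, \<xi>, \<eta>)))"

lemma family_of:
  assumes g: "g \<in> coordinates" and I: "I \<in> arcs" and x: "x \<in> A I"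
  shows family_of_bounded: "family_of g I x \<in> bounded_ops"
    and cinner_family_of: "cinner \<xi> (family_of g I x \<eta>) = g (I, x, \<xi>, \<eta>)"
proof -
  have adm: "admissible g" and box: "g \<in> disc_box" using g by (auto simp: coordinates_def)
  have "\<exists>T\<in>bounded_ops. (\<forall>\<xi> \<eta>. cinner \<xi> (T \<eta>) = g (I, x, \<xi>, \<eta>)) \<and> (\<forall>\<eta>. norm (T \<eta>) \<le> onorm x * norm \<eta>)"
  proof (rule sesquilinear_form_op)
    show "cmod (g (I, x, \<xi>, \<eta>)) \<le> onorm x * norm \<xi> * norm \<eta>" for \<xi> \<eta>
      by (rule disc_boxD[OF box I x])
    show "onorm x \<ge> 0" by (rule bounded_opsD(10)[OF arc_bounded[OF I x]])
  qed (use adm I x in \<open>simp_all add: admissible_def\<close>)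
  then have "\<exists>T. T \<in> bounded_ops \<and> (\<forall>\<xi> \<eta>. cinner \<xi> (T \<eta>) = g (I, x, \<xi>, \<eta>))" by blast
  from someI_ex[OF this] I x
  show "family_of g I x \<in> bounded_ops" "cinner \<xi> (family_of g I x \<eta>) = g (I, x, \<xi>, \<eta>)"
    by (simp_all add: family_of_def)
qed

text \<open>The element \<open>\<phi>\<^sub>0\<close> serves one purpose: it shows that an operator
  of \<open>Vir U I\<close> outside \<open>A I\<close> equals \<open>undefined\<close>, as the
  decoded family requires.\<close>

lemma family_of_UCP:
  assumes g: "g \<in> coordinates" and \<phi>\<^sub>0: "\<phi>\<^sub>0 \<in> UCP A U \<Omega>"
  shows "family_of g \<in> UCP A U \<Omega>"
proof -
  let ?F = "family_of g"
  have adm: "admissible g" using g by (simp add: coordinates_def)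
  note b = family_of_bounded[OF g] and e = cinner_family_of[OF g]
  have und: "?F I x = undefined" if "I \<in> arcs" "x \<notin> A I" for I x
    using that by (simp add: family_of_def)
  have eqI: "S = T" if "\<And>\<xi> \<eta>. cinner \<xi> (S \<eta>) = cinner \<xi> (T \<eta>)" for S T :: "'h \<Rightarrow> 'h"
    by (rule ext, rule cinner_eqI, rule that)
  show ?thesis
  proof (rule UCP_I)
    have "?F I \<in> ucp_maps (A I)" if I: "I \<in> arcs" for I
    proof (rule ucp_mapsI[OF I])
      note vN = von_neumann[OF I]
      have mem: "?F I x \<in> A I" if x: "x \<in> A I" for x
      proof -
        \<comment> \<open>Membership in \<open>A I\<close> is proved through the bicommutant, since
          commutation is visible in matrix elements.\<close>
        have "?F I x \<in> commutant (commutant (A I))"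
        proof (rule commutantI[OF b[OF I x]])
          fix y \<eta> assume y: "y \<in> commutant (A I)"
          then have yb: "y \<in> bounded_ops" using commutant_bounded_ops by blast
          show "y (?F I x \<eta>) = ?F I x (y \<eta>)"
          proof (rule cinner_eqI)
            fix \<xi>
            have "cinner \<xi> (y (?F I x \<eta>)) = g (I, x, adj y \<xi>, \<eta>)"
              by (simp add: cinner_adj_left[OF yb, symmetric] e I x)
            also have "\<dots> = g (I, x, \<xi>, y \<eta>)" using adm I x y by (simp add: admissible_def)
            finally show "cinner \<xi> (y (?F I x \<eta>)) = cinner \<xi> (?F I x (y \<eta>))" by (simp add: e I x)
          qed
        qed
        then show ?thesis by (simp add: von_neumann_bicommutant[OF vN])
      qed
      show "?F I \<in> A I \<rightarrow>\<^sub>E A I" using mem und[OF I] by auto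
      show "?F I id = id"
        using adm I von_neumann_id[OF vN] by (intro eqI) (simp add: e admissible_def)
      show "?F I (\<lambda>\<xi>. x \<xi> + c *\<^sub>C y \<xi>) = (\<lambda>\<xi>. ?F I x \<xi> + c *\<^sub>C ?F I y \<xi>)"
        if xy: "x \<in> A I" "y \<in> A I" for x y c
      proof (rule eqI)
        have "(\<lambda>\<xi>. x \<xi> + c *\<^sub>C y \<xi>) \<in> A I"
          using von_neumann_lincomb[OF vN xy, of 1 c] by simp
        then show "cinner \<xi> (?F I (\<lambda>\<xi>. x \<xi> + c *\<^sub>C y \<xi>) \<eta>) = cinner \<xi> (?F I x \<eta> + c *\<^sub>C ?F I y \<eta>)" for \<xi> \<eta>
          using adm I xy by (simp add: e cinner_add_right cinner_scaleC_right admissible_def)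
      qed
      fix n X \<zeta> assume X: "\<And>i j. i < n \<Longrightarrow> j < n \<Longrightarrow> X i j \<in> A I" "positive_matrix n X"
      have "(\<Sum>i<n. \<Sum>j<n. cinner (\<zeta> i) (?F I (X i j) (\<zeta> j))) = (\<Sum>i<n. \<Sum>j<n. g (I, X i j, \<zeta> i, \<zeta> j))"
        by (intro sum.cong refl) (simp add: e I X(1))
      then show "(\<Sum>i<n. \<Sum>j<n. cinner (\<zeta> i) (?F I (X i j) (\<zeta> j))) \<in> \<real>\<^sub>\<ge>\<^sub>0"
        using adm I X by (simp add: admissible_def)
    qed
    then show "?F \<in> (\<Pi>\<^sub>E I\<in>arcs. ucp_maps (A I))" by (auto simp: family_of_def)
  next
    fix I J x assume IJ: "I \<in> arcs" "J \<in> arcs" "I \<subseteq> J" and x: "x \<in> A I"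
    then have xJ: "x \<in> A J" using isotony by blast
    show "?F J x = ?F I x"
      using adm IJ x xJ by (intro eqI) (simp add: e admissible_def)
  next
    fix I x assume I: "I \<in> arcs" and x: "x \<in> A I"
    show "cinner \<Omega> (?F I x \<Omega>) = cinner \<Omega> (x \<Omega>)"
      using adm I x by (simp add: e admissible_def)
  next
    fix I h x assume I: "I \<in> arcs" and h: "h \<in> PSL2" and x: "x \<in> A (h ` I)"
    have y: "Ad (inv (U h)) x \<in> A I" by (rule Ad_inv_mem[OF I h x])
    have hI: "h ` I \<in> arcs" by (rule PSL2_image_arcs[OF h I])
    show "Ad (U h) (?F I (Ad (inv (U h)) x)) = ?F (h ` I) x"
    proof (rule eqI)
      fix \<xi> \<eta>
      have "cinner \<xi> (Ad (U h) (?F I (Ad (inv (U h)) x)) \<eta>) =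
          cinner (inv (U h) \<xi>) (?F I (Ad (inv (U h)) x) (inv (U h) \<eta>))"
        unfolding Ad_def[of "U h"] by (simp add: cinner_inv_unitary_left[OF PSL2_unitary[OF h]])
      also have "\<dots> = g (h ` I, x, \<xi>, \<eta>)"
        unfolding e[OF I y] using adm I h x by (simp add: admissible_def)
      finally show "cinner \<xi> (Ad (U h) (?F I (Ad (inv (U h)) x)) \<eta>) = cinner \<xi> (?F (h ` I) x \<eta>)"
        by (simp add: e[OF hI x])
    qed
  next
    fix I x assume I: "I \<in> arcs" and x: "x \<in> Vir U I"
    show "?F I x = x"
    proof (cases "x \<in> A I")
      case True
      then show ?thesis using adm I x by (intro eqI) (simp add: e admissible_def)
    next
      case False
      then show ?thesis using und[OF I] UCP_undefined[OF \<phi>\<^sub>0 I] UCP_Vir[OF \<phi>\<^sub>0 I x] by simp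
    qed
  qed
qed

lemma family_of_surj:
  assumes \<phi>: "\<phi> \<in> UCP A U \<Omega>" shows "\<phi> \<in> family_of ` coordinates"
proof -
  define g :: "'h matrix_elements"
    where "g = (\<lambda>(I, x, \<xi>, \<eta>). if I \<in> arcs \<and> x \<in> A I then cinner \<xi> (\<phi> I x \<eta>) else 0)"
  have ev: "g (I, x, \<xi>, \<eta>) = cinner \<xi> (\<phi> I x \<eta>)" if "I \<in> arcs" "x \<in> A I" for I x \<xi> \<eta>
    using that by (simp add: g_def)
  have b: "\<phi> I x \<in> bounded_ops" "\<phi> I x \<in> A I" if "I \<in> arcs" "x \<in> A I" for I x
    using ucp_maps_bounded[OF UCP_ucp[OF \<phi>]] that by auto
  have box: "g \<in> disc_box"
    using ucp_contractive[OF UCP_ucp[OF \<phi>] von_neumann]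
    by (auto simp: disc_box_def g_def)
  have lincomb: "(\<lambda>\<zeta>. x \<zeta> + c *\<^sub>C y \<zeta>) \<in> A I" if "I \<in> arcs" "x \<in> A I" "y \<in> A I" for I x y c
    using von_neumann_lincomb[OF von_neumann that(2,3), of 1 c] that by simp
  have adm: "admissible g"
    unfolding admissible_def
  proof (intro conjI allI impI; (elim conjE)?)
    fix I n X \<zeta> assume X: "I \<in> arcs" "\<forall>i<n. \<forall>j<n. X i j \<in> A I" "positive_matrix n X"
    have "(\<Sum>i<n. \<Sum>j<n. g (I, X i j, \<zeta> i, \<zeta> j)) = (\<Sum>i<n. \<Sum>j<n. cinner (\<zeta> i) (\<phi> I (X i j) (\<zeta> j)))"
      using X by (intro sum.cong refl) (simp add: ev)
    then show "(\<Sum>i<n. \<Sum>j<n. g (I, X i j, \<zeta> i, \<zeta> j)) \<in> \<real>\<^sub>\<ge>\<^sub>0"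
      using ucp_positive_matrix[OF UCP_ucp[OF \<phi> X(1)] _ X(3)] X by (simp add: positive_matrix_def)
  next
    fix I x y \<xi> \<eta> assume I: "I \<in> arcs" "x \<in> A I" "y \<in> commutant (A I)"
    then have "y \<in> bounded_ops" using commutant_bounded_ops by blast
    then show "g (I, x, \<xi>, y \<eta>) = g (I, x, adj y \<xi>, \<eta>)"
      using I commutantD[OF I(3) b(2)[OF I(1,2)]] by (simp add: ev cinner_adj_left)
  next
    fix I J x \<xi> \<eta> assume IJ: "I \<in> arcs" "J \<in> arcs" "I \<subseteq> J" "x \<in> A I"
    then have "x \<in> A J" using isotony by blast
    then show "g (J, x, \<xi>, \<eta>) = g (I, x, \<xi>, \<eta>)" using IJ by (simp add: ev UCP_isotone[OF \<phi> IJ])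
  next
    fix I h x \<xi> \<eta> assume I: "I \<in> arcs" and h: "h \<in> PSL2" and x: "x \<in> A (h ` I)"
    show "g (I, Ad (inv (U h)) x, inv (U h) \<xi>, inv (U h) \<eta>) = g (h ` I, x, \<xi>, \<eta>)"
      unfolding ev[OF I Ad_inv_mem[OF I h x]] ev[OF PSL2_image_arcs[OF h I] x]
        UCP_covariant[OF \<phi> I h x, symmetric] Ad_def[of "U h"]
      by (simp add: cinner_inv_unitary_left[OF PSL2_unitary[OF h]])
  qed (simp_all add: ev b bounded_opsD[OF b(1)] cinner_add_left cinner_add_right cinner_scaleC_left cinner_scaleC_right
      lincomb ucp_linear[OF UCP_ucp[OF \<phi>]] von_neumann_id[OF von_neumann] ucp_id[OF UCP_ucp[OF \<phi>]]
      UCP_vacuum[OF \<phi>] UCP_Vir[OF \<phi>])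
  have g: "g \<in> coordinates" using box adm by (simp add: coordinates_def)
  have "family_of g I x = \<phi> I x" if "I \<in> arcs" for I x
  proof (cases "x \<in> A I")
    case True
    then show ?thesis
      using that by - (rule ext, rule cinner_eqI, simp add: cinner_family_of[OF g] ev)
  next
    case False
    then show ?thesis using that UCP_undefined[OF \<phi>] by (simp add: family_of_def)
  qed
  moreover have "family_of g I = undefined" "\<phi> I = undefined" if "I \<notin> arcs" for I
    using that UCP_PiE[OF \<phi>] by (auto simp: family_of_def)
  ultimately have "family_of g = \<phi>" by (metis ext)
  then show ?thesis using g by blast
qed

text \<open>The coordinates control single matrix elements. An ultraweak functional is a series of
  them, dominated by \<open>onorm x\<close> times the products of the norms uniformly in
  \<open>g\<close>, so the Weierstrass test makes it continuous.\<close>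

lemma family_of_continuous:
  assumes \<phi>\<^sub>0: "\<phi>\<^sub>0 \<in> UCP A U \<Omega>"
  shows "continuous_map (top_of_set coordinates) (UCP_topology A U \<Omega>) family_of"
proof -
  note U = family_of_UCP[OF _ \<phi>\<^sub>0]
  have series: "continuous_on coordinates (\<lambda>g. \<Sum>n. cinner (\<xi> n) (family_of g I x (\<eta> n)))"
    if I: "I \<in> arcs" and x: "x \<in> A I" and s: "\<xi> \<in> square_summable" "\<eta> \<in> square_summable" for I x \<xi> \<eta>
  proof -
    have summ: "summable (\<lambda>n. onorm x * (norm (\<xi> n) * norm (\<eta> n)))"
      using s by (intro summable_mult square_summable_product) (auto simp: square_summable_def)
    have bd: "norm (g (I, x, \<xi> n, \<eta> n)) \<le> onorm x * (norm (\<xi> n) * norm (\<eta> n))" if "g \<in> coordinates" for g n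
      using disc_boxD[OF _ I x, of g "\<xi> n" "\<eta> n"] that by (simp add: coordinates_def mult.assoc)
    have "uniform_limit coordinates (\<lambda>n g. \<Sum>i<n. g (I, x, \<xi> i, \<eta> i)) (\<lambda>g. \<Sum>i. g (I, x, \<xi> i, \<eta> i)) sequentially"
      by (rule Weierstrass_m_test[OF bd summ])
    then have "continuous_on coordinates (\<lambda>g. \<Sum>i. g (I, x, \<xi> i, \<eta> i))"
      by (rule uniform_limit_theorem[rotated])
        (auto intro!: always_eventually continuous_intros continuous_on_coordinate)
    then show ?thesis
      by (rule continuous_on_eq) (simp add: cinner_family_of I x)
  qed
  show ?thesis
    unfolding UCP_topology_def
  proof (rule continuous_map_into_coarsest)
    show "family_of ` topspace (top_of_set coordinates) \<subseteq> UCP A U \<Omega>" using U by auto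
    fix I assume I: "I \<in> arcs"
    show "continuous_map (top_of_set coordinates) (pointwise_ultraweak_topology (A I)) ((\<lambda>\<phi>. \<phi> I) \<circ> family_of)"
      unfolding pointwise_ultraweak_topology_def
    proof (rule continuous_map_into_coarsest)
      show "((\<lambda>\<phi>. \<phi> I) \<circ> family_of) ` topspace (top_of_set coordinates) \<subseteq> ucp_maps (A I)"
        using UCP_ucp[OF U I] by auto
      fix x assume x: "x \<in> A I"
      show "continuous_map (top_of_set coordinates) (ultraweak_topology (A I))
          ((\<lambda>\<phi>. \<phi> x) \<circ> ((\<lambda>\<phi>. \<phi> I) \<circ> family_of))"
        unfolding ultraweak_topology_def
      proof (rule continuous_map_into_coarsest)
        show "((\<lambda>\<phi>. \<phi> x) \<circ> ((\<lambda>\<phi>. \<phi> I) \<circ> family_of)) ` topspace (top_of_set coordinates) \<subseteq> A I"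
          using ucp_closed[OF UCP_ucp[OF U I] x] by auto
        fix j :: "(nat \<Rightarrow> 'h) \<times> (nat \<Rightarrow> 'h)" assume "j \<in> square_summable \<times> square_summable"
        then show "continuous_map (top_of_set coordinates) euclidean
            ((case j of (\<xi>, \<eta>) \<Rightarrow> \<lambda>x. \<Sum>n. cinner (\<xi> n) (x (\<eta> n))) \<circ> ((\<lambda>\<phi>. \<phi> x) \<circ> ((\<lambda>\<phi>. \<phi> I) \<circ> family_of)))"
          using series[OF I x] by (cases j) (simp add: o_def)
      qed
    qed
  qed
qed

lemma UCP_compact: "compact_space (UCP_topology A U \<Omega>)"
\<comment> \<open>Decoding needs a base point; the empty space is compact anyway.\<close>
proof (cases "UCP A U \<Omega> = {}")
  case True
  then show ?thesis by (simp add: compact_space_def)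
next
  case False
  then obtain \<phi>\<^sub>0 where \<phi>\<^sub>0: "\<phi>\<^sub>0 \<in> UCP A U \<Omega>" by blast
  have "compactin (UCP_topology A U \<Omega>) (family_of ` coordinates)"
    by (rule image_compactin[OF _ family_of_continuous[OF \<phi>\<^sub>0]])
      (simp add: compactin_subtopology compact_coordinates)
  moreover have "family_of ` coordinates = UCP A U \<Omega>"
    using family_of_UCP[OF _ \<phi>\<^sub>0] family_of_surj by blast
  ultimately show ?thesis by (simp add: compact_space_def)
qed

section \<open>Separation by matrix elements\<close>

lemma UCP_Hausdorff: "Hausdorff_space (UCP_topology A U \<Omega>)"
proof (rule Hausdorff_space_separating)
  fix \<phi> \<psi> assume "\<phi> \<in> topspace (UCP_topology A U \<Omega>)" "\<psi> \<in> topspace (UCP_topology A U \<Omega>)" "\<phi> \<noteq> \<psi>"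
  then have \<phi>: "\<phi> \<in> UCP A U \<Omega>" and \<psi>: "\<psi> \<in> UCP A U \<Omega>" and ne: "\<phi> \<noteq> \<psi>" by auto
  obtain I where I: "I \<in> arcs" "\<phi> I \<noteq> \<psi> I"
    using PiE_ext[OF UCP_PiE[OF \<phi>] UCP_PiE[OF \<psi>]] ne by blast
  obtain x where x: "x \<in> A I" "\<phi> I x \<noteq> \<psi> I x"
    using I UCP_undefined[OF \<phi> I(1)] UCP_undefined[OF \<psi> I(1)] by (metis ext)
  obtain \<xi> \<eta> where ne: "cinner \<xi> (\<phi> I x \<eta>) \<noteq> cinner \<xi> (\<psi> I x \<eta>)"
    using x(2) cinner_eqI by (metis ext)
  \<comment> \<open>Sequences supported at 0 turn a single matrix element into one of the
    functionals defining the ultraweak topology.\<close>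
  define a b :: "nat \<Rightarrow> 'h" where "a n = (if n = 0 then \<xi> else 0)" and "b n = (if n = 0 then \<eta> else 0)" for n
  have ss: "(a, b) \<in> square_summable \<times> square_summable"
    by (auto simp: square_summable_def a_def b_def intro!: summable_finite[of "{0}"] split: if_splits)
  let ?q = "\<lambda>x. \<Sum>n. cinner (a n) (x (b n))"
  have q: "?q x = cinner \<xi> (x \<eta>)" for x
    using suminf_finite[of "{0}" "\<lambda>n. cinner (a n) (x (b n))"] by (simp add: a_def b_def)
  have "continuous_map (ultraweak_topology (A I)) euclidean ?q"
    using continuous_map_coarsest_topology[OF ss, of "\<lambda>(\<xi>, \<eta>) x. \<Sum>n. cinner (\<xi> n) (x (\<eta> n))" "A I" "\<lambda>_. euclidean"]
    by (simp add: ultraweak_topology_def)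
  moreover have "continuous_map (pointwise_ultraweak_topology (A I)) (ultraweak_topology (A I)) (\<lambda>\<phi>. \<phi> x)"
    unfolding pointwise_ultraweak_topology_def
    by (rule continuous_map_coarsest_topology[OF x(1)])
      (auto simp: ultraweak_topology_def ucp_closed[OF _ x(1)])
  moreover have "continuous_map (UCP_topology A U \<Omega>) (pointwise_ultraweak_topology (A I)) (\<lambda>\<phi>. \<phi> I)"
    unfolding UCP_topology_def
    by (rule continuous_map_coarsest_topology[OF I(1)])
      (auto simp: pointwise_ultraweak_topology_def UCP_ucp[OF _ I(1)])
  ultimately have "continuous_map (UCP_topology A U \<Omega>) euclidean (?q \<circ> ((\<lambda>\<phi>. \<phi> x) \<circ> (\<lambda>\<phi>. \<phi> I)))"
    by (intro continuous_map_compose)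
  then show "\<exists>f :: (complex set \<Rightarrow> ('h \<Rightarrow> 'h) \<Rightarrow> 'h \<Rightarrow> 'h) \<Rightarrow> complex.
      continuous_map (UCP_topology A U \<Omega>) euclidean f \<and> f \<phi> \<noteq> f \<psi>"
    using ne by (intro exI[of _ "?q \<circ> ((\<lambda>\<phi>. \<phi> x) \<circ> (\<lambda>\<phi>. \<phi> I))"]) (simp add: q)
qed

end

theorem theorem4p10:
  fixes A :: "complex set \<Rightarrow> ('h::complex_hilbert \<Rightarrow> 'h) set"
    and U :: "(complex \<Rightarrow> complex) \<Rightarrow> 'h \<Rightarrow> 'h"
    and \<Omega> :: 'h
  assumes "conformal_net A U \<Omega>"
  shows "compact_space (UCP_topology A U \<Omega>) \<and>
    Hausdorff_space (UCP_topology A U \<Omega>) \<and>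
    (\<forall>\<phi>\<in>UCP A U \<Omega>. \<forall>\<psi>\<in>UCP A U \<Omega>. \<forall>t\<in>{0..1}. convex_combination A t \<phi> \<psi> \<in> UCP A U \<Omega>)"
proof -
  interpret conformal_net A U \<Omega> by fact
  show ?thesis using UCP_compact UCP_Hausdorff UCP_convex by blast
qed

end
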